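(* Let $g:\mathbb{R}\to\mathbb{R}$ be a continuous function such that, with $G(t):=\int_0^tg(\tau)\,d\tau$ for $t\in\mathbb{R}$: (1) there exist $a_1,a_2>0$ and $q\in[1,2^* )$ such that $|g(t)|\leq a_1+a_2|t|^{q-1}$ for all $t\in\mathbb{R}$; (2) $\displaystyle\liminf_{t\to0^+}\frac{G(t)}{t^2}=+\infty$. For any $\mu>0$ let $h_\mu:[0,+\infty)\to\mathbb{R}$ be the function defined by $$h_\mu(t):=\frac{t-\mu c_{2^*}^{2^*}\,t^{2^*-1}}{a_1c_{2^*}|\Omega|^{\frac{2^*-1}{2^*}}+a_2c_{2^*}^{q}|\Omega|^{\frac{2^*-q}{2^*}}t^{q-1}}\quad\text{for all } t\geq0.$$ Then, for all $\mu>0$ there exists a nonempty open interval $$\Lambda_\mu\subseteq\left(0,\max_{[0,+\infty)}h_\mu\right)$$ such that, for every $\lambda\in\Lambda_\mu$, the problem $$\begin{cases}-\mathcal{L}_Ku=\mu|u|^{2^*-2}u+\lambda g(u)&\text{in }\Omega\\ u=0&\text{in }\mathbb{R}^n\setminus\Omega\end{cases}$$ admits a non-trivial (i.e. not identically zero) weak solution $u_{0,\mu,\lambda}\in X_0$.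
   Context: Standing assumptions: $s\in(0,1)$, $n$ is a positive integer with $n>2s$, $\Omega\subset\mathbb{R}^n$ is (nonempty) open, bounded, with Lipschitz boundary, $|\Omega|$ is its Lebesgue measure, $\Omega^c:=\mathbb{R}^n\setminus\Omega$, and $2^*:=\frac{2n}{n-2s}$. The kernel $K:\mathbb{R}^n\setminus\{0\}\to(0,+\infty)$ satisfies: $wK\in L^1(\mathbb{R}^n)$ with $w(x):=\min\{|x|^2,1\}$; and there exists $k_0>0$ such that $K(x)\geq k_0|x|^{-(n+2s)}$ for all $x\in\mathbb{R}^n\setminus\{0\}$. The operator is $$\mathcal{L}_Ku(x):=\int_{\mathbb{R}^n}(u(x+y)+u(x-y)-2u(x))K(y)\,dy.$$ Let $Q:=\mathbb{R}^{2n}\setminus(\Omega^c\times\Omega^c)$. $X$ is the linear space of Lebesgue measurable functions $u:\mathbb{R}^n\to\mathbb{R}$ such that $u|_\Omega\in L^2(\Omega)$ and $(x,y)\mapsto(u(x)-u(y))\sqrt{K(x-y)}$ belongs to $L^2(Q,dx\,dy)$; $X_0:=\{u\in X:u=0\text{ a.e. in }\Omega^c\}$, a Hilbert space with scalar product $$\langle u,v\rangle:=\int_Q(u(x)-u(y))(v(x)-v(y))K(x-y)\,dx\,dy$$ and norm $\|u\|:=\langle u,u\rangle^{1/2}$. The embedding $X_0\hookrightarrow L^{2^*}(\mathbb{R}^n)$ is continuous and $$c_{2^*}:=\sup_{u\in X_0\setminus\{0\}}\frac{\|u\|_{L^{2^*}(\mathbb{R}^n)}}{\|u\|}.$$ A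 weak solution of the problem is a function $u\in X_0$ such that $\langle u,v\rangle-\mu\int_\Omega|u|^{2^*-2}uv\,dx-\lambda\int_\Omega g(u)v\,dx=0$ for every $v\in X_0$. Convention: $t^0=1$ for all $t\ge 0$. *)

theory Defs
  imports "HOL-Analysis.Analysis"
begin

text \<open>Near each boundary point, in suitable orthonormal coordinates whose last axis is \<open>e\<close>,
  the set is the strict epigraph of a Lipschitz function on the hyperplane orthogonal to \<open>e\<close>.\<close>

definition lipschitz_boundary :: "'a::euclidean_space set \<Rightarrow> bool" where
  "lipschitz_boundary \<Omega> \<longleftrightarrow>
    (\<forall>p \<in> frontier \<Omega>. \<exists>r > 0. \<exists>e \<phi> L. norm e = 1 \<and> L-lipschitz_on {y. y \<bullet> e = 0} \<phi> \<and>
      \<Omega> \<inter> ball p r = {x \<in> ball p r. \<phi> (x - (x \<bullet> e) *\<^sub>R e) < x \<bullet> e})"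

text \<open>Real powers of nonnegative reals with \<open>t\<^sup>0 = 1\<close> for all \<open>t \<ge> 0\<close>,
  in contrast to \<open>0 powr 0 = 0\<close>.\<close>

definition rpow :: "real \<Rightarrow> real \<Rightarrow> real" where
  "rpow t a = (if a = 0 then 1 else t powr a)"

definition primitive :: "(real \<Rightarrow> real) \<Rightarrow> real \<Rightarrow> real" where
  "primitive g t = (LBINT \<tau>=ereal 0..ereal t. g \<tau>)"

definition in_L2 :: "'a::euclidean_space set \<Rightarrow> ('a \<Rightarrow> real) \<Rightarrow> bool" where
  "in_L2 S f \<longleftrightarrow> f \<in> borel_measurable (lebesgue_on S) \<and> integrable (lebesgue_on S) (\<lambda>x. (f x)\<^sup>2)"

definition Q_set :: "'a::euclidean_space set \<Rightarrow> ('a \<times> 'a) set" where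
  "Q_set \<Omega> = - ((- \<Omega>) \<times> (- \<Omega>))"

text \<open>Elements of the function spaces are functions, not classes modulo equality almost
  everywhere; hence the zero vector is expressed by \<open>AE x in lebesgue. u x = 0\<close>.
  Kernels are total functions; their value at \<open>0\<close> is only ever multiplied by \<open>0\<close>.\<close>

definition X_space :: "'a::euclidean_space set \<Rightarrow> ('a \<Rightarrow> real) \<Rightarrow> ('a \<Rightarrow> real) set" where
  "X_space \<Omega> K = {u. u \<in> borel_measurable lebesgue \<and> in_L2 \<Omega> u \<and>
     in_L2 (Q_set \<Omega>) (\<lambda>(x, y). (u x - u y) * sqrt (K (x - y)))}"

definition X0_space :: "'a::euclidean_space set \<Rightarrow> ('a \<Rightarrow> real) \<Rightarrow> ('a \<Rightarrow> real) set" where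
  "X0_space \<Omega> K = {u \<in> X_space \<Omega> K. AE x in lebesgue. x \<in> - \<Omega> \<longrightarrow> u x = 0}"

definition X0_inner ::
  "'a::euclidean_space set \<Rightarrow> ('a \<Rightarrow> real) \<Rightarrow> ('a \<Rightarrow> real) \<Rightarrow> ('a \<Rightarrow> real) \<Rightarrow> real" where
  "X0_inner \<Omega> K u v =
     (LINT z:Q_set \<Omega>|lebesgue.
        (u (fst z) - u (snd z)) * (v (fst z) - v (snd z)) * K (fst z - snd z))"

definition X0_norm :: "'a::euclidean_space set \<Rightarrow> ('a \<Rightarrow> real) \<Rightarrow> ('a \<Rightarrow> real) \<Rightarrow> real" where
  "X0_norm \<Omega> K u = sqrt (X0_inner \<Omega> K u u)"

definition Lp_norm :: "real \<Rightarrow> ('a::euclidean_space \<Rightarrow> real) \<Rightarrow> real" where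
  "Lp_norm p u = (LINT x|lebesgue. \<bar>u x\<bar> powr p) powr (1 / p)"

text \<open>For the critical exponent, under the standing hypotheses on the kernel and the domain, the
  fractional Sobolev inequality makes the integrals in \<^const>\<open>Lp_norm\<close> converge on the space
  and the nonempty set below bounded above, so that \<open>Sup\<close> is a genuine supremum.\<close>

definition embedding_const :: "'a::euclidean_space set \<Rightarrow> ('a \<Rightarrow> real) \<Rightarrow> real \<Rightarrow> real" where
  "embedding_const \<Omega> K p =
     Sup {Lp_norm p u / X0_norm \<Omega> K u | u.
            u \<in> X0_space \<Omega> K \<and> \<not> (AE x in lebesgue. u x = 0)}"

definition weak_solution ::
  "'a::euclidean_space set \<Rightarrow> ('a \<Rightarrow> real) \<Rightarrow> real \<Rightarrow> real \<Rightarrow> real \<Rightarrow> (real \<Rightarrow> real) \<Rightarrow> ('a \<Rightarrow> real) \<Rightarrow> bool" where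
  "weak_solution \<Omega> K p \<mu> lam g u \<longleftrightarrow> u \<in> X0_space \<Omega> K \<and>
     (\<forall>v \<in> X0_space \<Omega> K.
        X0_inner \<Omega> K u v
        - \<mu> * (LINT x:\<Omega>|lebesgue. \<bar>u x\<bar> powr (p - 2) * u x * v x)
        - lam * (LINT x:\<Omega>|lebesgue. g (u x) * v x) = 0)"

end

theory Submission
  imports Defs "HOL-Complex_Analysis.Great_Picard"
begin

text \<open>
  The solution is a local minimiser of the energy functional
  \<open>J(u) = \<parallel>u\<parallel>\<^sup>2 / 2 - (\<mu> / p) \<integral> |u|\<^sup>p - \<lambda> \<integral> G(u)\<close> on a small ball of \<open>X\<^sub>0\<close>. Since any interval below the
  maximum of \<open>h\<^sub>\<mu>\<close> is admissible, it is enough to find a nontrivial solution for all sufficiently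
  small \<open>\<lambda> > 0\<close> and to know that the maximum of \<open>h\<^sub>\<mu>\<close> exists and is positive.

  Existence of a minimiser is the delicate point, because the embedding of \<open>X\<^sub>0\<close> into \<open>L\<^sup>p\<close> is not
  compact at the critical exponent. However, the critical term is of order \<open>p > 2\<close>, so on a ball of
  small radius its second variation is dominated by that of the quadratic term, and
  \<open>\<parallel>u\<parallel>\<^sup>2 / 2 - (\<mu> / p) \<integral> |u|\<^sup>p\<close> is strongly midpoint convex there (\<open>strongly_midpoint_convex\<close>). The other term
  has subcritical growth and is continuous along sequences of bounded energy that converge almost
  everywhere (\<open>potential_tendsto\<close>). A minimising sequence has a subsequence that converges almost
  everywhere (\<open>X0_compact\<close>); comparing the values of \<open>J\<close> at two of its members and at their midpoint
  bounds the distance of the two members, so the convergence is in norm and the limit is a minimiser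
  (\<open>minimizer_exists\<close>).

  For small \<open>\<lambda>\<close> the functional is positive on the sphere bounding the ball, whereas \<open>G(t) / t\<^sup>2 \<rightarrow> \<infinity>\<close> makes it
  negative at small multiples of a nonnegative bump (\<open>functional_negative\<close>). Hence the minimiser lies in the
  interior and is not zero, and the vanishing of the directional derivatives of \<open>J\<close> is exactly the weak
  formulation (\<open>minimizer_weak_solution\<close>).

  The analytic basis consists of two facts about the Gagliardo seminorm, carried over to \<open>X\<^sub>0\<close> by the lower
  bound for the kernel. The fractional Sobolev inequality follows from a pointwise estimate: if
  \<open>|u(x)| = T\<close>, then by Markov's inequality \<open>u\<close> is at most \<open>T / 2\<close> on half of a ball around \<open>x\<close> whose volume is
  comparable to \<open>\<parallel>u\<parallel>\<^sub>p\<^sup>p / T\<^sup>p\<close>, and this half alone contributes enough to the seminorm (\<open>sobolev_pointwise\<close>).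
  Compactness follows by replacing functions by their averages over the cells of a grid: the error is
  controlled by the seminorm, and the averages are countably many bounded sequences of numbers
  (\<open>gagliardo_compact\<close>).
\<close>

section \<open>The fractional Sobolev inequality\<close>

lemma fatou_AE_bound:
  fixes f :: "nat \<Rightarrow> 'a \<Rightarrow> real"
  assumes meas: "\<And>k. f k \<in> borel_measurable M"
    and lim: "AE x in M. (\<lambda>k. f k x) \<longlonglongrightarrow> h x"
    and bound: "eventually (\<lambda>k. (\<integral>\<^sup>+x. ennreal (f k x) \<partial>M) \<le> c) sequentially"
  shows "(\<integral>\<^sup>+x. ennreal (h x) \<partial>M) \<le> c"
proof -
  have "(\<integral>\<^sup>+x. ennreal (h x) \<partial>M) = (\<integral>\<^sup>+x. liminf (\<lambda>k. ennreal (f k x)) \<partial>M)"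
    by (intro nn_integral_cong_AE eventually_mono[OF lim])
      (auto intro!: lim_imp_Liminf[symmetric] tendsto_ennrealI)
  also have "\<dots> \<le> liminf (\<lambda>k. \<integral>\<^sup>+x. ennreal (f k x) \<partial>M)"
    using meas by (intro nn_integral_liminf) auto
  also have "\<dots> \<le> liminf (\<lambda>k. c)"
    by (intro Liminf_mono bound)
  also have "\<dots> = c" by (simp add: Liminf_const)
  finally show ?thesis .
qed

text \<open>The square of the Gagliardo seminorm. It is extended-valued, so the estimates below make sense before
  finiteness is known; on the diagonal the integrand is \<open>0\<close>.\<close>

definition gagliardo :: "real \<Rightarrow> ('a::euclidean_space \<Rightarrow> real) \<Rightarrow> ennreal" where
  "gagliardo s u = (\<integral>\<^sup>+x. \<integral>\<^sup>+y. ennreal ((u x - u y)\<^sup>2 * norm (x - y) powr (- (real DIM('a) + 2 * s))) \<partial>lborel \<partial>lborel)"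

text \<open>With \<open>T = |u(x)|\<close>, choose the radius \<open>r\<close> so that the Markov bound for \<open>|{|u| > T / 2}|\<close> is half of
  \<open>|ball x r|\<close>. On the rest of the ball \<open>|u(x) - u(y)| \<ge> T / 2\<close> and \<open>|x - y| < r\<close>, so the integral on the right is
  at least a constant times \<open>T\<^sup>2 r\<^sup>-\<^sup>2\<^sup>s\<close>; inserting \<open>r\<close> turns the power of \<open>T\<close> into \<open>p\<close>, since
  \<open>p = 2 + 2sp / n\<close>.\<close>

lemma sobolev_pointwise:
  fixes u :: "'a::euclidean_space \<Rightarrow> real"
  defines "n \<equiv> real DIM('a)"
  assumes s: "0 < s" "2 * s < n" and p: "p = 2 * n / (n - 2 * s)"
    and u: "u \<in> borel_measurable borel"
    and P: "0 < P" "(\<integral>\<^sup>+y. ennreal (\<bar>u y\<bar> powr p) \<partial>lborel) \<le> ennreal P"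
    and x: "u x \<noteq> 0"
  shows "ennreal (\<bar>u x\<bar> powr p) \<le> ennreal (8 / unit_ball_vol n * (2 powr (p + 1) / unit_ball_vol n) powr (2 * s / n) * P powr (2 * s / n)) *
           (\<integral>\<^sup>+y. ennreal ((u x - u y)\<^sup>2 * norm (x - y) powr (- (n + 2 * s))) \<partial>lborel)"
    (is "_ \<le> ennreal ?K * ?D")
proof -
  define T where "T = \<bar>u x\<bar>"
  have T: "0 < T" using x by (simp add: T_def)
  have n: "0 < n" by (simp add: n_def)
  define w where "w = unit_ball_vol n"
  have w: "0 < w" unfolding w_def using n by (intro unit_ball_vol_pos) auto
  have p0: "0 < p" using s n p by simp
  \<comment> \<open>the radius for which at most half of the ball is occupied by the superlevel set\<close>
  define r where "r = (2 powr (p + 1) * P / (w * T powr p)) powr (1 / n)"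
  have base: "0 < 2 powr (p + 1) * P / (w * T powr p)" using P T w by simp
  have r: "0 < r" unfolding r_def using P T w by simp
  have rn: "r ^ DIM('a) = 2 powr (p + 1) * P / (w * T powr p)"
  proof -
    have "r ^ DIM('a) = r powr n" using r by (simp add: powr_realpow n_def)
    also have "\<dots> = (2 powr (p + 1) * P / (w * T powr p)) powr 1"
      unfolding r_def powr_powr using n P T w by simp
    finally show ?thesis using base by (simp only: powr_one less_imp_le)
  qed
  have half: "w * r ^ DIM('a) / 2 = (2 / T) powr p * P"
    using w T P unfolding rn by (simp add: powr_add powr_divide field_simps)
  define A where "A = {y \<in> ball x r. \<bar>u y\<bar> \<le> T / 2}"
  define S where "S = {y. T / 2 < \<bar>u y\<bar>}"
  have [measurable]: "u \<in> borel_measurable borel" by fact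
  have S[measurable]: "S \<in> sets borel" unfolding S_def by measurable
  have A[measurable]: "A \<in> sets borel" unfolding A_def by measurable
  have "ennreal ((T / 2) powr p) * emeasure lborel S = (\<integral>\<^sup>+y. ennreal ((T / 2) powr p) * indicator S y \<partial>lborel)"
    by (simp add: nn_integral_cmult_indicator)
  also have "\<dots> \<le> (\<integral>\<^sup>+y. ennreal (\<bar>u y\<bar> powr p) \<partial>lborel)"
    using T p0 by (intro nn_integral_mono) (auto simp: S_def indicator_def intro!: ennreal_leI powr_mono2)
  also have "\<dots> \<le> ennreal P" by fact
  finally have "ennreal ((2 / T) powr p) * (ennreal ((T / 2) powr p) * emeasure lborel S) \<le> ennreal ((2 / T) powr p) * ennreal P"
    by (intro mult_left_mono) auto
  moreover have "ennreal ((2 / T) powr p) * ennreal ((T / 2) powr p) = 1"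
    using T by (simp add: ennreal_mult[symmetric] powr_mult[symmetric])
  ultimately have Smeas: "emeasure lborel S \<le> ennreal (w * r ^ DIM('a) / 2)"
    using P T by (simp add: half ennreal_mult mult.assoc[symmetric])
  have ball: "emeasure lborel (ball x r) = ennreal (w * r ^ DIM('a))"
    using r by (simp add: emeasure_ball w_def n_def)
  have "ball x r \<subseteq> A \<union> S" by (auto simp: A_def S_def)
  then have "ennreal (w * r ^ DIM('a)) \<le> emeasure lborel (A \<union> S)"
    unfolding ball[symmetric] by (intro emeasure_mono) auto
  also have "\<dots> \<le> emeasure lborel A + emeasure lborel S" by (intro emeasure_subadditive) auto
  also have "\<dots> \<le> emeasure lborel A + ennreal (w * r ^ DIM('a) / 2)" by (intro add_left_mono Smeas)
  finally have "ennreal (w * r ^ DIM('a) / 2) + ennreal (w * r ^ DIM('a) / 2) \<le> emeasure lborel A + ennreal (w * r ^ DIM('a) / 2)"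
    using w r by (simp flip: ennreal_plus)
  then have Ameas: "ennreal (w * r ^ DIM('a) / 2) \<le> emeasure lborel A"
    using ennreal_add_left_cancel_le[of "ennreal (w * r ^ DIM('a) / 2)"] by (simp add: add.commute)
  have "ennreal ((T / 2)\<^sup>2 * r powr (- (n + 2 * s))) * emeasure lborel A
      = (\<integral>\<^sup>+y. ennreal ((T / 2)\<^sup>2 * r powr (- (n + 2 * s))) * indicator A y \<partial>lborel)"
    by (simp add: nn_integral_cmult_indicator)
  also have "\<dots> \<le> ?D"
  proof (intro nn_integral_mono)
    fix y
    show "ennreal ((T / 2)\<^sup>2 * r powr (- (n + 2 * s))) * indicator A y \<le> ennreal ((u x - u y)\<^sup>2 * norm (x - y) powr (- (n + 2 * s)))"
    proof (cases "y \<in> A")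
      case True
      then have y: "norm (x - y) < r" "\<bar>u y\<bar> \<le> T / 2" by (auto simp: A_def dist_norm)
      then have "x \<noteq> y" using T by (auto simp: T_def)
      have "(T / 2)\<^sup>2 \<le> (u x - u y)\<^sup>2"
      proof -
        have "\<bar>T / 2\<bar> \<le> \<bar>u x - u y\<bar>" using y T unfolding T_def by linarith
        then show ?thesis by (rule abs_le_square_iff[THEN iffD1])
      qed
      moreover have "r powr (- (n + 2 * s)) \<le> norm (x - y) powr (- (n + 2 * s))"
        using y \<open>x \<noteq> y\<close> n s by (intro powr_mono2') auto
      ultimately have "(T / 2)\<^sup>2 * r powr (- (n + 2 * s)) \<le> (u x - u y)\<^sup>2 * norm (x - y) powr (- (n + 2 * s))"
        by (intro mult_mono) auto
      then show ?thesis using True by (simp add: ennreal_leI)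
    qed simp
  qed
  finally have le_D: "ennreal ((T / 2)\<^sup>2 * r powr (- (n + 2 * s))) * ennreal (w * r ^ DIM('a) / 2) \<le> ?D"
    using Ameas by (meson mult_left_mono order_trans zero_le)
  have "ennreal ((T / 2)\<^sup>2 * r powr (- (n + 2 * s))) * ennreal (w * r ^ DIM('a) / 2)
      = ennreal ((T / 2)\<^sup>2 * r powr (- (n + 2 * s)) * (w * r ^ DIM('a) / 2))"
    using w r by (subst ennreal_mult) auto
  also have "(T / 2)\<^sup>2 * r powr (- (n + 2 * s)) * (w * r ^ DIM('a) / 2) = w / 8 * T\<^sup>2 * r powr (- (2 * s))"
  proof -
    have "r powr (- (n + 2 * s)) * r ^ DIM('a) = r powr (- (n + 2 * s)) * r powr n"
      using r by (simp add: powr_realpow n_def)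
    also have "\<dots> = r powr (- (2 * s))" by (simp add: powr_add[symmetric])
    finally show ?thesis by (simp add: power2_eq_square field_simps)
  qed
  finally have D: "ennreal (w / 8 * T\<^sup>2 * r powr (- (2 * s))) \<le> ?D" using le_D by simp
  have rs: "r powr (2 * s) = (2 powr (p + 1) / w) powr (2 * s / n) * P powr (2 * s / n) * T powr (- (2 * s * p / n))"
    unfolding r_def powr_powr using w T P by (simp add: powr_divide powr_mult powr_powr powr_minus field_simps)
  have "p = 2 + 2 * s * p / n" using s n unfolding p by (simp add: field_simps)
  then have Tp: "T powr p = T\<^sup>2 * T powr (2 * s * p / n)"
    using T by (metis powr_add powr_numeral less_imp_le)
  have "?K * (w / 8 * T\<^sup>2 * r powr (- (2 * s))) = T powr p"
  proof -
    have "?K = 8 / w * (r powr (2 * s) * T powr (2 * s * p / n))"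
      unfolding rs w_def using T by (simp add: mult.assoc powr_add[symmetric])
    then show ?thesis using w r by (simp add: w_def[symmetric] Tp powr_minus field_simps)
  qed
  then have "ennreal (T powr p) = ennreal ?K * ennreal (w / 8 * T\<^sup>2 * r powr (- (2 * s)))"
    using w by (subst ennreal_mult[symmetric]) (auto simp: w_def)
  also have "\<dots> \<le> ennreal ?K * ?D" by (intro mult_left_mono D) auto
  finally show ?thesis by (simp add: T_def)
qed

text \<open>The factor in \<open>sobolev_pointwise\<close> without the power of \<open>P\<close>; it is a constant for the embedding, not the
  optimal one.\<close>

definition sobolev_const :: "real \<Rightarrow> real \<Rightarrow> real" where
  "sobolev_const n s = 8 / unit_ball_vol n * (2 powr (2 * n / (n - 2 * s) + 1) / unit_ball_vol n) powr (2 * s / n)"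

text \<open>Integrating the pointwise bound gives \<open>P \<le> C P\<^bsup>2s/n\<^esup> e\<close> for \<open>P = \<parallel>u\<parallel>\<^sub>p\<^sup>p\<close>. Dividing by \<open>P\<^bsup>2s/n\<^esup>\<close> requires \<open>P < \<infinity>\<close>,
  and the remaining exponent is \<open>1 - 2s / n = 2 / p\<close>.\<close>

lemma sobolev_inequality_of_finite_norm:
  fixes u :: "'a::euclidean_space \<Rightarrow> real"
  defines "n \<equiv> real DIM('a)"
  assumes s: "0 < s" "2 * s < n" and p: "p = 2 * n / (n - 2 * s)"
    and u: "u \<in> borel_measurable borel"
    and fin: "(\<integral>\<^sup>+y. ennreal (\<bar>u y\<bar> powr p) \<partial>lborel) < \<infinity>"
    and e: "0 \<le> e" "gagliardo s u \<le> ennreal e"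
  shows "(\<integral>\<^sup>+y. ennreal (\<bar>u y\<bar> powr p) \<partial>lborel) \<le> ennreal ((sobolev_const n s * e) powr (p / 2))"
proof -
  have n: "0 < n" by (simp add: n_def)
  have [measurable]: "u \<in> borel_measurable borel" by fact
  have w: "0 < unit_ball_vol n" using n by (intro unit_ball_vol_pos) auto
  have p0: "0 < p" using s n p by simp
  obtain P where P: "(\<integral>\<^sup>+y. ennreal (\<bar>u y\<bar> powr p) \<partial>lborel) = ennreal P" "0 \<le> P"
    using fin by (metis ennreal_cases infinity_ennreal_def order_less_irrefl)
  let ?C = "sobolev_const n s"
  have C: "0 \<le> ?C" using w by (simp add: sobolev_const_def)
  show ?thesis
  proof (cases "P = 0")
    case False
    then have P0: "0 < P" using P by simp
    let ?D = "\<lambda>x. \<integral>\<^sup>+y. ennreal ((u x - u y)\<^sup>2 * norm (x - y) powr (- (n + 2 * s))) \<partial>lborel"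
    have "ennreal (\<bar>u x\<bar> powr p) \<le> ennreal (?C * P powr (2 * s / n)) * ?D x" for x
    proof (cases "u x = 0")
      case False
      from sobolev_pointwise[OF s[unfolded n_def] p[unfolded n_def] u P0 _ False] P
      show ?thesis by (simp add: sobolev_const_def p n_def)
    qed (use p0 in simp)
    then have "ennreal P \<le> (\<integral>\<^sup>+x. ennreal (?C * P powr (2 * s / n)) * ?D x \<partial>lborel)"
      unfolding P(1)[symmetric] by (intro nn_integral_mono)
    also have "\<dots> = ennreal (?C * P powr (2 * s / n)) * gagliardo s u"
      unfolding gagliardo_def n_def by (intro nn_integral_cmult) measurable
    also have "\<dots> \<le> ennreal (?C * P powr (2 * s / n)) * ennreal e"
      by (intro mult_left_mono e) auto
    also have "\<dots> = ennreal (?C * P powr (2 * s / n) * e)" using C e by (simp add: ennreal_mult)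
    finally have "P \<le> ?C * e * P powr (2 * s / n)" using C e by (simp add: ennreal_le_iff mult_ac)
    moreover have "P = P powr (2 / p) * P powr (2 * s / n)"
    proof -
      have "2 / p + 2 * s / n = 1" unfolding p using s n by (simp add: field_simps)
      then show ?thesis using P0 by (simp add: powr_add[symmetric])
    qed
    ultimately have "P powr (2 / p) \<le> ?C * e"
      using P0 by (metis mult_le_cancel_right_pos powr_gt_zero order_less_irrefl)
    then have "(P powr (2 / p)) powr (p / 2) \<le> (?C * e) powr (p / 2)"
      using p0 by (intro powr_mono2) auto
    then show ?thesis using P0 p0 by (simp add: P powr_powr ennreal_leI)
  qed (simp add: P)
qed

text \<open>Truncations of \<open>u\<close> at height \<open>N\<close> are bounded with bounded support, hence in \<open>L\<^sup>p\<close>, and truncation does not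
  increase the seminorm; the bound passes to \<open>u\<close> by Fatou's lemma.\<close>

lemma fractional_sobolev:
  fixes u :: "'a::euclidean_space \<Rightarrow> real"
  defines "n \<equiv> real DIM('a)"
  assumes s: "0 < s" "2 * s < n" and p: "p = 2 * n / (n - 2 * s)"
    and u: "u \<in> borel_measurable borel"
    and supp: "bounded B" "\<And>x. x \<notin> B \<Longrightarrow> u x = 0"
    and e: "0 \<le> e" "gagliardo s u \<le> ennreal e"
  shows "(\<integral>\<^sup>+y. ennreal (\<bar>u y\<bar> powr p) \<partial>lborel) \<le> ennreal ((sobolev_const n s * e) powr (p / 2))"
proof -
  have n: "0 < n" by (simp add: n_def)
  have [measurable]: "u \<in> borel_measurable borel" by fact
  have p0: "0 < p" using s n p by simp
  obtain R where R: "0 < R" "B \<subseteq> ball 0 R" using supp(1) bounded_subset_ballD by blast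
  define v where "v N x = max (- real N) (min (real N) (u x))" for N x
  have [measurable]: "v N \<in> borel_measurable borel" for N unfolding v_def by measurable
  have bd: "(\<integral>\<^sup>+y. ennreal (\<bar>v N y\<bar> powr p) \<partial>lborel) \<le> ennreal ((sobolev_const n s * e) powr (p / 2))" for N
  proof (rule sobolev_inequality_of_finite_norm[OF s[unfolded n_def] p[unfolded n_def] _ _ e(1), folded n_def])
    have "(\<integral>\<^sup>+y. ennreal (\<bar>v N y\<bar> powr p) \<partial>lborel) \<le> (\<integral>\<^sup>+y. ennreal (real N powr p) * indicator (ball (0::'a) R) y \<partial>lborel)"
    proof (intro nn_integral_mono)
      fix x
      have "\<bar>v N x\<bar> powr p \<le> real N powr p" using p0 by (intro powr_mono2) (auto simp: v_def)
      moreover have "v N x = 0" if "x \<notin> ball 0 R"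
      proof -
        have "u x = 0" using supp(2)[of x] subsetD[OF R(2), of x] that by blast
        then show ?thesis by (simp add: v_def)
      qed
      ultimately show "ennreal (\<bar>v N x\<bar> powr p) \<le> ennreal (real N powr p) * indicator (ball 0 R) x"
        by (auto simp: indicator_def ennreal_leI)
    qed
    also have "\<dots> < \<infinity>"
      using emeasure_lborel_ball_finite[of "0::'a" R]
      by (simp add: nn_integral_cmult_indicator ennreal_mult_less_top)
    finally show "(\<integral>\<^sup>+y. ennreal (\<bar>v N y\<bar> powr p) \<partial>lborel) < \<infinity>" .
    have "\<bar>v N x - v N y\<bar> \<le> \<bar>u x - u y\<bar>" for x y unfolding v_def by linarith
    then have "(v N x - v N y)\<^sup>2 \<le> (u x - u y)\<^sup>2" for x y by (simp add: abs_le_square_iff)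
    then have "gagliardo s (v N) \<le> gagliardo s u" unfolding gagliardo_def
      by (intro nn_integral_mono ennreal_leI mult_right_mono) auto
    with e show "gagliardo s (v N) \<le> ennreal e" by simp
  qed measurable
  show ?thesis
  proof (rule fatou_AE_bound[where f = "\<lambda>N y. \<bar>v N y\<bar> powr p"])
    show "AE x in lborel. (\<lambda>k. \<bar>v k x\<bar> powr p) \<longlonglongrightarrow> \<bar>u x\<bar> powr p"
    proof (intro AE_I2 tendsto_eventually)
      fix x
      obtain N0 :: nat where "\<bar>u x\<bar> \<le> real N0" using real_arch_simple by blast
      then show "\<forall>\<^sub>F k in sequentially. \<bar>v k x\<bar> powr p = \<bar>u x\<bar> powr p"
        unfolding eventually_sequentially by (intro exI[of _ N0]) (auto simp: v_def)
    qed
  qed (use bd in auto)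
qed

section \<open>Compactness for the Gagliardo seminorm\<close>

text \<open>The half-open cube of the grid with mesh \<open>\<delta>\<close> that contains \<open>x\<close>. Indexing cubes by their points makes
  cell averages functions of \<open>x\<close>, measurable without any enumeration of the cubes.\<close>

definition cell :: "real \<Rightarrow> 'a::euclidean_space \<Rightarrow> 'a set" where
  "cell \<delta> x = {y. \<forall>b\<in>Basis. \<lfloor>(y \<bullet> b) / \<delta>\<rfloor> = \<lfloor>(x \<bullet> b) / \<delta>\<rfloor>}"

lemma cell_measurable [measurable]:
  "Measurable.pred (borel \<Otimes>\<^sub>M borel) (\<lambda>(x, y). y \<in> cell \<delta> x)"
  "cell \<delta> x \<in> sets borel"
  unfolding cell_def by measurable

lemma countable_cells: "countable (range (\<lambda>(j::nat, x::'a::euclidean_space). cell (\<delta> j) x))"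
proof -
  let ?h = "\<lambda>(j::nat, z). {y::'a. \<forall>b\<in>Basis. \<lfloor>(y \<bullet> b) / \<delta> j\<rfloor> = z b}"
  have c: "countable (UNIV \<times> (PiE (Basis :: 'a set) (\<lambda>_. UNIV :: int set)) :: (nat \<times> ('a \<Rightarrow> int)) set)"
    by (intro countable_SIGMA countable_PiE) auto
  have "range (\<lambda>(j::nat, x::'a). cell (\<delta> j) x) \<subseteq> ?h ` (UNIV \<times> (PiE (Basis :: 'a set) (\<lambda>_. UNIV)))"
  proof clarify
    fix j x
    have "(j, restrict (\<lambda>b. \<lfloor>(x \<bullet> b) / \<delta> j\<rfloor>) Basis) \<in> UNIV \<times> (PiE (Basis :: 'a set) (\<lambda>_. UNIV :: int set))"
      by auto
    moreover have "cell (\<delta> j) x = ?h (j, restrict (\<lambda>b. \<lfloor>(x \<bullet> b) / \<delta> j\<rfloor>) Basis)"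
      by (auto simp: cell_def)
    ultimately show "cell (\<delta> j) x \<in> ?h ` (UNIV \<times> (PiE (Basis :: 'a set) (\<lambda>_. UNIV :: int set)))"
      by blast
  qed
  then show ?thesis by (rule countable_subset[OF _ countable_image[OF c]])
qed

lemma emeasure_cell:
  fixes x :: "'a::euclidean_space"
  assumes "0 < \<delta>"
  shows "emeasure lborel (cell \<delta> x) = ennreal (\<delta> ^ DIM('a))"
proof -
  define a where "a = (\<Sum>b\<in>Basis. (\<delta> * \<lfloor>(x \<bullet> b) / \<delta>\<rfloor>) *\<^sub>R b)"
  define c where "c = a + (\<Sum>b\<in>Basis. \<delta> *\<^sub>R b)"
  have a: "a \<bullet> b = \<delta> * \<lfloor>(x \<bullet> b) / \<delta>\<rfloor>" if "b \<in> Basis" for b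
    using that by (simp add: a_def)
  have c: "c \<bullet> b = a \<bullet> b + \<delta>" if "b \<in> Basis" for b
    using that by (simp add: c_def inner_add_left)
  have iff: "\<lfloor>t / \<delta>\<rfloor> = k \<longleftrightarrow> \<delta> * k \<le> t \<and> t < \<delta> * k + \<delta>" for t k
    using assms by (simp add: floor_eq_iff field_simps)
  have cell: "cell \<delta> x = {y. \<forall>b\<in>Basis. a \<bullet> b \<le> y \<bullet> b \<and> y \<bullet> b < c \<bullet> b}"
    by (auto simp: cell_def iff a c)
  have vol: "(\<Prod>b\<in>Basis. (c - a) \<bullet> b) = \<delta> ^ DIM('a)"
    by (simp add: inner_diff_left c)
  have le: "a \<bullet> b \<le> c \<bullet> b" if "b \<in> Basis" for b using that c assms by simp
  have "box a c \<subseteq> cell \<delta> x" unfolding cell by (auto simp: mem_box less_imp_le)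
  then have "emeasure lborel (box a c) \<le> emeasure lborel (cell \<delta> x)"
    by (intro emeasure_mono) auto
  moreover have "cell \<delta> x \<subseteq> cbox a c" unfolding cell by (auto simp: mem_box less_imp_le)
  then have "emeasure lborel (cell \<delta> x) \<le> emeasure lborel (cbox a c)"
    by (intro emeasure_mono) auto
  ultimately show ?thesis
    using le vol by (simp add: emeasure_lborel_box emeasure_lborel_cbox)
qed

lemma norm_diff_cell:
  fixes x :: "'a::euclidean_space"
  assumes "0 < \<delta>" "y \<in> cell \<delta> x"
  shows "norm (x - y) \<le> real DIM('a) * \<delta>"
proof -
  have "\<bar>(x - y) \<bullet> b\<bar> \<le> \<delta>" if b: "b \<in> Basis" for b
  proof -
    have "\<lfloor>(y \<bullet> b) / \<delta>\<rfloor> = \<lfloor>(x \<bullet> b) / \<delta>\<rfloor>" using assms b by (simp add: cell_def)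
    then have "\<bar>(x \<bullet> b) / \<delta> - (y \<bullet> b) / \<delta>\<bar> \<le> 1" by linarith
    then have "\<bar>(x - y) \<bullet> b\<bar> / \<delta> \<le> 1"
      using assms by (simp add: inner_diff_left diff_divide_distrib[symmetric])
    then show ?thesis using assms by simp
  qed
  then have "(\<Sum>b\<in>Basis. \<bar>(x - y) \<bullet> b\<bar>) \<le> (\<Sum>b\<in>(Basis::'a set). \<delta>)"
    by (intro sum_mono)
  then show ?thesis using norm_le_l1[of "x - y"] by simp
qed

definition cell_average :: "real \<Rightarrow> ('a::euclidean_space \<Rightarrow> real) \<Rightarrow> 'a \<Rightarrow> real" where
  "cell_average \<delta> u x = (LINT y|lborel. indicator (cell \<delta> x) y * u y) / \<delta> ^ DIM('a)"

lemma cell_average_measurable [measurable]: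
  assumes [measurable]: "u \<in> borel_measurable borel"
  shows "cell_average \<delta> u \<in> borel_measurable borel"
proof -
  have "(\<lambda>(x, y). indicator (cell \<delta> x) y * u y) \<in> borel_measurable (borel \<Otimes>\<^sub>M borel)"
    by measurable
  then show ?thesis
    unfolding cell_average_def by measurable
qed

text \<open>On a cell, \<open>|u(x) - u(y)| \<le> \<theta> + |u(x) - u(y)|\<^sup>2 / \<theta>\<close>, and the second summand is compared with the Gagliardo
  kernel because \<open>|x - y| \<le> n \<delta>\<close>. The choice \<open>\<theta> = \<delta>\<^sup>s\<close> balances the two contributions.\<close>

lemma cell_average_error:
  fixes u :: "'a::euclidean_space \<Rightarrow> real"
  defines "n \<equiv> real DIM('a)"
  assumes \<delta>: "0 < \<delta>" and s: "0 < s" and u: "integrable lborel u"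
    and B[measurable]: "B \<in> sets borel"
  shows "(\<integral>\<^sup>+x. ennreal \<bar>u x - cell_average \<delta> u x\<bar> * indicator B x \<partial>lborel)
    \<le> ennreal (\<delta> powr s) * (emeasure lborel B + ennreal (n powr (n + 2 * s)) * gagliardo s u)"
proof -
  have [measurable]: "u \<in> borel_measurable borel" using u by simp
  have n: "0 < n" by (simp add: n_def)
  let ?V = "\<delta> ^ DIM('a)" and ?\<theta> = "\<delta> powr s"
  let ?k = "\<lambda>x y. (u x - u y)\<^sup>2 * norm (x - y) powr (- (n + 2 * s))"
  let ?c = "(n * \<delta>) powr (n + 2 * s) / ?\<theta>"
  have V: "0 < ?V" and \<theta>: "0 < ?\<theta>" using \<delta> by auto
  have pw: "\<bar>u x - u y\<bar> \<le> ?\<theta> + ?c * ?k x y" if y: "y \<in> cell \<delta> x" for x y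
  proof (cases "x = y")
    case False
    have "\<bar>u x - u y\<bar> \<le> ?\<theta> + (u x - u y)\<^sup>2 / ?\<theta>"
    proof (cases "\<bar>u x - u y\<bar> \<le> ?\<theta>")
      case True
      moreover have "0 \<le> (u x - u y)\<^sup>2 / ?\<theta>" by simp
      ultimately show ?thesis by linarith
    next
      case False
      then have "\<bar>u x - u y\<bar> * ?\<theta> \<le> \<bar>u x - u y\<bar> * \<bar>u x - u y\<bar>"
        by (intro mult_left_mono) auto
      then have "\<bar>u x - u y\<bar> \<le> (u x - u y)\<^sup>2 / ?\<theta>" using \<theta> by (simp add: field_simps power2_eq_square)
      then show ?thesis using \<theta> by linarith
    qed
    moreover have "1 \<le> (n * \<delta>) powr (n + 2 * s) * norm (x - y) powr (- (n + 2 * s))"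
    proof -
      have "norm (x - y) powr (n + 2 * s) \<le> (n * \<delta>) powr (n + 2 * s)"
        using norm_diff_cell[OF \<delta> y] n s by (intro powr_mono2) (auto simp: n_def)
      then show ?thesis using False unfolding powr_minus by (simp add: field_simps)
    qed
    then have "(u x - u y)\<^sup>2 / ?\<theta> * 1 \<le> (u x - u y)\<^sup>2 / ?\<theta> * ((n * \<delta>) powr (n + 2 * s) * norm (x - y) powr (- (n + 2 * s)))"
      by (intro mult_left_mono) auto
    ultimately show ?thesis by (simp add: field_simps)
  qed (use \<theta> in auto)
  have cell: "emeasure lborel (cell \<delta> x) = ennreal ?V" for x :: 'a
    using emeasure_cell[OF \<delta>] .
  have int_cell: "integrable lborel (\<lambda>y. indicator (cell \<delta> x) y * u y)" for x
    using integrable_mult_indicator[OF _ u, of "cell \<delta> x"] by simp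
  have int_one: "integrable lborel (indicator (cell \<delta> x) :: 'a \<Rightarrow> real)" for x
    by (simp add: integrable_indicator_iff cell)
  have err: "ennreal \<bar>u x - cell_average \<delta> u x\<bar>
      \<le> ennreal ?\<theta> + ennreal (?c / ?V) * (\<integral>\<^sup>+y. ennreal (?k x y) \<partial>lborel)" for x
  proof -
    have "measure lborel (cell \<delta> x) = ?V" using cell[of x] V by (simp add: measure_def)
    then have "u x - cell_average \<delta> u x = (LINT y|lborel. indicator (cell \<delta> x) y * (u x - u y)) / ?V"
      using V \<delta> int_cell int_one
      by (simp add: cell_average_def right_diff_distrib Bochner_Integration.integral_diff diff_divide_distrib)
    then have "ennreal \<bar>u x - cell_average \<delta> u x\<bar> = ennreal \<bar>LINT y|lborel. indicator (cell \<delta> x) y * (u x - u y)\<bar> * ennreal (1 / ?V)"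
      using V by (simp add: ennreal_mult[symmetric])
    also have "\<dots> \<le> (\<integral>\<^sup>+y. ennreal (norm (indicator (cell \<delta> x) y * (u x - u y))) \<partial>lborel) * ennreal (1 / ?V)"
    proof (intro mult_right_mono)
      have "integrable lborel (\<lambda>y. indicator (cell \<delta> x) y * (u x - u y))"
        using int_cell int_one by (simp add: right_diff_distrib)
      from integral_norm_bound_ennreal[OF this]
      show "ennreal \<bar>LINT y|lborel. indicator (cell \<delta> x) y * (u x - u y)\<bar> \<le> (\<integral>\<^sup>+y. ennreal (norm (indicator (cell \<delta> x) y * (u x - u y))) \<partial>lborel)"
        by simp
    qed simp
    also have "\<dots> \<le> (\<integral>\<^sup>+y. ennreal ?\<theta> * indicator (cell \<delta> x) y + ennreal ?c * ennreal (?k x y) \<partial>lborel) * ennreal (1 / ?V)"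
    proof (intro mult_right_mono nn_integral_mono)
      fix y
      show "ennreal (norm (indicator (cell \<delta> x) y * (u x - u y))) \<le> ennreal ?\<theta> * indicator (cell \<delta> x) y + ennreal ?c * ennreal (?k x y)"
        using pw[of y x] \<theta> by (cases "y \<in> cell \<delta> x") (auto simp: ennreal_mult[symmetric] ennreal_plus[symmetric] simp del: ennreal_plus intro!: ennreal_leI)
    qed simp
    also have "\<dots> = (ennreal ?\<theta> * ennreal ?V + ennreal ?c * (\<integral>\<^sup>+y. ennreal (?k x y) \<partial>lborel)) * ennreal (1 / ?V)"
      by (subst nn_integral_add) (auto simp: nn_integral_cmult nn_integral_cmult_indicator cell)
    also have "\<dots> = ennreal ?\<theta> * (ennreal ?V * ennreal (1 / ?V)) + (ennreal ?c * ennreal (1 / ?V)) * (\<integral>\<^sup>+y. ennreal (?k x y) \<partial>lborel)"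
      by (simp only: distrib_left distrib_right ac_simps)
    also have "ennreal ?V * ennreal (1 / ?V) = 1" using V \<delta> by (subst ennreal_mult[symmetric]) auto
    also have "ennreal ?c * ennreal (1 / ?V) = ennreal (?c / ?V)" using V \<theta> by (subst ennreal_mult[symmetric]) auto
    finally show ?thesis by simp
  qed
  have "(\<integral>\<^sup>+x. ennreal \<bar>u x - cell_average \<delta> u x\<bar> * indicator B x \<partial>lborel)
      \<le> (\<integral>\<^sup>+x. ennreal ?\<theta> * indicator B x + ennreal (?c / ?V) * (\<integral>\<^sup>+y. ennreal (?k x y) \<partial>lborel) \<partial>lborel)"
    using err by (intro nn_integral_mono) (auto simp: indicator_def)
  also have "\<dots> = ennreal ?\<theta> * emeasure lborel B + ennreal (?c / ?V) * gagliardo s u"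
    unfolding gagliardo_def n_def[symmetric]
    by (subst nn_integral_add) (auto simp: nn_integral_cmult nn_integral_cmult_indicator)
  also have "?c / ?V = ?\<theta> * n powr (n + 2 * s)"
  proof -
    have "(n * \<delta>) powr (n + 2 * s) = n powr (n + 2 * s) * (\<delta> powr n * \<delta> powr s * \<delta> powr s)"
      using n \<delta> by (simp add: powr_mult powr_add[symmetric] add.commute)
    moreover have "\<delta> powr n = ?V" using \<delta> by (simp add: powr_realpow n_def)
    ultimately show ?thesis using \<delta> by (simp add: field_simps)
  qed
  finally show ?thesis by (simp add: ennreal_mult distrib_left mult.assoc)
qed

text \<open>The integrals over the countably many cells of all meshes \<open>1, 1/2, 1/3, \<dots>\<close> converge along a common
  subsequence. For a fixed mesh the cell averages then converge in \<open>L\<^sup>1\<close>, and since they are uniformly close to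
  the functions themselves, the subsequence is Cauchy in \<open>L\<^sup>1\<close>.\<close>

lemma gagliardo_compact:
  fixes u :: "nat \<Rightarrow> 'a::euclidean_space \<Rightarrow> real"
  assumes s: "0 < s" and int: "\<And>k. integrable lborel (u k)"
    and supp: "bounded B" "\<And>k x. x \<notin> B \<Longrightarrow> u k x = 0"
    and M: "\<And>k. (LINT x|lborel. \<bar>u k x\<bar>) \<le> M"
    and e: "0 \<le> e" "\<And>k. gagliardo s (u k) \<le> ennreal e"
  obtains r where "strict_mono r" "AE x in lborel. convergent (\<lambda>i. u (r i) x)"
proof -
  have meas[measurable]: "u k \<in> borel_measurable borel" for k using int[of k] by simp
  define n where "n = real DIM('a)"
  obtain R where R: "0 < R" "B \<subseteq> ball 0 R" using supp(1) bounded_subset_ballD by blast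
  define W where "W = (ball 0 R :: 'a set)"
  have W[measurable]: "W \<in> sets borel" by (simp add: W_def)
  have uW: "u k x = 0" if "x \<notin> W" for k x using that R supp(2) unfolding W_def by blast
  have Wfin: "emeasure lborel W < \<infinity>" unfolding W_def by (rule emeasure_lborel_ball_finite)
  define \<delta> where "\<delta> j = 1 / real (Suc j)" for j
  have \<delta>: "0 < \<delta> j" for j by (simp add: \<delta>_def)
  let ?I = "\<lambda>k C. LINT y|lborel. indicator C y * u k y"
  have Ibd: "norm (?I k C) \<le> M" if "C \<in> range (\<lambda>(j, x). cell (\<delta> j) x)" for k C
  proof -
    have [measurable]: "C \<in> sets borel" using that by auto
    have "norm (?I k C) \<le> (LINT y|lborel. norm (indicator C y * u k y))"
      by (rule integral_norm_bound)
    also have "\<dots> \<le> (LINT y|lborel. \<bar>u k y\<bar>)"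
    proof (rule integral_mono)
      show "integrable lborel (\<lambda>y. norm (indicator C y * u k y))"
        using integrable_mult_indicator[OF _ int, of C k] by simp
    qed (use int in \<open>auto simp: indicator_def\<close>)
    finally show ?thesis using M[of k] by linarith
  qed
  obtain r where r: "strict_mono r" and conv: "\<And>C. C \<in> range (\<lambda>(j, x). cell (\<delta> j) x) \<Longrightarrow> \<exists>l. (\<lambda>k. ?I (r k) C) \<longlonglongrightarrow> l"
    by (rule function_convergent_subsequence[where f = ?I, OF countable_cells[of \<delta>] Ibd]) (assumption, erule that)
  \<comment> \<open>the indicator gives the averages, whose supports may reach outside the ball, an integrable majorant\<close>
  define v where "v j k x = cell_average (\<delta> j) (u (r k)) x * indicator W x" for j k x
  define L where "L j x = lim (\<lambda>k. v j k x)" for j x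
  have v_conv: "(\<lambda>k. v j k x) \<longlonglongrightarrow> L j x" for j x
  proof -
    have "\<exists>l. (\<lambda>k. ?I (r k) (cell (\<delta> j) x)) \<longlonglongrightarrow> l" by (intro conv) auto
    then obtain l where l: "(\<lambda>k. ?I (r k) (cell (\<delta> j) x)) \<longlonglongrightarrow> l" by blast
    have "(\<lambda>k. v j k x) \<longlonglongrightarrow> l / \<delta> j ^ DIM('a) * indicator W x"
      unfolding v_def cell_average_def using \<delta>[of j] by (intro tendsto_intros l) auto
    then have "convergent (\<lambda>k. v j k x)" by (rule convergentI)
    then show ?thesis unfolding L_def by (simp add: convergent_LIMSEQ_iff)
  qed
  have [measurable]: "v j k \<in> borel_measurable borel" for j k unfolding v_def by measurable
  have [measurable]: "L j \<in> borel_measurable borel" for j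
    by (rule borel_measurable_LIMSEQ_real[OF v_conv]) measurable
  have v_lim: "(\<lambda>k. \<integral>\<^sup>+x. ennreal (norm (L j x - v j k x)) \<partial>lborel) \<longlonglongrightarrow> 0" for j
  proof (rule nn_integral_dominated_convergence_norm[where w = "\<lambda>x. M / \<delta> j ^ DIM('a) * indicator W x"])
    show "AE x in lborel. norm (v j k x) \<le> M / \<delta> j ^ DIM('a) * indicator W x" for k
    proof (intro AE_I2)
      fix x
      have "norm (?I (r k) (cell (\<delta> j) x)) \<le> M" by (rule Ibd) auto
      then show "norm (v j k x) \<le> M / \<delta> j ^ DIM('a) * indicator W x"
        using \<delta>[of j] by (simp add: v_def cell_average_def indicator_def divide_right_mono)
    qed
    have "(\<integral>\<^sup>+x. ennreal (M / \<delta> j ^ DIM('a) * indicator W x) \<partial>lborel) \<le> (\<integral>\<^sup>+x. ennreal \<bar>M / \<delta> j ^ DIM('a)\<bar> * indicator W x \<partial>lborel)"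
      by (intro nn_integral_mono) (auto simp: indicator_def intro!: ennreal_leI simp del: abs_divide)
    also have "\<dots> < \<infinity>" using Wfin by (simp add: nn_integral_cmult_indicator ennreal_mult_less_top)
    finally show "(\<integral>\<^sup>+x. ennreal (M / \<delta> j ^ DIM('a) * indicator W x) \<partial>lborel) < \<infinity>" .
  qed (use v_conv in auto)
  have Efin: "emeasure lborel W + ennreal (n powr (n + 2 * s)) * ennreal e < \<infinity>"
    using Wfin by (simp add: ennreal_mult_less_top)
  then obtain E where E: "emeasure lborel W + ennreal (n powr (n + 2 * s)) * ennreal e = ennreal E" "0 \<le> E"
    by (metis ennreal_cases infinity_ennreal_def order_less_irrefl)
  have uv: "(\<integral>\<^sup>+x. ennreal (norm (u (r k) x - v j k x)) \<partial>lborel) \<le> ennreal (\<delta> j powr s * E)" for j k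
  proof -
    have "(\<integral>\<^sup>+x. ennreal (norm (u (r k) x - v j k x)) \<partial>lborel)
      = (\<integral>\<^sup>+x. ennreal \<bar>u (r k) x - cell_average (\<delta> j) (u (r k)) x\<bar> * indicator W x \<partial>lborel)"
      by (intro nn_integral_cong) (auto simp: v_def indicator_def uW)
    also have "\<dots> \<le> ennreal (\<delta> j powr s) * (emeasure lborel W + ennreal (n powr (n + 2 * s)) * gagliardo s (u (r k)))"
      unfolding n_def by (intro cell_average_error \<delta> s int W)
    also have "\<dots> \<le> ennreal (\<delta> j powr s) * (emeasure lborel W + ennreal (n powr (n + 2 * s)) * ennreal e)"
      by (intro mult_left_mono add_left_mono e) auto
    finally show ?thesis unfolding E by (simp add: ennreal_mult E)
  qed
  have \<delta>_lim: "(\<lambda>j. \<delta> j powr s * E) \<longlonglongrightarrow> 0"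
  proof -
    have "(\<lambda>j. \<delta> j) \<longlonglongrightarrow> 0" unfolding \<delta>_def by (rule LIMSEQ_Suc[OF lim_1_over_n])
    then have "(\<lambda>j. \<delta> j powr s) \<longlonglongrightarrow> 0 powr s"
      using \<delta> s by (intro tendsto_powr2) (auto intro!: always_eventually intro: less_imp_le)
    then show ?thesis using s by (auto intro: tendsto_mult_left_zero)
  qed
  have cauchy: "\<exists>N. \<forall>i\<ge>N. \<forall>k\<ge>N. (LINT x|lborel. norm (u (r i) x - u (r k) x)) < \<epsilon>" if \<epsilon>: "0 < \<epsilon>" for \<epsilon>
  proof -
    obtain j where j: "\<delta> j powr s * E < \<epsilon> / 4"
      using order_tendstoD(2)[OF \<delta>_lim, of "\<epsilon> / 4"] \<epsilon> by (auto simp: eventually_sequentially)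
    obtain N where N: "\<And>k. k \<ge> N \<Longrightarrow> (\<integral>\<^sup>+x. ennreal (norm (L j x - v j k x)) \<partial>lborel) < ennreal (\<epsilon> / 4)"
      using order_tendstoD(2)[OF v_lim, of "ennreal (\<epsilon> / 4)" j] \<epsilon> by (auto simp: eventually_sequentially)
    have "(LINT x|lborel. norm (u (r i) x - u (r k) x)) < \<epsilon>" if "i \<ge> N" "k \<ge> N" for i k
    proof -
      let ?nn = "\<lambda>f. \<integral>\<^sup>+x. ennreal (norm (f x :: real)) \<partial>lborel"
      have "ennreal (LINT x|lborel. norm (u (r i) x - u (r k) x)) = ?nn (\<lambda>x. u (r i) x - u (r k) x)"
        using int by (intro nn_integral_eq_integral[symmetric]) auto
      also have "\<dots> \<le> (\<integral>\<^sup>+x. (ennreal (norm (u (r i) x - v j i x)) + ennreal (norm (L j x - v j i x)))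
         + (ennreal (norm (L j x - v j k x)) + ennreal (norm (u (r k) x - v j k x))) \<partial>lborel)"
        by (intro nn_integral_mono) (auto simp: ennreal_plus[symmetric] simp del: ennreal_plus intro!: ennreal_leI)
      also have "\<dots> = (?nn (\<lambda>x. u (r i) x - v j i x) + ?nn (\<lambda>x. L j x - v j i x))
         + (?nn (\<lambda>x. L j x - v j k x) + ?nn (\<lambda>x. u (r k) x - v j k x))"
        by (simp add: nn_integral_add)
      also have "\<dots> < (ennreal (\<epsilon> / 4) + ennreal (\<epsilon> / 4)) + (ennreal (\<epsilon> / 4) + ennreal (\<epsilon> / 4))"
      proof -
        have a: "?nn (\<lambda>x. u (r l) x - v j l x) < ennreal (\<epsilon> / 4)" for l
          by (rule le_less_trans[OF uv ennreal_lessI]) (use j \<epsilon> in auto)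
        show ?thesis by (intro add_strict_mono a N that)
      qed
      also have "\<dots> = ennreal \<epsilon>" using \<epsilon> by (simp flip: ennreal_plus)
      finally show ?thesis using \<epsilon> by (simp add: ennreal_less_iff)
    qed
    then show ?thesis by blast
  qed
  obtain t where t: "strict_mono t" "AE x in lborel. Cauchy (\<lambda>i. u (r (t i)) x)"
    using cauchy_L1_AE_cauchy_subseq[of lborel "\<lambda>i. u (r i)", OF int cauchy] by blast
  show thesis
  proof (rule that)
    show "strict_mono (r \<circ> t)" using r t strict_mono_o by blast
    show "AE x in lborel. convergent (\<lambda>i. u ((r \<circ> t) i) x)"
      using t(2) by eventually_elim (simp add: Cauchy_convergent_iff)
  qed
qed

section \<open>Lebesgue measure on products\<close>

lemma AE_lborel_fst:
  fixes P :: "'a::euclidean_space \<Rightarrow> bool"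
  assumes "AE x in lborel. P x"
  shows "AE z in (lborel :: ('a \<times> 'b::euclidean_space) measure). P (fst z)"
proof -
  obtain N where N: "{x. \<not> P x} \<subseteq> N" "emeasure lborel N = 0" "N \<in> sets lborel"
    using AE_E[OF assms] by auto
  have "emeasure (lborel \<Otimes>\<^sub>M lborel) (N \<times> (UNIV :: 'b set)) = 0"
    using N by (subst lborel.emeasure_pair_measure_Times) auto
  then have "N \<times> (UNIV :: 'b set) \<in> null_sets lborel"
    unfolding lborel_prod using N by (intro null_setsI) (auto intro: borel_Times)
  then show ?thesis
    by (rule AE_I') (use N in auto)
qed

lemma AE_lborel_snd:
  fixes P :: "'b::euclidean_space \<Rightarrow> bool"
  assumes "AE x in lborel. P x"
  shows "AE z in (lborel :: ('a::euclidean_space \<times> 'b) measure). P (snd z)"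
proof -
  obtain N where N: "{x. \<not> P x} \<subseteq> N" "emeasure lborel N = 0" "N \<in> sets lborel"
    using AE_E[OF assms] by auto
  have "emeasure (lborel \<Otimes>\<^sub>M lborel) ((UNIV :: 'a set) \<times> N) = 0"
    using N by (subst lborel.emeasure_pair_measure_Times) auto
  then have "(UNIV :: 'a set) \<times> N \<in> null_sets lborel"
    unfolding lborel_prod using N by (intro null_setsI) (auto intro: borel_Times)
  then show ?thesis
    by (rule AE_I') (use N in auto)
qed

lemma nn_integral_lborel_shift:
  fixes f :: "'a::euclidean_space \<Rightarrow> ennreal"
  assumes [measurable]: "f \<in> borel_measurable borel"
  shows "(\<integral>\<^sup>+x. f (x - y) \<partial>lborel) = (\<integral>\<^sup>+x. f x \<partial>lborel)"
proof -
  have "(\<integral>\<^sup>+x. f x \<partial>lborel) = (\<integral>\<^sup>+x. f x \<partial>distr lborel borel ((+) (- y)))"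
    by (simp add: lborel_distr_plus)
  also have "\<dots> = (\<integral>\<^sup>+x. f (x - y) \<partial>lborel)"
    by (subst nn_integral_distr) auto
  finally show ?thesis by simp
qed

lemma nn_integral_lborel_reflect:
  fixes f :: "'a::euclidean_space \<Rightarrow> ennreal"
  assumes [measurable]: "f \<in> borel_measurable borel"
  shows "(\<integral>\<^sup>+y. f (x - y) \<partial>lborel) = (\<integral>\<^sup>+y. f y \<partial>lborel)"
proof -
  have "(\<integral>\<^sup>+y. f y \<partial>lborel) = (\<integral>\<^sup>+y. f y \<partial>distr lborel borel (\<lambda>y. x + (-1) *\<^sub>R y))"
    using lborel_affine[of "-1" x] by (simp add: density_1)
  also have "\<dots> = (\<integral>\<^sup>+y. f (x - y) \<partial>lborel)"
    by (subst nn_integral_distr) auto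
  finally show ?thesis by simp
qed

lemma nn_integral_lborel_prod:
  fixes f :: "'a::euclidean_space \<times> 'b::euclidean_space \<Rightarrow> ennreal"
  assumes [measurable]: "f \<in> borel_measurable borel"
  shows "(\<integral>\<^sup>+z. f z \<partial>lborel) = (\<integral>\<^sup>+x. \<integral>\<^sup>+y. f (x, y) \<partial>lborel \<partial>lborel)"
    and "(\<integral>\<^sup>+z. f z \<partial>lborel) = (\<integral>\<^sup>+y. \<integral>\<^sup>+x. f (x, y) \<partial>lborel \<partial>lborel)"
proof -
  have [measurable]: "f \<in> borel_measurable (lborel \<Otimes>\<^sub>M lborel)"
    unfolding lborel_prod by simp
  show "(\<integral>\<^sup>+z. f z \<partial>lborel) = (\<integral>\<^sup>+x. \<integral>\<^sup>+y. f (x, y) \<partial>lborel \<partial>lborel)"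
    by (subst lborel.nn_integral_fst) (simp_all add: lborel_prod)
  show "(\<integral>\<^sup>+z. f z \<partial>lborel) = (\<integral>\<^sup>+y. \<integral>\<^sup>+x. f (x, y) \<partial>lborel \<partial>lborel)"
    by (subst lborel_pair.nn_integral_snd) (simp_all add: lborel_prod)
qed

text \<open>Makes it possible to replace the kernel by a Borel representative inside \<open>K (x - y)\<close>: for fixed \<open>y\<close> the
  exceptional set in \<open>x\<close> is a translate of a null set.\<close>

lemma AE_lborel_diff:
  fixes P :: "'a::euclidean_space \<Rightarrow> bool"
  assumes "AE x in lborel. P x"
  shows "AE z in (lborel :: ('a \<times> 'a) measure). P (fst z - snd z)"
proof -
  obtain N where N: "{x. \<not> P x} \<subseteq> N" "emeasure lborel N = 0" "N \<in> sets lborel"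
    using AE_E[OF assms] by auto
  have [measurable]: "N \<in> sets borel" using N by simp
  have "(\<integral>\<^sup>+z. indicator N (fst z - snd z) \<partial>(lborel :: ('a \<times> 'a) measure))
      = (\<integral>\<^sup>+y. \<integral>\<^sup>+x. indicator N (x - y) \<partial>lborel \<partial>lborel)"
    by (subst nn_integral_lborel_prod(2)) (simp_all add: borel_prod[symmetric])
  also have "\<dots> = 0"
    using N by (subst nn_integral_lborel_shift) auto
  finally have "AE z in (lborel :: ('a \<times> 'a) measure). (indicator N (fst z - snd z) :: ennreal) = 0"
    by (subst (asm) nn_integral_0_iff_AE) (auto simp: borel_prod[symmetric])
  then show ?thesis by eventually_elim (use N in \<open>auto simp: indicator_eq_0_iff\<close>)
qed

section \<open>The space \<open>X\<^sub>0\<close>\<close>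

locale fractional_kernel =
  fixes \<Omega> :: "'a::euclidean_space set" and K :: "'a \<Rightarrow> real" and s p k\<^sub>0 :: real
  assumes s: "0 < s" "2 * s < real DIM('a)"
    and p: "p = 2 * real DIM('a) / (real DIM('a) - 2 * s)"
    and \<Omega>: "\<Omega> \<noteq> {}" "open \<Omega>" "bounded \<Omega>"
    and K_pos: "\<And>x. x \<noteq> 0 \<Longrightarrow> 0 < K x"
    and K_int: "integrable lebesgue (\<lambda>x. min ((norm x)\<^sup>2) 1 * K x)"
    and k\<^sub>0: "0 < k\<^sub>0"
    and K_lower: "\<And>x. x \<noteq> 0 \<Longrightarrow> k\<^sub>0 * norm x powr (- (real DIM('a) + 2 * s)) \<le> K x"
begin

lemma p_gt_2: "2 < p"
  using s unfolding p by (simp add: field_simps)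

lemma Omega_sets [measurable]: "\<Omega> \<in> sets borel" "\<Omega> \<in> sets lebesgue"
  using \<Omega> by auto

lemma emeasure_Omega: "emeasure lborel \<Omega> < \<infinity>" "emeasure lebesgue \<Omega> < \<infinity>"
  using emeasure_bounded_finite[OF \<Omega>(3)] by auto

text \<open>The weight \<open>min (|x|\<^sup>2) 1\<close> can be divided out away from the origin.\<close>

lemma K_measurable: "K \<in> borel_measurable lebesgue"
proof -
  have "(\<lambda>x. if x = 0 then K 0 else (min ((norm x)\<^sup>2) 1 * K x) / min ((norm x)\<^sup>2) 1) \<in> borel_measurable lebesgue"
  proof (rule measurable_If)
    have [measurable]: "(\<lambda>x::'a. min ((norm x)\<^sup>2) 1) \<in> borel_measurable lebesgue"
      by (rule measurable_completion) simp
    have [measurable]: "(\<lambda>x. min ((norm x)\<^sup>2) 1 * K x) \<in> borel_measurable lebesgue"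
      using K_int by simp
    show "(\<lambda>x. (min ((norm x)\<^sup>2) 1 * K x) / min ((norm x)\<^sup>2) 1) \<in> borel_measurable lebesgue"
      by measurable
  qed auto
  moreover have "(\<lambda>x. if x = 0 then K 0 else (min ((norm x)\<^sup>2) 1 * K x) / min ((norm x)\<^sup>2) 1) = K"
    by (auto simp: fun_eq_iff min_def)
  ultimately show ?thesis by simp
qed

lemma K_borel:
  obtains K' where "K' \<in> borel_measurable borel" "AE x in lborel. K x = K' x"
  using completion_ex_borel_measurable_real[OF K_measurable] by auto

lemma Q_sets [measurable]: "Q_set \<Omega> \<in> sets borel" "Q_set \<Omega> \<in> sets lebesgue"
proof -
  have "open (Q_set \<Omega>)" unfolding Q_set_def
    using \<Omega> by (intro open_Compl closed_Times) (auto simp: closed_def)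
  then show "Q_set \<Omega> \<in> sets borel" by simp
  then show "Q_set \<Omega> \<in> sets lebesgue" by simp
qed

text \<open>Multiplied by \<open>1\<^sub>Q\<close>, the function whose square integrability defines the space lives on the whole product
  space and depends linearly on \<open>u\<close>, and \<open>X0_inner\<close> is the \<open>L\<^sup>2\<close> product of two such functions.\<close>

definition kernel_diff :: "('a \<Rightarrow> real) \<Rightarrow> 'a \<times> 'a \<Rightarrow> real" where
  "kernel_diff u z = indicator (Q_set \<Omega>) z * ((u (fst z) - u (snd z)) * sqrt (K (fst z - snd z)))"

abbreviation "X0 \<equiv> X0_space \<Omega> K"
abbreviation energy :: "('a \<Rightarrow> real) \<Rightarrow> real" where "energy u \<equiv> X0_inner \<Omega> K u u"

text \<open>The functions are Lebesgue measurable only, and Lebesgue measure on the product is not the product of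
  the completed measures. Hence \<open>u\<close> and \<open>K\<close> are replaced by Borel representatives, which changes the function
  on a null set of pairs.\<close>

lemma kernel_diff_measurable:
  assumes "u \<in> borel_measurable lebesgue"
  shows "kernel_diff u \<in> borel_measurable lebesgue"
proof -
  obtain u' where u'[measurable]: "u' \<in> borel_measurable borel" and uu': "AE x in lborel. u x = u' x"
    using completion_ex_borel_measurable_real[OF assms] by auto
  obtain K' where K'[measurable]: "K' \<in> borel_measurable borel" and KK': "AE x in lborel. K x = K' x"
    by (rule K_borel)
  let ?q = "\<lambda>z. indicator (Q_set \<Omega>) z * ((u' (fst z) - u' (snd z)) * sqrt (K' (fst z - snd z)))"
  have [measurable]: "(\<lambda>z. (u' (fst z) - u' (snd z)) * sqrt (K' (fst z - snd z))) \<in> borel_measurable borel"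
    unfolding borel_prod[symmetric] by measurable
  have "?q \<in> borel_measurable borel" by measurable
  then have "?q \<in> borel_measurable lebesgue" by (intro measurable_completion) simp
  moreover have "AE z in lebesgue. ?q z = kernel_diff u z"
    unfolding AE_completion_iff using AE_lborel_fst[OF uu'] AE_lborel_snd[OF uu'] AE_lborel_diff[OF KK']
    by eventually_elim (simp add: kernel_diff_def)
  ultimately show ?thesis by (rule borel_measurable_AE)
qed

lemma kernel_diff_mult:
  "kernel_diff u z * kernel_diff v z =
     indicator (Q_set \<Omega>) z * ((u (fst z) - u (snd z)) * (v (fst z) - v (snd z)) * K (fst z - snd z))"
proof (cases "fst z = snd z")
  case False
  then have "0 < K (fst z - snd z)" by (intro K_pos) auto
  then show ?thesis by (auto simp: kernel_diff_def indicator_def)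
qed (simp add: kernel_diff_def)

lemma X0_inner_eq: "X0_inner \<Omega> K u v = (LINT z|lebesgue. kernel_diff u z * kernel_diff v z)"
  unfolding X0_inner_def set_lebesgue_integral_def kernel_diff_mult by (simp add: mult.assoc)

lemma X0_iff:
  "u \<in> X0 \<longleftrightarrow> u \<in> borel_measurable lebesgue \<and> integrable lebesgue (\<lambda>x. indicator \<Omega> x * (u x)\<^sup>2) \<and>
     integrable lebesgue (\<lambda>z. (kernel_diff u z)\<^sup>2) \<and> (AE x in lebesgue. x \<notin> \<Omega> \<longrightarrow> u x = 0)"
proof (cases "u \<in> borel_measurable lebesgue")
  case True
  have 1: "in_L2 \<Omega> u \<longleftrightarrow> integrable lebesgue (\<lambda>x. indicator \<Omega> x * (u x)\<^sup>2)"
    using True unfolding in_L2_def by (simp add: integrable_restrict_space measurable_restrict_space1)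
  let ?q = "\<lambda>z. (u (fst z) - u (snd z)) * sqrt (K (fst z - snd z))"
  have "?q \<in> borel_measurable (lebesgue_on (Q_set \<Omega>))"
    using kernel_diff_measurable[OF True] unfolding kernel_diff_def
    by (simp add: borel_measurable_restrict_space_iff)
  moreover have "(indicator (Q_set \<Omega>) z *\<^sub>R (?q z)\<^sup>2) = (kernel_diff u z)\<^sup>2" for z
    by (simp add: kernel_diff_def indicator_def)
  ultimately have 2: "in_L2 (Q_set \<Omega>) ?q \<longleftrightarrow> integrable lebesgue (\<lambda>z. (kernel_diff u z)\<^sup>2)"
    unfolding in_L2_def by (simp only: integrable_restrict_space Q_sets simp_thms) (simp add: integrable_restrict_space)
  have "(\<lambda>(x, y). (u x - u y) * sqrt (K (x - y))) = ?q" by auto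
  with 1 2 True show ?thesis unfolding X0_space_def X_space_def by auto
qed (simp add: X0_space_def X_space_def)

lemma X0_D:
  assumes "u \<in> X0"
  shows "u \<in> borel_measurable lebesgue" "integrable lebesgue (\<lambda>z. (kernel_diff u z)\<^sup>2)"
    "AE x in lebesgue. x \<notin> \<Omega> \<longrightarrow> u x = 0" "kernel_diff u \<in> borel_measurable lebesgue"
  using assms kernel_diff_measurable[of u] by (auto simp: X0_iff)

lemma kernel_diff_mult_integrable:
  assumes "u \<in> X0" "v \<in> X0"
  shows "integrable lebesgue (\<lambda>z. kernel_diff u z * kernel_diff v z)"
proof (rule Bochner_Integration.integrable_bound)
  show "integrable lebesgue (\<lambda>z. (kernel_diff u z)\<^sup>2 + (kernel_diff v z)\<^sup>2)"
    using X0_D[OF assms(1)] X0_D[OF assms(2)] by auto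
  show "(\<lambda>z. kernel_diff u z * kernel_diff v z) \<in> borel_measurable lebesgue"
    using X0_D[OF assms(1)] X0_D[OF assms(2)] by auto
  have "\<bar>a * b\<bar> \<le> a\<^sup>2 + b\<^sup>2" for a b :: real
  proof -
    have "2 * \<bar>a * b\<bar> \<le> a\<^sup>2 + b\<^sup>2"
      using sum_squares_bound[of "\<bar>a\<bar>" "\<bar>b\<bar>"] by (simp add: abs_mult mult.assoc)
    then show ?thesis using abs_ge_zero[of "a * b"] by linarith
  qed
  then show "AE z in lebesgue. norm (kernel_diff u z * kernel_diff v z) \<le> norm ((kernel_diff u z)\<^sup>2 + (kernel_diff v z)\<^sup>2)"
    by (intro AE_I2) simp
qed

lemma kernel_diff_lincomb:
  "kernel_diff (\<lambda>x. a * u x + b * v x) z = a * kernel_diff u z + b * kernel_diff v z"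
  by (simp add: kernel_diff_def algebra_simps)

lemma X0_lincomb:
  assumes u: "u \<in> X0" and v: "v \<in> X0"
  shows "(\<lambda>x. a * u x + b * v x) \<in> X0"
    and "energy (\<lambda>x. a * u x + b * v x) = a\<^sup>2 * energy u + 2 * (a * b) * X0_inner \<Omega> K u v + b\<^sup>2 * energy v"
proof -
  note qi = kernel_diff_mult_integrable[OF u u] kernel_diff_mult_integrable[OF u v] kernel_diff_mult_integrable[OF v v]
  have sq: "(kernel_diff (\<lambda>x. a * u x + b * v x) z)\<^sup>2 =
      a\<^sup>2 * (kernel_diff u z * kernel_diff u z) + 2 * (a * b) * (kernel_diff u z * kernel_diff v z) + b\<^sup>2 * (kernel_diff v z * kernel_diff v z)" for z
    unfolding kernel_diff_lincomb by (simp add: power2_eq_square algebra_simps)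
  have [measurable]: "u \<in> borel_measurable lebesgue" "v \<in> borel_measurable lebesgue"
    using u v by (auto simp: X0_iff)
  show "(\<lambda>x. a * u x + b * v x) \<in> X0"
    unfolding X0_iff
  proof (intro conjI)
    show "integrable lebesgue (\<lambda>z. (kernel_diff (\<lambda>x. a * u x + b * v x) z)\<^sup>2)"
      unfolding sq using qi by auto
    show "integrable lebesgue (\<lambda>x. indicator \<Omega> x * (a * u x + b * v x)\<^sup>2)"
    proof (rule Bochner_Integration.integrable_bound)
      show "integrable lebesgue (\<lambda>x. 2 * a\<^sup>2 * (indicator \<Omega> x * (u x)\<^sup>2) + 2 * b\<^sup>2 * (indicator \<Omega> x * (v x)\<^sup>2))"
        using u v by (auto simp: X0_iff)
      have "(c + d)\<^sup>2 \<le> 2 * c\<^sup>2 + 2 * d\<^sup>2" for c d :: real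
        using sum_squares_bound[of c d] by (simp add: power2_sum)
      from this[of "a * u _" "b * v _"]
      have "(a * u x + b * v x)\<^sup>2 \<le> 2 * a\<^sup>2 * (u x)\<^sup>2 + 2 * b\<^sup>2 * (v x)\<^sup>2" for x
        by (simp add: power_mult_distrib mult.assoc)
      then show "AE x in lebesgue. norm (indicator \<Omega> x * (a * u x + b * v x)\<^sup>2) \<le>
          norm (2 * a\<^sup>2 * (indicator \<Omega> x * (u x)\<^sup>2) + 2 * b\<^sup>2 * (indicator \<Omega> x * (v x)\<^sup>2))"
        by (intro AE_I2) (auto simp: indicator_def intro: order_trans[OF _ abs_ge_self])
    qed measurable
    show "AE x in lebesgue. x \<notin> \<Omega> \<longrightarrow> a * u x + b * v x = 0"
      using X0_D(3)[OF u] X0_D(3)[OF v] by eventually_elim auto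
  qed measurable
  have "energy (\<lambda>x. a * u x + b * v x) = (LINT z|lebesgue. (kernel_diff (\<lambda>x. a * u x + b * v x) z)\<^sup>2)"
    by (simp add: X0_inner_eq power2_eq_square)
  also have "\<dots> = a\<^sup>2 * energy u + 2 * (a * b) * X0_inner \<Omega> K u v + b\<^sup>2 * energy v"
    unfolding sq using qi by (simp add: X0_inner_eq)
  finally show "energy (\<lambda>x. a * u x + b * v x) = a\<^sup>2 * energy u + 2 * (a * b) * X0_inner \<Omega> K u v + b\<^sup>2 * energy v" .
qed

lemma zero_X0: "(\<lambda>x. 0) \<in> X0"
  by (simp add: X0_iff kernel_diff_def)

lemma X0_diff: "u \<in> X0 \<Longrightarrow> v \<in> X0 \<Longrightarrow> (\<lambda>x. u x - v x) \<in> X0"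
  using X0_lincomb(1)[of u v 1 "-1"] by simp

lemma X0_uminus: "u \<in> X0 \<Longrightarrow> (\<lambda>x. - u x) \<in> X0"
  using X0_lincomb(1)[of u u "-1" 0] by simp

lemma energy_nonneg: "0 \<le> energy u"
  by (simp add: X0_inner_eq power2_eq_square[symmetric])

lemma nn_integral_kernel_diff:
  assumes "u \<in> X0"
  shows "(\<integral>\<^sup>+z. ennreal ((kernel_diff u z)\<^sup>2) \<partial>lebesgue) = ennreal (energy u)"
  using X0_D[OF assms] by (subst nn_integral_eq_integral) (auto simp: X0_inner_eq power2_eq_square)

text \<open>A Borel representative that vanishes everywhere outside \<open>\<Omega>\<close>: its differences are supported in \<open>Q\<close>, so the lower
  bound for the kernel compares the whole Gagliardo double integral with the energy.\<close>

lemma X0_borel: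
  assumes "u \<in> X0"
  obtains u' where "u' \<in> borel_measurable borel" "\<And>x. x \<notin> \<Omega> \<Longrightarrow> u' x = 0" "AE x in lborel. u x = u' x"
    "gagliardo s u' \<le> ennreal (energy u / k\<^sub>0)"
proof -
  obtain g where g[measurable]: "g \<in> borel_measurable borel" and ug: "AE x in lborel. u x = g x"
    using completion_ex_borel_measurable_real[OF X0_D(1)[OF assms]] by auto
  define u' where "u' x = indicator \<Omega> x * g x" for x
  have [measurable]: "u' \<in> borel_measurable borel" unfolding u'_def by measurable
  have uu': "AE x in lborel. u x = u' x"
    using ug X0_D(3)[OF assms] unfolding AE_completion_iff
    by eventually_elim (auto simp: u'_def indicator_def)
  let ?k = "\<lambda>z. (u' (fst z) - u' (snd z))\<^sup>2 * norm (fst z - snd z) powr (- (real DIM('a) + 2 * s))"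
  have k: "?k \<in> borel_measurable borel" unfolding borel_prod[symmetric] by measurable
  then have kk: "(\<lambda>z. ennreal (?k z)) \<in> borel_measurable borel" by measurable
  have "ennreal k\<^sub>0 * gagliardo s u' = ennreal k\<^sub>0 * (\<integral>\<^sup>+z. ennreal (?k z) \<partial>lborel)"
    unfolding gagliardo_def using nn_integral_lborel_prod(1)[OF kk] by simp
  also have "\<dots> = (\<integral>\<^sup>+z. ennreal (k\<^sub>0 * ?k z) \<partial>lborel)"
    using nn_integral_cmult[of "\<lambda>z. ennreal (?k z)" lborel "ennreal k\<^sub>0"] kk k\<^sub>0 by (simp add: ennreal_mult'[of k\<^sub>0])
  also have "\<dots> \<le> (\<integral>\<^sup>+z. ennreal ((kernel_diff u z)\<^sup>2) \<partial>lborel)"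
  proof (intro nn_integral_mono_AE)
    show "AE z in lborel. ennreal (k\<^sub>0 * ?k z) \<le> ennreal ((kernel_diff u z)\<^sup>2)"
      using AE_lborel_fst[OF uu'] AE_lborel_snd[OF uu']
    proof eventually_elim
      case (elim z)
      show ?case
      proof (cases "fst z = snd z \<or> z \<notin> Q_set \<Omega>")
        case True
        then have "u' (fst z) = u' (snd z)"
          by (auto simp: Q_set_def u'_def)
        then show ?thesis by simp
      next
        case False
        then have "k\<^sub>0 * norm (fst z - snd z) powr (- (real DIM('a) + 2 * s)) \<le> K (fst z - snd z)"
          by (intro K_lower) auto
        then have "(u' (fst z) - u' (snd z))\<^sup>2 * (k\<^sub>0 * norm (fst z - snd z) powr (- (real DIM('a) + 2 * s)))
            \<le> (u' (fst z) - u' (snd z))\<^sup>2 * K (fst z - snd z)"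
          by (intro mult_left_mono) auto
        also have "\<dots> = (kernel_diff u z)\<^sup>2"
          using False elim kernel_diff_mult[of u z u] by (simp add: power2_eq_square)
        finally show ?thesis by (intro ennreal_leI) (simp add: mult_ac)
      qed
    qed
  qed
  also have "\<dots> = ennreal (energy u)"
    using nn_integral_kernel_diff[OF assms] by (simp add: nn_integral_completion)
  finally have "ennreal (1 / k\<^sub>0) * (ennreal k\<^sub>0 * gagliardo s u') \<le> ennreal (1 / k\<^sub>0) * ennreal (energy u)"
    by (intro mult_left_mono) auto
  moreover have "ennreal (1 / k\<^sub>0) * (ennreal k\<^sub>0 * gagliardo s u') = gagliardo s u'"
    using k\<^sub>0 by (simp add: mult.assoc[symmetric] ennreal_mult[symmetric])
  ultimately have "gagliardo s u' \<le> ennreal (energy u / k\<^sub>0)"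
    using k\<^sub>0 energy_nonneg[of u] by (simp add: ennreal_mult[symmetric])
  then show ?thesis
    using that[of u'] uu' by (auto simp: u'_def)
qed

definition sobolev_C :: real where
  "sobolev_C = sobolev_const (real DIM('a)) s / k\<^sub>0"

lemma sobolev_C_pos: "0 < sobolev_C"
proof -
  have "unit_ball_vol (real DIM('a)) \<noteq> 0"
    using unit_ball_vol_pos[of "real DIM('a)"] by (metis less_irrefl of_nat_0_le_iff)
  then show ?thesis unfolding sobolev_C_def sobolev_const_def using k\<^sub>0
    by (intro divide_pos_pos mult_pos_pos) auto
qed

lemma X0_sobolev_nn:
  assumes u: "u \<in> X0"
  shows "(\<integral>\<^sup>+x. ennreal (\<bar>u x\<bar> powr p) \<partial>lebesgue) \<le> ennreal ((sobolev_C * energy u) powr (p / 2))"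
proof -
  obtain u' where u': "u' \<in> borel_measurable borel" "\<And>x. x \<notin> \<Omega> \<Longrightarrow> u' x = 0" "AE x in lborel. u x = u' x"
    "gagliardo s u' \<le> ennreal (energy u / k\<^sub>0)"
    using X0_borel[OF u] by blast
  have "(\<integral>\<^sup>+x. ennreal (\<bar>u x\<bar> powr p) \<partial>lebesgue) = (\<integral>\<^sup>+x. ennreal (\<bar>u' x\<bar> powr p) \<partial>lborel)"
    unfolding nn_integral_completion by (intro nn_integral_cong_AE eventually_mono[OF u'(3)]) simp
  also have "\<dots> \<le> ennreal ((sobolev_const (real DIM('a)) s * (energy u / k\<^sub>0)) powr (p / 2))"
    by (rule fractional_sobolev[OF s p u'(1) \<Omega>(3) u'(2) _ u'(4)]) (use k\<^sub>0 energy_nonneg[of u] in simp_all)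
  finally show ?thesis by (simp add: sobolev_C_def)
qed

lemma X0_sobolev:
  assumes u: "u \<in> X0"
  shows "integrable lebesgue (\<lambda>x. \<bar>u x\<bar> powr p)"
    and "(LINT x|lebesgue. \<bar>u x\<bar> powr p) \<le> (sobolev_C * energy u) powr (p / 2)"
proof -
  have [measurable]: "u \<in> borel_measurable lebesgue" by (rule X0_D(1)[OF u])
  show int: "integrable lebesgue (\<lambda>x. \<bar>u x\<bar> powr p)"
  proof (rule integrableI_bounded)
    have "(\<integral>\<^sup>+x. ennreal (norm (\<bar>u x\<bar> powr p)) \<partial>lebesgue) \<le> ennreal ((sobolev_C * energy u) powr (p / 2))"
      using X0_sobolev_nn[OF u] by simp
    also have "\<dots> < \<infinity>" by simp
    finally show "(\<integral>\<^sup>+x. ennreal (norm (\<bar>u x\<bar> powr p)) \<partial>lebesgue) < \<infinity>" .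
  qed measurable
  show "(LINT x|lebesgue. \<bar>u x\<bar> powr p) \<le> (sobolev_C * energy u) powr (p / 2)"
    using X0_sobolev_nn[OF u] by (subst (asm) nn_integral_eq_integral[OF int]) auto
qed

end

section \<open>Closedness, compactness and nontriviality of \<open>X\<^sub>0\<close>\<close>

lemma powr_le_one_plus_powr:
  fixes x a b :: real
  assumes "0 \<le> x" "0 \<le> a" "a \<le> b"
  shows "x powr a \<le> 1 + x powr b"
proof (cases "x \<le> 1")
  case True
  then have "x powr a \<le> 1 powr a" using assms by (intro powr_mono2) auto
  then show ?thesis using powr_ge_zero[of x b] unfolding powr_one_eq_one by linarith
next
  case False
  then have "x powr a \<le> x powr b" using assms by (intro powr_mono) auto
  then show ?thesis by simp
qed

context fractional_kernel
begin

lemma abs_le_powr: "\<bar>x\<bar> \<le> 1 + \<bar>x\<bar> powr p"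
  using powr_le_one_plus_powr[of "\<bar>x\<bar>" 1 p] p_gt_2 by simp

lemma sq_le_powr: "x\<^sup>2 \<le> 1 + \<bar>x\<bar> powr p"
proof -
  have "\<bar>x\<bar> powr 2 = x\<^sup>2" by simp
  then show ?thesis using powr_le_one_plus_powr[of "\<bar>x\<bar>" 2 p] p_gt_2 by simp
qed

lemma Omega_integrable: "integrable lebesgue (indicator \<Omega> :: 'a \<Rightarrow> real)" "integrable lborel (indicator \<Omega> :: 'a \<Rightarrow> real)"
  using emeasure_Omega by (auto simp: integrable_indicator_iff)

text \<open>Fatou's lemma, applied to \<open>kernel_diff (u k)\<close> and to \<open>|u k|\<^sup>p\<close>. This takes the place of both completeness of
  \<open>X\<^sub>0\<close> and weak lower semicontinuity of the norm.\<close>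

lemma X0_AE_closed:
  fixes u :: "nat \<Rightarrow> 'a \<Rightarrow> real"
  assumes u: "\<And>k. u k \<in> X0" and v: "v \<in> borel_measurable lebesgue"
    and lim: "AE x in lebesgue. (\<lambda>k. u k x) \<longlonglongrightarrow> v x"
    and bound: "eventually (\<lambda>k. energy (u k) \<le> M) sequentially"
  shows "v \<in> X0" "energy v \<le> M"
proof -
  obtain k where "energy (u k) \<le> M" using bound by (auto simp: eventually_sequentially)
  then have M: "0 \<le> M" using energy_nonneg[of "u k"] by linarith
  have lim': "AE x in lborel. (\<lambda>k. u k x) \<longlonglongrightarrow> v x" using lim by (simp add: AE_completion_iff)
  have "(\<integral>\<^sup>+z. ennreal ((kernel_diff v z)\<^sup>2) \<partial>lebesgue) \<le> ennreal M"
  proof (rule fatou_AE_bound[where f = "\<lambda>k z. (kernel_diff (u k) z)\<^sup>2"])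
    show "AE z in lebesgue. (\<lambda>k. (kernel_diff (u k) z)\<^sup>2) \<longlonglongrightarrow> (kernel_diff v z)\<^sup>2"
      unfolding AE_completion_iff using AE_lborel_fst[OF lim'] AE_lborel_snd[OF lim']
      by eventually_elim (unfold kernel_diff_def, intro tendsto_intros)
    show "\<forall>\<^sub>F k in sequentially. (\<integral>\<^sup>+z. ennreal ((kernel_diff (u k) z)\<^sup>2) \<partial>lebesgue) \<le> ennreal M"
      using bound by eventually_elim (simp add: nn_integral_kernel_diff[OF u] ennreal_leI)
    show "(\<lambda>z. (kernel_diff (u k) z)\<^sup>2) \<in> borel_measurable lebesgue" for k
      using X0_D(2)[OF u] by (rule borel_measurable_integrable)
  qed
  note nnq = this
  have qm[measurable]: "kernel_diff v \<in> borel_measurable lebesgue" using kernel_diff_measurable[OF v] .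
  have qi: "integrable lebesgue (\<lambda>z. (kernel_diff v z)\<^sup>2)"
    by (rule integrableI_bounded) (use nnq in \<open>auto simp: top.not_eq_extremum[symmetric] top_unique intro: le_less_trans\<close>)
  have vp: "(\<integral>\<^sup>+x. ennreal (\<bar>v x\<bar> powr p) \<partial>lebesgue) \<le> ennreal ((sobolev_C * M) powr (p / 2))"
  proof (rule fatou_AE_bound[where f = "\<lambda>k x. \<bar>u k x\<bar> powr p"])
    show "AE x in lebesgue. (\<lambda>k. \<bar>u k x\<bar> powr p) \<longlonglongrightarrow> \<bar>v x\<bar> powr p"
      using lim by eventually_elim (use p_gt_2 in \<open>auto intro!: tendsto_powr2 tendsto_rabs\<close>)
    show "\<forall>\<^sub>F k in sequentially. (\<integral>\<^sup>+x. ennreal (\<bar>u k x\<bar> powr p) \<partial>lebesgue) \<le> ennreal ((sobolev_C * M) powr (p / 2))"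
      using bound
    proof eventually_elim
      case (elim k)
      have "(sobolev_C * energy (u k)) powr (p / 2) \<le> (sobolev_C * M) powr (p / 2)"
        using elim sobolev_C_pos energy_nonneg[of "u k"] p_gt_2 by (intro powr_mono2 mult_left_mono) auto
      then show ?case using X0_sobolev_nn[OF u, of k] by (meson ennreal_leI order_trans)
    qed
    show "(\<lambda>x. \<bar>u k x\<bar> powr p) \<in> borel_measurable lebesgue" for k
      using X0_sobolev(1)[OF u] by (rule borel_measurable_integrable)
  qed
  have vpi: "integrable lebesgue (\<lambda>x. \<bar>v x\<bar> powr p)"
    by (rule integrableI_bounded) (use v vp in \<open>auto intro: le_less_trans\<close>)
  show "v \<in> X0" unfolding X0_iff
  proof (intro conjI v qi)
    show "integrable lebesgue (\<lambda>x. indicator \<Omega> x * (v x)\<^sup>2)"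
    proof (rule Bochner_Integration.integrable_bound)
      show "integrable lebesgue (\<lambda>x. indicator \<Omega> x + \<bar>v x\<bar> powr p)" using vpi Omega_integrable by auto
      show "AE x in lebesgue. norm (indicator \<Omega> x * (v x)\<^sup>2) \<le> norm (indicator \<Omega> x + \<bar>v x\<bar> powr p)"
        using sq_le_powr by (intro AE_I2) (auto simp: indicator_def)
    qed (use v in auto)
    have "AE x in lebesgue. \<forall>k. x \<notin> \<Omega> \<longrightarrow> u k x = 0"
      unfolding AE_all_countable using X0_D(3)[OF u] by blast
    then show "AE x in lebesgue. x \<notin> \<Omega> \<longrightarrow> v x = 0"
      using lim by eventually_elim (auto intro: LIMSEQ_unique[OF _ tendsto_const])
  qed
  then have "ennreal (energy v) \<le> ennreal M" using nn_integral_kernel_diff nnq by metis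
  then show "energy v \<le> M" using M by (simp add: ennreal_le_iff)
qed

text \<open>The compactness theorem for Borel representatives; their \<open>L\<^sup>1\<close> norms are bounded by \<open>|\<Omega>|\<close> plus the \<open>p\<close>-th powers
  of their \<open>L\<^sup>p\<close> norms.\<close>

lemma X0_compact:
  fixes u :: "nat \<Rightarrow> 'a \<Rightarrow> real"
  assumes u: "\<And>k. u k \<in> X0" and M: "\<And>k. energy (u k) \<le> M"
  obtains r v where "strict_mono r" "v \<in> borel_measurable lebesgue"
    "AE x in lebesgue. (\<lambda>i. u (r i) x) \<longlonglongrightarrow> v x"
proof -
  have M0: "0 \<le> M" using energy_nonneg[of "u 0"] M[of 0] by linarith
  have "\<exists>w. w \<in> borel_measurable borel \<and> (\<forall>x. x \<notin> \<Omega> \<longrightarrow> w x = 0) \<and> (AE x in lborel. u k x = w x)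
    \<and> gagliardo s w \<le> ennreal (energy (u k) / k\<^sub>0)" for k
    using X0_borel[OF u[of k]] by metis
  then obtain w where w: "\<And>k. w k \<in> borel_measurable borel" "\<And>k x. x \<notin> \<Omega> \<Longrightarrow> w k x = 0"
    "\<And>k. AE x in lborel. u k x = w k x" "\<And>k. gagliardo s (w k) \<le> ennreal (energy (u k) / k\<^sub>0)"
    by metis
  note [measurable] = w(1)
  have wp: "integrable lborel (\<lambda>x. \<bar>w k x\<bar> powr p)" "(LINT x|lborel. \<bar>w k x\<bar> powr p) \<le> (sobolev_C * M) powr (p / 2)" for k
  proof -
    have ae: "AE x in lebesgue. \<bar>u k x\<bar> powr p = \<bar>w k x\<bar> powr p"
      unfolding AE_completion_iff by (rule eventually_mono[OF w(3)[of k]]) simp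
    have m: "(\<lambda>x. \<bar>w k x\<bar> powr p) \<in> borel_measurable lebesgue"
      by (rule measurable_completion) simp
    have "integrable lebesgue (\<lambda>x. \<bar>w k x\<bar> powr p)"
      by (rule integrable_cong_AE_imp[OF X0_sobolev(1)[OF u[of k]] m ae])
    then show "integrable lborel (\<lambda>x. \<bar>w k x\<bar> powr p)" by (simp add: integrable_completion)
    have "(LINT x|lborel. \<bar>w k x\<bar> powr p) = (LINT x|lebesgue. \<bar>w k x\<bar> powr p)"
      by (simp add: integral_completion)
    also have "\<dots> = (LINT x|lebesgue. \<bar>u k x\<bar> powr p)"
      using X0_sobolev(1)[OF u[of k]] m ae by (intro integral_cong_AE) auto
    also have "\<dots> \<le> (sobolev_C * energy (u k)) powr (p / 2)" by (rule X0_sobolev(2)[OF u])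
    also have "\<dots> \<le> (sobolev_C * M) powr (p / 2)"
      using M[of k] sobolev_C_pos energy_nonneg[of "u k"] p_gt_2 by (intro powr_mono2 mult_left_mono) auto
    finally show "(LINT x|lborel. \<bar>w k x\<bar> powr p) \<le> (sobolev_C * M) powr (p / 2)" .
  qed
  have bd: "\<bar>w k x\<bar> \<le> indicator \<Omega> x + \<bar>w k x\<bar> powr p" for k x
    using abs_le_powr[of "w k x"] w(2)[of x k] by (auto simp: indicator_def)
  have wi: "integrable lborel (w k)" for k
  proof (rule Bochner_Integration.integrable_bound)
    show "integrable lborel (\<lambda>x. indicator \<Omega> x + \<bar>w k x\<bar> powr p)" using wp(1)[of k] Omega_integrable(2) by auto
    show "AE x in lborel. norm (w k x) \<le> norm (indicator \<Omega> x + \<bar>w k x\<bar> powr p)"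
      using bd[of k] by (intro AE_I2) (metis abs_ge_self order_trans real_norm_def)
  qed (use w in auto)
  define M1 where "M1 = (LINT x|lborel. indicator \<Omega> x) + (sobolev_C * M) powr (p / 2)"
  have wM: "(LINT x|lborel. \<bar>w k x\<bar>) \<le> M1" for k
  proof -
    have "(LINT x|lborel. \<bar>w k x\<bar>) \<le> (LINT x|lborel. indicator \<Omega> x + \<bar>w k x\<bar> powr p)"
      using wi[of k] wp(1)[of k] Omega_integrable(2) bd by (intro integral_mono) auto
    also have "\<dots> = (LINT x|lborel. indicator \<Omega> x) + (LINT x|lborel. \<bar>w k x\<bar> powr p)"
      using wp(1)[of k] Omega_integrable(2) by (intro Bochner_Integration.integral_add) auto
    also have "\<dots> \<le> M1" unfolding M1_def using wp(2)[of k] by simp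
    finally show ?thesis .
  qed
  have wE: "gagliardo s (w k) \<le> ennreal (M / k\<^sub>0)" for k
    using w(4)[of k] M[of k] k\<^sub>0 by (meson divide_right_mono ennreal_leI less_imp_le order_trans)
  have e0: "0 \<le> M / k\<^sub>0" using M0 k\<^sub>0 by simp
  obtain r where r: "strict_mono r" "AE x in lborel. convergent (\<lambda>i. w (r i) x)"
    by (rule gagliardo_compact[OF s(1) wi \<Omega>(3) w(2) wM e0 wE])
  define v where "v x = lim (\<lambda>i. w (r i) x)" for x
  have "v \<in> borel_measurable borel" unfolding v_def by measurable
  then have vm: "v \<in> borel_measurable lebesgue" by (intro measurable_completion) simp
  have "AE x in lborel. \<forall>k. u k x = w k x" unfolding AE_all_countable using w(3) by blast
  with r(2) have "AE x in lborel. (\<lambda>i. u (r i) x) \<longlonglongrightarrow> v x"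
    by eventually_elim (auto simp: v_def convergent_LIMSEQ_iff)
  then show thesis using that[OF r(1) vm] by (simp add: AE_completion_iff)
qed

text \<open>The tent \<open>max 0 (r - |x - x\<^sub>0|)\<close> with \<open>r \<le> 1\<close>: its squared increments are at most \<open>min (|x - y|\<^sup>2) 1\<close>, the weight in
  the integrability condition on the kernel, and on \<open>Q\<close> one of the two points lies in the bounded set \<open>\<Omega>\<close>.\<close>

lemma exists_bump:
  obtains \<phi> where "\<phi> \<in> X0" "\<And>x. 0 \<le> \<phi> x" "\<And>x. \<phi> x \<le> 1" "\<phi> \<in> borel_measurable borel"
    "\<not> (AE x in lebesgue. \<phi> x = 0)" "\<And>x. x \<notin> \<Omega> \<Longrightarrow> \<phi> x = 0"
proof -
  obtain x0 r0 where "x0 \<in> \<Omega>" "0 < r0" "ball x0 r0 \<subseteq> \<Omega>"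
    using \<Omega>(1,2) open_contains_ball by blast
  then obtain r where r: "0 < r" "r \<le> 1" "ball x0 r \<subseteq> \<Omega>"
    using that[of "min r0 1"] by (meson ball_min_Int min.cobounded2 min_less_iff_conj order_trans subset_ball min.cobounded1 zero_less_one)
  define \<phi> where "\<phi> x = max 0 (r - dist x0 x)" for x
  have m[measurable]: "\<phi> \<in> borel_measurable borel" unfolding \<phi>_def by measurable
  have out: "\<phi> x = 0" if "x \<notin> \<Omega>" for x
  proof -
    have "\<not> dist x0 x < r" using that r by (auto simp: subset_iff)
    then show ?thesis by (simp add: \<phi>_def)
  qed
  have bnd: "0 \<le> \<phi> x" "\<phi> x \<le> 1" for x using r by (auto simp: \<phi>_def intro: order_trans[OF _ r(2)])
  have lip: "(\<phi> x - \<phi> y)\<^sup>2 \<le> min ((norm (x - y))\<^sup>2) 1" for x y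
  proof -
    have "\<bar>dist x0 x - dist x0 y\<bar> \<le> dist x y" by metric
    then have "\<bar>\<phi> x - \<phi> y\<bar> \<le> \<bar>norm (x - y)\<bar>" by (auto simp: \<phi>_def dist_norm[of x y])
    moreover have "\<bar>\<phi> x - \<phi> y\<bar> \<le> \<bar>1\<bar>" using bnd[of x] bnd[of y] by auto
    ultimately show ?thesis unfolding abs_le_square_iff by simp
  qed
  obtain K' where [measurable]: "K' \<in> borel_measurable borel" and KK': "AE x in lborel. K x = K' x"
    by (rule K_borel)
  let ?f = "\<lambda>x. ennreal (min ((norm x)\<^sup>2) 1 * K' x)"
  have "(\<integral>\<^sup>+x. ?f x \<partial>lborel) = (\<integral>\<^sup>+x. ennreal (min ((norm x)\<^sup>2) 1 * K x) \<partial>lborel)"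
    by (intro nn_integral_cong_AE eventually_mono[OF KK']) simp
  also have "\<dots> = (\<integral>\<^sup>+x. ennreal (min ((norm x)\<^sup>2) 1 * K x) \<partial>lebesgue)"
    by (simp add: nn_integral_completion)
  also have "\<dots> \<le> (\<integral>\<^sup>+x. ennreal (norm (min ((norm x)\<^sup>2) 1 * K x)) \<partial>lebesgue)"
    by (intro nn_integral_mono ennreal_leI) simp
  also have "\<dots> < \<infinity>" using K_int by (simp add: integrable_iff_bounded)
  finally have f_fin: "(\<integral>\<^sup>+x. ?f x \<partial>lborel) < \<infinity>" .
  have m_leb: "\<phi> \<in> borel_measurable lebesgue" by (rule measurable_completion) simp
  have "(\<integral>\<^sup>+z. ennreal ((kernel_diff \<phi> z)\<^sup>2) \<partial>lebesgue) = (\<integral>\<^sup>+z. ennreal ((kernel_diff \<phi> z)\<^sup>2) \<partial>lborel)"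
    by (simp add: nn_integral_completion)
  also have "\<dots> \<le> (\<integral>\<^sup>+z. indicator \<Omega> (fst z) * ?f (fst z - snd z) + indicator \<Omega> (snd z) * ?f (fst z - snd z) \<partial>lborel)"
  proof (intro nn_integral_mono_AE eventually_mono[OF AE_lborel_diff[OF KK']])
    fix z :: "'a \<times> 'a" assume KK: "K (fst z - snd z) = K' (fst z - snd z)"
    show "ennreal ((kernel_diff \<phi> z)\<^sup>2) \<le> indicator \<Omega> (fst z) * ?f (fst z - snd z) + indicator \<Omega> (snd z) * ?f (fst z - snd z)"
    proof (cases "z \<in> Q_set \<Omega> \<and> fst z \<noteq> snd z")
      case True
      then have "0 < K (fst z - snd z)" by (intro K_pos) auto
      then have "(\<phi> (fst z) - \<phi> (snd z))\<^sup>2 * K (fst z - snd z) \<le> min ((norm (fst z - snd z))\<^sup>2) 1 * K (fst z - snd z)"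
        using lip by (intro mult_right_mono) auto
      then have "(kernel_diff \<phi> z)\<^sup>2 \<le> min ((norm (fst z - snd z))\<^sup>2) 1 * K' (fst z - snd z)"
        using True kernel_diff_mult[of \<phi> z \<phi>] unfolding KK by (simp add: power2_eq_square)
      then have "ennreal ((kernel_diff \<phi> z)\<^sup>2) \<le> ?f (fst z - snd z)" by (rule ennreal_leI)
      moreover have "fst z \<in> \<Omega> \<or> snd z \<in> \<Omega>" using True by (cases z) (auto simp: Q_set_def)
      ultimately show ?thesis by (auto simp: indicator_def intro: order_trans)
    next
      case False
      then have "kernel_diff \<phi> z = 0" by (auto simp: kernel_diff_def)
      then show ?thesis by simp
    qed
  qed
  also have "\<dots> = (\<integral>\<^sup>+z. indicator \<Omega> (fst z) * ?f (fst z - snd z) \<partial>lborel) + (\<integral>\<^sup>+z. indicator \<Omega> (snd z) * ?f (fst z - snd z) \<partial>lborel)"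
    by (intro nn_integral_add) (simp_all add: borel_prod[symmetric])
  also have "(\<integral>\<^sup>+z. indicator \<Omega> (fst z) * ?f (fst z - snd z) \<partial>lborel)
      = (\<integral>\<^sup>+x. \<integral>\<^sup>+y. indicator \<Omega> x * ?f (x - y) \<partial>lborel \<partial>lborel)"
    by (subst nn_integral_lborel_prod(1)) (simp_all add: borel_prod[symmetric])
  also have "\<dots> = (\<integral>\<^sup>+x. indicator \<Omega> x * (\<integral>\<^sup>+y. ?f y \<partial>lborel) \<partial>lborel)"
    by (intro nn_integral_cong) (subst nn_integral_cmult, simp, subst nn_integral_lborel_reflect[where f = ?f], simp_all)
  also have "\<dots> = emeasure lborel \<Omega> * (\<integral>\<^sup>+y. ?f y \<partial>lborel)"
    by (subst nn_integral_multc) simp_all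
  also have "(\<integral>\<^sup>+z. indicator \<Omega> (snd z) * ?f (fst z - snd z) \<partial>lborel)
      = (\<integral>\<^sup>+y. \<integral>\<^sup>+x. indicator \<Omega> y * ?f (x - y) \<partial>lborel \<partial>lborel)"
    by (subst nn_integral_lborel_prod(2)) (simp_all add: borel_prod[symmetric])
  also have "\<dots> = (\<integral>\<^sup>+y. indicator \<Omega> y * (\<integral>\<^sup>+x. ?f x \<partial>lborel) \<partial>lborel)"
    by (intro nn_integral_cong) (subst nn_integral_cmult, simp, subst nn_integral_lborel_shift[where f = ?f], simp_all)
  also have "\<dots> = emeasure lborel \<Omega> * (\<integral>\<^sup>+y. ?f y \<partial>lborel)"
    by (subst nn_integral_multc) simp_all
  finally have "(\<integral>\<^sup>+z. ennreal ((kernel_diff \<phi> z)\<^sup>2) \<partial>lebesgue) < \<infinity>"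
    using f_fin emeasure_Omega(1) by (auto simp: ennreal_mult_less_top intro: le_less_trans)
  then have qi: "integrable lebesgue (\<lambda>z. (kernel_diff \<phi> z)\<^sup>2)"
    using kernel_diff_measurable[OF m_leb] by (intro integrableI_bounded) auto
  have "\<phi> \<in> X0" unfolding X0_iff
  proof (intro conjI m_leb qi)
    show "integrable lebesgue (\<lambda>x. indicator \<Omega> x * (\<phi> x)\<^sup>2)"
    proof (rule Bochner_Integration.integrable_bound[OF Omega_integrable(1)])
      show "AE x in lebesgue. norm (indicator \<Omega> x * (\<phi> x)\<^sup>2) \<le> norm (indicator \<Omega> x :: real)"
        using bnd by (intro AE_I2) (auto simp: indicator_def power_le_one)
    qed (use m_leb in auto)
    show "AE x in lebesgue. x \<notin> \<Omega> \<longrightarrow> \<phi> x = 0" using out by auto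
  qed
  moreover have "\<not> (AE x in lebesgue. \<phi> x = 0)"
  proof
    assume "AE x in lebesgue. \<phi> x = 0"
    then have "AE x in lborel. x \<notin> ball x0 r"
      unfolding AE_completion_iff by eventually_elim (auto simp: \<phi>_def)
    then have "emeasure lborel (ball x0 r) = 0"
      by (subst (asm) AE_iff_measurable[of "ball x0 r"]) auto
    moreover have "unit_ball_vol (real DIM('a)) \<noteq> 0"
      using unit_ball_vol_pos[of "real DIM('a)"] by (metis less_irrefl of_nat_0_le_iff)
    ultimately show False using r by (simp add: emeasure_ball)
  qed
  ultimately show thesis using that[of \<phi>] bnd out m by auto
qed

lemma Lp_norm_le:
  assumes u: "u \<in> X0"
  shows "Lp_norm p u \<le> sqrt sobolev_C * X0_norm \<Omega> K u"
proof -
  have "Lp_norm p u \<le> ((sobolev_C * energy u) powr (p / 2)) powr (1 / p)"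
    unfolding Lp_norm_def using X0_sobolev(2)[OF u] p_gt_2 by (intro powr_mono2) auto
  also have "\<dots> = sqrt (sobolev_C * energy u)"
    using p_gt_2 sobolev_C_pos energy_nonneg[of u] by (simp add: powr_powr powr_half_sqrt)
  finally show ?thesis by (simp add: X0_norm_def real_sqrt_mult)
qed

text \<open>The Sobolev inequality bounds the set of quotients, so that its \<open>Sup\<close> dominates the positive quotient of a
  bump.\<close>

lemma embedding_const_pos: "0 < embedding_const \<Omega> K p"
proof -
  obtain \<phi> where \<phi>: "\<phi> \<in> X0" "\<not> (AE x in lebesgue. \<phi> x = 0)" using exists_bump by metis
  let ?A = "{Lp_norm p u / X0_norm \<Omega> K u | u. u \<in> X0 \<and> \<not> (AE x in lebesgue. u x = 0)}"
  have nonneg: "0 \<le> X0_norm \<Omega> K u" for u unfolding X0_norm_def using energy_nonneg by simp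
  have "(LINT x|lebesgue. \<bar>\<phi> x\<bar> powr p) \<noteq> 0"
    using \<phi>(2) X0_sobolev(1)[OF \<phi>(1)] by (subst integral_nonneg_eq_0_iff_AE) auto
  then have L: "0 < Lp_norm p \<phi>" by (simp add: Lp_norm_def)
  have "X0_norm \<Omega> K \<phi> \<noteq> 0" using L Lp_norm_le[OF \<phi>(1)] by auto
  then have N: "0 < X0_norm \<Omega> K \<phi>" using nonneg[of \<phi>] by linarith
  have "bdd_above ?A"
  proof (rule bdd_aboveI[of _ "sqrt sobolev_C"])
    fix y assume "y \<in> ?A"
    then obtain u where u: "u \<in> X0" "y = Lp_norm p u / X0_norm \<Omega> K u" by auto
    show "y \<le> sqrt sobolev_C"
      using Lp_norm_le[OF u(1)] nonneg[of u] sobolev_C_pos unfolding u(2)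
      by (cases "X0_norm \<Omega> K u = 0") (auto simp: divide_le_eq)
  qed
  moreover have "Lp_norm p \<phi> / X0_norm \<Omega> K \<phi> \<in> ?A" using \<phi> by blast
  ultimately have "Lp_norm p \<phi> / X0_norm \<Omega> K \<phi> \<le> embedding_const \<Omega> K p"
    unfolding embedding_const_def by (intro cSup_upper)
  then show ?thesis using L N by (meson divide_pos_pos less_le_trans)
qed

end

section \<open>Integrals of nonlinear functions\<close>

lemma tendsto_abs_powr_0:
  assumes "0 < (r::real)"
  shows "((\<lambda>h. \<bar>h\<bar> powr r) \<longlongrightarrow> 0) (at 0)"
proof -
  have "((\<lambda>h::real. \<bar>h\<bar> powr r) \<longlongrightarrow> \<bar>0\<bar> powr r) (at 0)"
    using assms by (intro tendsto_powr2 tendsto_rabs tendsto_ident_at tendsto_const) auto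
  then show ?thesis using assms by simp
qed

lemma DERIV_signed_powr:
  assumes r: "0 < (r::real)"
  shows "((\<lambda>t. \<bar>t\<bar> powr r * t) has_real_derivative (r + 1) * \<bar>x\<bar> powr r) (at x)"
proof -
  consider "0 < x" | "x < 0" | "x = 0" by linarith
  then show ?thesis
  proof cases
    case 1
    have "((\<lambda>t. t powr r * t) has_real_derivative (r + 1) * \<bar>x\<bar> powr r) (at x)"
      using 1 by (auto intro!: derivative_eq_intros simp: powr_diff field_simps)
    then show ?thesis
      by (rule has_field_derivative_transform_within_open[of _ _ _ "{0<..}"]) (use 1 in auto)
  next
    case 2
    have "((\<lambda>t. (- t) powr r * t) has_real_derivative (r + 1) * \<bar>x\<bar> powr r) (at x)"
      using 2 by (auto intro!: derivative_eq_intros simp: powr_diff field_simps)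
    then show ?thesis
      by (rule has_field_derivative_transform_within_open[of _ _ _ "{..<0}"]) (use 2 in auto)
  next
    case 3
    have "((\<lambda>h. \<bar>h\<bar> powr r * h / h) \<longlongrightarrow> 0) (at 0)"
      by (rule Lim_transform_eventually[OF tendsto_abs_powr_0[OF r]]) (auto simp: eventually_at_filter)
    then show ?thesis unfolding 3 using r by (simp add: DERIV_def)
  qed
qed

lemma DERIV_abs_powr:
  assumes p: "2 < (p::real)"
  shows "((\<lambda>t. \<bar>t\<bar> powr p) has_real_derivative p * (\<bar>x\<bar> powr (p - 2) * x)) (at x)"
proof -
  have eq: "\<bar>t\<bar> powr p = (\<bar>t\<bar> powr (p - 2) * t) * t" for t :: real
  proof -
    have "\<bar>t\<bar> powr p = \<bar>t\<bar> powr (p - 2) * \<bar>t\<bar> powr 2" unfolding powr_add[symmetric] by simp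
    moreover have "\<bar>t\<bar> powr 2 = t * t" by (simp add: power2_eq_square)
    ultimately show ?thesis by (simp only: mult.assoc)
  qed
  have "((\<lambda>t. (\<bar>t\<bar> powr (p - 2) * t) * t) has_real_derivative p * (\<bar>x\<bar> powr (p - 2) * x)) (at x)"
    by (rule DERIV_cong[OF DERIV_mult[OF DERIV_signed_powr[of "p - 2"] DERIV_ident]])
      (use p in \<open>auto simp: algebra_simps\<close>)
  then show ?thesis unfolding eq .
qed

lemma signed_powr_lipschitz:
  assumes p: "2 < (p::real)" and "\<bar>x\<bar> \<le> M" "\<bar>y\<bar> \<le> M"
  shows "\<bar>\<bar>x\<bar> powr (p - 2) * x - \<bar>y\<bar> powr (p - 2) * y\<bar> \<le> (p - 1) * M powr (p - 2) * \<bar>x - y\<bar>"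
proof -
  have "norm (\<bar>x\<bar> powr (p - 2) * x - \<bar>y\<bar> powr (p - 2) * y) \<le> ((p - 1) * M powr (p - 2)) * norm (x - y)"
  proof (rule field_differentiable_bound[of "{-M..M}"])
    show "((\<lambda>t. \<bar>t\<bar> powr (p - 2) * t) has_field_derivative (p - 2 + 1) * \<bar>z\<bar> powr (p - 2)) (at z within {-M..M})" for z
      using p by (intro has_field_derivative_at_within[OF DERIV_signed_powr]) simp
    show "norm ((p - 2 + 1) * \<bar>z\<bar> powr (p - 2)) \<le> (p - 1) * M powr (p - 2)" if "z \<in> {-M..M}" for z
    proof -
      have "\<bar>z\<bar> powr (p - 2) \<le> M powr (p - 2)" using that p by (intro powr_mono2) auto
      then show ?thesis using p by (simp add: abs_mult)
    qed
    show "x \<in> {-M..M}" "y \<in> {-M..M}" using assms(2,3) by (simp_all add: abs_le_iff)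
  qed (rule convex_real_interval)
  then show ?thesis by (simp only: real_norm_def)
qed

text \<open>Up to the factor \<open>1 / 2\<close> the left-hand side is a second difference of \<open>|t|\<^sup>p\<close>, estimated by the Lipschitz constant of
  its derivative on \<open>[- |a| - |b|, |a| + |b|]\<close>.\<close>

lemma powr_midpoint_gap:
  assumes p: "2 < (p::real)"
  shows "(\<bar>a\<bar> powr p + \<bar>b\<bar> powr p) / 2 - \<bar>(a + b) / 2\<bar> powr p
    \<le> p * (p - 1) / 4 * ((\<bar>a\<bar> + \<bar>b\<bar>) powr (p - 2) * (a - b)\<^sup>2)"
proof -
  define m h where "m = (a + b) / 2" and "h = (a - b) / 2"
  define M where "M = \<bar>a\<bar> + \<bar>b\<bar>"
  let ?\<psi> = "\<lambda>t::real. \<bar>t\<bar> powr p" and ?d = "\<lambda>t::real. \<bar>t\<bar> powr (p - 2) * t"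
  let ?k = "\<lambda>t. ?\<psi> (m + t * h) + ?\<psi> (m - t * h)"
  have bd: "\<bar>m + t * h\<bar> \<le> M" "\<bar>m - t * h\<bar> \<le> M" if "t \<in> {0..1}" for t
  proof -
    have "\<bar>t * h\<bar> \<le> \<bar>h\<bar>" using that by (simp add: abs_mult mult_left_le_one_le)
    moreover have "\<bar>m\<bar> + \<bar>h\<bar> \<le> M" unfolding m_def h_def M_def by (auto simp: abs_if field_simps)
    ultimately show "\<bar>m + t * h\<bar> \<le> M" "\<bar>m - t * h\<bar> \<le> M" by linarith+
  qed
  have "norm (?k 1 - ?k 0) \<le> (2 * p * (p - 1) * M powr (p - 2) * h\<^sup>2) * norm (1 - 0 :: real)"
  proof (rule field_differentiable_bound[of "{0..1}"])
    fix t :: real assume t: "t \<in> {0..1}"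
    have "((\<lambda>t. ?\<psi> (m + t * h)) has_field_derivative p * ?d (m + t * h) * h) (at t)"
      by (rule DERIV_chain2[OF DERIV_abs_powr[OF p]]) (auto intro!: derivative_eq_intros)
    moreover have "((\<lambda>t. ?\<psi> (m - t * h)) has_field_derivative p * ?d (m - t * h) * (- h)) (at t)"
      by (rule DERIV_chain2[OF DERIV_abs_powr[OF p]]) (auto intro!: derivative_eq_intros)
    ultimately have "(?k has_field_derivative p * ?d (m + t * h) * h + p * ?d (m - t * h) * (- h)) (at t)"
      by (rule DERIV_add)
    then have "(?k has_field_derivative p * h * (?d (m + t * h) - ?d (m - t * h))) (at t)"
      by (rule DERIV_cong) (simp add: algebra_simps)
    then show "(?k has_field_derivative p * h * (?d (m + t * h) - ?d (m - t * h))) (at t within {0..1})"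
      by (rule has_field_derivative_at_within)
    have "norm (p * h * (?d (m + t * h) - ?d (m - t * h))) = p * \<bar>h\<bar> * \<bar>?d (m + t * h) - ?d (m - t * h)\<bar>"
      using p by (simp add: abs_mult)
    also have "\<dots> \<le> p * \<bar>h\<bar> * ((p - 1) * M powr (p - 2) * \<bar>(m + t * h) - (m - t * h)\<bar>)"
      using p by (intro mult_left_mono signed_powr_lipschitz bd t) auto
    also have "\<dots> \<le> p * \<bar>h\<bar> * ((p - 1) * M powr (p - 2) * (2 * \<bar>h\<bar>))"
      using p t by (intro mult_left_mono) (auto simp: abs_mult intro!: mult_left_le)
    also have "\<dots> = 2 * p * (p - 1) * M powr (p - 2) * h\<^sup>2"
      by (simp add: power2_eq_square)
    finally show "norm (p * h * (?d (m + t * h) - ?d (m - t * h))) \<le> 2 * p * (p - 1) * M powr (p - 2) * h\<^sup>2" .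
  qed auto
  moreover have "m + h = a" "m - h = b" by (simp_all add: m_def h_def field_simps)
  ultimately have "?\<psi> a + ?\<psi> b - 2 * ?\<psi> m \<le> 2 * p * (p - 1) * M powr (p - 2) * h\<^sup>2"
    by simp
  moreover have h2: "h\<^sup>2 = (a - b)\<^sup>2 / 4" by (simp add: h_def power_divide)
  moreover from h2 have "2 * p * (p - 1) * M powr (p - 2) * h\<^sup>2 = 2 * (p * (p - 1) / 4 * (M powr (p - 2) * (a - b)\<^sup>2))"
    by simp
  ultimately have gap: "?\<psi> a + ?\<psi> b - 2 * ?\<psi> m \<le> 2 * (p * (p - 1) / 4 * (M powr (p - 2) * (a - b)\<^sup>2))"
    by (simp only:)
  have halve: "x / 2 - y \<le> z" if "x - 2 * y \<le> 2 * z" for x y z :: real using that by simp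
  show ?thesis unfolding m_def[symmetric] M_def[symmetric] by (rule halve[OF gap])
qed

lemma powr_add_le:
  assumes "0 \<le> x" "0 \<le> y" "0 \<le> (p::real)"
  shows "(x + y) powr p \<le> 2 powr p * (x powr p + y powr p)"
proof -
  have "(x + y) powr p \<le> (2 * max x y) powr p" using assms by (intro powr_mono2) auto
  also have "\<dots> = 2 powr p * (max x y) powr p" using assms by (simp add: powr_mult)
  also have "\<dots> \<le> 2 powr p * (x powr p + y powr p)" by (intro mult_left_mono) (auto simp: max_def)
  finally show ?thesis .
qed

text \<open>Hoelder's inequality with exponents \<open>p / (p - 2)\<close> and \<open>p / 2\<close>, stated with upper bounds in place of the norms.\<close>

lemma holder_powr_square:
  fixes f g :: "'a \<Rightarrow> real"
  assumes p: "2 < p"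
    and f: "f \<in> borel_measurable M" "integrable M (\<lambda>x. \<bar>f x\<bar> powr p)" "(LINT x|M. \<bar>f x\<bar> powr p) \<le> X"
    and g: "g \<in> borel_measurable M" "integrable M (\<lambda>x. \<bar>g x\<bar> powr p)" "(LINT x|M. \<bar>g x\<bar> powr p) \<le> Y"
    and X: "0 < X"
  shows "integrable M (\<lambda>x. \<bar>f x\<bar> powr (p - 2) * (g x)\<^sup>2)"
    and "(LINT x|M. \<bar>f x\<bar> powr (p - 2) * (g x)\<^sup>2) \<le> X powr ((p - 2) / p) * Y powr (2 / p)"
proof -
  let ?a = "(p - 2) / p" and ?b = "2 / p"
  have ab: "0 \<le> ?a" "0 \<le> ?b" "?a + ?b = 1" using p by (auto simp: field_simps)
  have Y0: "0 \<le> Y" using order_trans[OF integral_nonneg_AE g(3)] by auto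
  have young: "\<bar>f x\<bar> powr (p - 2) * (g x)\<^sup>2 \<le> X powr ?a * Z powr ?b * (?a * (\<bar>f x\<bar> powr p / X) + ?b * (\<bar>g x\<bar> powr p / Z))"
    if Z: "0 < Z" for x Z
  proof (cases "f x = 0 \<or> g x = 0")
    case False
    have "(\<bar>f x\<bar> powr p / X) powr ?a * (\<bar>g x\<bar> powr p / Z) powr ?b \<le> ?a * (\<bar>f x\<bar> powr p / X) + ?b * (\<bar>g x\<bar> powr p / Z)"
      using ab X Z False by (intro Youngs_inequality_0) auto
    moreover have "\<bar>f x\<bar> powr (p - 2) * (g x)\<^sup>2 = X powr ?a * Z powr ?b * ((\<bar>f x\<bar> powr p / X) powr ?a * (\<bar>g x\<bar> powr p / Z) powr ?b)"
    proof -
      have "(\<bar>f x\<bar> powr p) powr ?a = \<bar>f x\<bar> powr (p - 2)" "(\<bar>g x\<bar> powr p) powr ?b = (g x)\<^sup>2"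
        using p False by (simp_all add: powr_powr)
      then show ?thesis using X Z by (simp add: powr_divide)
    qed
    ultimately show ?thesis using X Z by simp
  next
    case True
    then show ?thesis using p X Z ab by (auto simp: powr_eq_0_iff intro!: mult_nonneg_nonneg add_nonneg_nonneg)
  qed
  show int: "integrable M (\<lambda>x. \<bar>f x\<bar> powr (p - 2) * (g x)\<^sup>2)"
  proof (rule Bochner_Integration.integrable_bound)
    show "integrable M (\<lambda>x. X powr ?a * 1 powr ?b * (?a * (\<bar>f x\<bar> powr p / X) + ?b * (\<bar>g x\<bar> powr p / 1)))"
      using f(2) g(2) by auto
    show "AE x in M. norm (\<bar>f x\<bar> powr (p - 2) * (g x)\<^sup>2) \<le> norm (X powr ?a * 1 powr ?b * (?a * (\<bar>f x\<bar> powr p / X) + ?b * (\<bar>g x\<bar> powr p / 1)))"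
    proof (rule AE_I2)
      fix x
      have "norm (\<bar>f x\<bar> powr (p - 2) * (g x)\<^sup>2) = \<bar>f x\<bar> powr (p - 2) * (g x)\<^sup>2" by simp
      also note young[of 1 x]
      finally show "norm (\<bar>f x\<bar> powr (p - 2) * (g x)\<^sup>2) \<le> norm (X powr ?a * 1 powr ?b * (?a * (\<bar>f x\<bar> powr p / X) + ?b * (\<bar>g x\<bar> powr p / 1)))"
        unfolding real_norm_def by linarith
    qed
  qed (use f g in measurable)
  show "(LINT x|M. \<bar>f x\<bar> powr (p - 2) * (g x)\<^sup>2) \<le> X powr ?a * Y powr ?b"
  proof (cases "Y = 0")
    case True
    have "0 \<le> (LINT x|M. \<bar>g x\<bar> powr p)" by (intro integral_nonneg_AE) auto
    then have "(LINT x|M. \<bar>g x\<bar> powr p) = 0" using g(3) True by linarith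
    then have "AE x in M. \<bar>g x\<bar> powr p = 0" using g(2) by (subst (asm) integral_nonneg_eq_0_iff_AE) auto
    then have "AE x in M. \<bar>f x\<bar> powr (p - 2) * (g x)\<^sup>2 = 0" by eventually_elim simp
    then have "(LINT x|M. \<bar>f x\<bar> powr (p - 2) * (g x)\<^sup>2) = 0" by (rule integral_eq_zero_AE)
    then show ?thesis by simp
  next
    case False
    then have Y: "0 < Y" using Y0 by simp
    have "(LINT x|M. \<bar>f x\<bar> powr (p - 2) * (g x)\<^sup>2)
        \<le> (LINT x|M. X powr ?a * Y powr ?b * (?a * (\<bar>f x\<bar> powr p / X) + ?b * (\<bar>g x\<bar> powr p / Y)))"
      using int young[OF Y] f(2) g(2) by (intro integral_mono) auto
    also have "\<dots> = X powr ?a * Y powr ?b * (?a * ((LINT x|M. \<bar>f x\<bar> powr p) / X) + ?b * ((LINT x|M. \<bar>g x\<bar> powr p) / Y))"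
      using f(2) g(2) by simp
    also have "\<dots> \<le> X powr ?a * Y powr ?b * (?a * 1 + ?b * 1)"
      using f(3) g(3) X Y ab by (intro mult_left_mono add_mono) auto
    finally show ?thesis using ab by simp
  qed
qed

text \<open>Truncating the arguments at height \<open>R\<close> changes each integral by at most \<open>2 \<epsilon> B\<close>, because \<open>G\<close> is small compared
  with \<open>|t|\<^sup>p\<close> at infinity; the truncated integrals converge by dominated convergence.\<close>

lemma integral_subcritical_tendsto:
  fixes G :: "real \<Rightarrow> real" and w :: "nat \<Rightarrow> 'a \<Rightarrow> real"
  assumes "finite_measure M" and p: "0 < p"
    and G: "continuous_on UNIV G" "\<And>t. \<bar>G t\<bar> \<le> C * (1 + \<bar>t\<bar> powr p)"
    and sub: "\<And>\<epsilon>. 0 < \<epsilon> \<Longrightarrow> \<exists>R>0. \<forall>t. R \<le> \<bar>t\<bar> \<longrightarrow> \<bar>G t\<bar> \<le> \<epsilon> * \<bar>t\<bar> powr p"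
    and w: "\<And>k. w k \<in> borel_measurable M" "\<And>k. integrable M (\<lambda>x. \<bar>w k x\<bar> powr p)"
      "\<And>k. (LINT x|M. \<bar>w k x\<bar> powr p) \<le> B"
    and v: "v \<in> borel_measurable M" "integrable M (\<lambda>x. \<bar>v x\<bar> powr p)" "(LINT x|M. \<bar>v x\<bar> powr p) \<le> B"
    and lim: "AE x in M. (\<lambda>k. w k x) \<longlonglongrightarrow> v x"
  shows "(\<lambda>k. LINT x|M. G (w k x)) \<longlonglongrightarrow> (LINT x|M. G (v x))"
proof -
  interpret finite_measure M by fact
  have [measurable]: "G \<in> borel_measurable borel" using G(1) by (rule borel_measurable_continuous_onI)
  note [measurable] = w(1) v(1)
  have C: "0 \<le> C" using G(2)[of 0] p by auto
  have Gint: "integrable M (\<lambda>x. G (f x))" if [measurable]: "f \<in> borel_measurable M" and fp: "integrable M (\<lambda>x. \<bar>f x\<bar> powr p)" for f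
  proof (rule Bochner_Integration.integrable_bound)
    show "integrable M (\<lambda>x. C * (1 + \<bar>f x\<bar> powr p))" using fp by auto
    show "AE x in M. norm (G (f x)) \<le> norm (C * (1 + \<bar>f x\<bar> powr p))"
      using G(2) C by (intro AE_I2) auto
  qed measurable
  have B0: "0 \<le> B" using order_trans[OF integral_nonneg_AE v(3)] by auto
  show ?thesis
  proof (rule LIMSEQ_I)
    fix e :: real assume e: "0 < e"
    define \<epsilon> where "\<epsilon> = e / (8 * (B + 1))"
    have \<epsilon>: "0 < \<epsilon>" using e B0 by (simp add: \<epsilon>_def)
    obtain R where R: "0 < R" "\<And>t. R \<le> \<bar>t\<bar> \<Longrightarrow> \<bar>G t\<bar> \<le> \<epsilon> * \<bar>t\<bar> powr p" using sub[OF \<epsilon>] by blast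
    define T where "T t = max (- R) (min R t)" for t :: real
    have [measurable]: "T \<in> borel_measurable borel" unfolding T_def by measurable
    have T: "\<bar>T t\<bar> \<le> R" for t using R(1) by (auto simp: T_def)
    have GT: "\<bar>G (T t)\<bar> \<le> C * (1 + R powr p)" for t
    proof -
      have "\<bar>T t\<bar> powr p \<le> R powr p" using T[of t] p by (intro powr_mono2) auto
      then have "C * (1 + \<bar>T t\<bar> powr p) \<le> C * (1 + R powr p)" using C by (intro mult_left_mono) auto
      with G(2)[of "T t"] show ?thesis by linarith
    qed
    have diff: "\<bar>G t - G (T t)\<bar> \<le> 2 * \<epsilon> * \<bar>t\<bar> powr p" for t
    proof (cases "\<bar>t\<bar> \<le> R")
      case True
      then have "T t = t" by (auto simp: T_def)
      then show ?thesis using \<epsilon> by simp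
    next
      case False
      then have "\<bar>T t\<bar> = R" using R(1) by (auto simp: T_def)
      then have "\<bar>G (T t)\<bar> \<le> \<epsilon> * R powr p" using R(2)[of "T t"] by simp
      also have "\<dots> \<le> \<epsilon> * \<bar>t\<bar> powr p" using False R \<epsilon> p by (intro mult_left_mono powr_mono2) auto
      finally show ?thesis using R(2)[of t] False by linarith
    qed
    have GTint: "integrable M (\<lambda>x. G (T (f x)))" if [measurable]: "f \<in> borel_measurable M" for f
      by (rule integrable_const_bound[of _ "C * (1 + R powr p)"]) (use GT in auto)
    have cut: "\<bar>(LINT x|M. G (f x)) - (LINT x|M. G (T (f x)))\<bar> \<le> e / 4"
      if f: "f \<in> borel_measurable M" "integrable M (\<lambda>x. \<bar>f x\<bar> powr p)" "(LINT x|M. \<bar>f x\<bar> powr p) \<le> B" for f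
    proof -
      have "\<bar>(LINT x|M. G (f x)) - (LINT x|M. G (T (f x)))\<bar> = \<bar>LINT x|M. G (f x) - G (T (f x))\<bar>"
        using Gint[OF f(1,2)] GTint[OF f(1)] by simp
      also have "\<dots> \<le> (LINT x|M. \<bar>G (f x) - G (T (f x))\<bar>)" by (rule integral_abs_bound)
      also have "\<dots> \<le> (LINT x|M. 2 * \<epsilon> * \<bar>f x\<bar> powr p)"
        using diff Gint[OF f(1,2)] GTint[OF f(1)] f by (intro integral_mono) auto
      also have "\<dots> \<le> 2 * \<epsilon> * B" using f \<epsilon> by simp
      also have "\<dots> \<le> 2 * \<epsilon> * (B + 1)" using \<epsilon> by simp
      also have "\<dots> = e / 4" using B0 by (simp add: \<epsilon>_def field_simps)
      finally show ?thesis .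
    qed
    have "(\<lambda>k. LINT x|M. G (T (w k x))) \<longlonglongrightarrow> (LINT x|M. G (T (v x)))"
    proof (rule integral_dominated_convergence[where w = "\<lambda>x. C * (1 + R powr p)"])
      have "isCont T y" for y unfolding T_def by (intro continuous_intros)
      moreover have "isCont G y" for y using G(1) by (simp add: continuous_on_eq_continuous_at)
      ultimately show "AE x in M. (\<lambda>k. G (T (w k x))) \<longlonglongrightarrow> G (T (v x))"
        by (intro eventually_mono[OF lim] isCont_tendsto_compose[of _ G] isCont_tendsto_compose[of _ T])
    qed (use GT in auto)
    then obtain N where N: "\<And>k. k \<ge> N \<Longrightarrow> norm ((LINT x|M. G (T (w k x))) - (LINT x|M. G (T (v x)))) < e / 4"
      using LIMSEQ_D[of _ _ "e / 4"] e by force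
    have "norm ((LINT x|M. G (w k x)) - (LINT x|M. G (v x))) < e" if "k \<ge> N" for k
      using N[OF that] cut[OF w(1) w(2) w(3), of k] cut[OF v] e unfolding real_norm_def by linarith
    then show "\<exists>N. \<forall>k\<ge>N. norm ((LINT x|M. G (w k x)) - (LINT x|M. G (v x))) < e" by blast
  qed
qed

text \<open>By the mean value theorem the difference quotients are at most \<open>C (1 + (|u| + |v|)\<^bsup>p - 1\<^esup>) |v|\<close>, which is
  integrable.\<close>

lemma integral_directional_derivative:
  fixes F f :: "real \<Rightarrow> real" and u v :: "'a \<Rightarrow> real"
  assumes "finite_measure M" and p: "1 < p"
    and F: "\<And>t. (F has_real_derivative f t) (at t)" "\<And>t. \<bar>F t\<bar> \<le> C * (1 + \<bar>t\<bar> powr p)"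
    and f: "f \<in> borel_measurable borel" "\<And>t. \<bar>f t\<bar> \<le> C * (1 + \<bar>t\<bar> powr (p - 1))"
    and u: "u \<in> borel_measurable M" "integrable M (\<lambda>x. \<bar>u x\<bar> powr p)"
    and v: "v \<in> borel_measurable M" "integrable M (\<lambda>x. \<bar>v x\<bar> powr p)"
    and t: "t \<longlonglongrightarrow> 0" "\<And>k. t k \<noteq> 0" "\<And>k. \<bar>t k\<bar> \<le> 1"
  shows "integrable M (\<lambda>x. f (u x) * v x)"
    and "(\<lambda>k. ((LINT x|M. F (u x + t k * v x)) - (LINT x|M. F (u x))) / t k) \<longlonglongrightarrow> (LINT x|M. f (u x) * v x)"
proof -
  interpret finite_measure M by fact
  have C: "0 \<le> C" using F(2)[of 0] p by auto
  have "continuous_on UNIV F" using F(1) by (meson DERIV_isCont continuous_at_imp_continuous_on)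
  then have [measurable]: "F \<in> borel_measurable borel" by (rule borel_measurable_continuous_onI)
  note [measurable] = f(1) u(1) v(1)
  define m where "m x = \<bar>u x\<bar> + \<bar>v x\<bar>" for x
  let ?D = "\<lambda>x. C * (1 + m x powr (p - 1)) * \<bar>v x\<bar>"
  have [measurable]: "m \<in> borel_measurable M" unfolding m_def by measurable
  have m0: "0 \<le> m x" for x by (simp add: m_def)
  have mp: "m x powr p \<le> 2 powr p * (\<bar>u x\<bar> powr p + \<bar>v x\<bar> powr p)" for x
    unfolding m_def using p by (intro powr_add_le) auto
  have dom: "integrable M (\<lambda>x. ?D x)"
  proof (rule Bochner_Integration.integrable_bound)
    show "integrable M (\<lambda>x. C * (1 + 2 * (2 powr p * (\<bar>u x\<bar> powr p + \<bar>v x\<bar> powr p))))"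
      using u v by auto
    show "AE x in M. norm (?D x) \<le> norm (C * (1 + 2 * (2 powr p * (\<bar>u x\<bar> powr p + \<bar>v x\<bar> powr p))))"
    proof (rule AE_I2)
      fix x
      have "(1 + m x powr (p - 1)) * \<bar>v x\<bar> \<le> (1 + m x powr (p - 1)) * m x"
        by (intro mult_left_mono) (auto simp: m_def)
      also have "\<dots> = m x + m x powr p"
        using m0[of x] by (cases "m x = 0") (auto simp: distrib_right powr_diff)
      finally have "(1 + m x powr (p - 1)) * \<bar>v x\<bar> \<le> 1 + 2 * (2 powr p * (\<bar>u x\<bar> powr p + \<bar>v x\<bar> powr p))"
        using powr_le_one_plus_powr[of "m x" 1 p] m0[of x] p mp[of x] by simp
      then have "C * ((1 + m x powr (p - 1)) * \<bar>v x\<bar>) \<le> C * (1 + 2 * (2 powr p * (\<bar>u x\<bar> powr p + \<bar>v x\<bar> powr p)))"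
        using C by (intro mult_left_mono) auto
      moreover have "0 \<le> ?D x" using C by auto
      ultimately show "norm (?D x) \<le> norm (C * (1 + 2 * (2 powr p * (\<bar>u x\<bar> powr p + \<bar>v x\<bar> powr p))))"
        by (simp add: mult.assoc)
    qed
  qed measurable
  have fle: "\<bar>f y\<bar> \<le> C * (1 + m x powr (p - 1))" if "\<bar>y\<bar> \<le> m x" for x y
  proof -
    have "\<bar>y\<bar> powr (p - 1) \<le> m x powr (p - 1)" using that p by (intro powr_mono2) auto
    then have "C * (1 + \<bar>y\<bar> powr (p - 1)) \<le> C * (1 + m x powr (p - 1))" using C by (intro mult_left_mono) auto
    with f(2)[of y] show ?thesis by linarith
  qed
  show "integrable M (\<lambda>x. f (u x) * v x)"
  proof (rule Bochner_Integration.integrable_bound[OF dom])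
    show "AE x in M. norm (f (u x) * v x) \<le> norm (?D x)"
    proof (rule AE_I2)
      fix x
      have "\<bar>f (u x)\<bar> * \<bar>v x\<bar> \<le> ?D x" by (intro mult_right_mono fle) (auto simp: m_def)
      then show "norm (f (u x) * v x) \<le> norm (?D x)"
        unfolding real_norm_def abs_mult[of "f (u x)"] by (meson abs_ge_self order_trans)
    qed
  qed measurable
  have Fint: "integrable M (\<lambda>x. F (h x))" if [measurable]: "h \<in> borel_measurable M" and "\<And>x. \<bar>h x\<bar> \<le> m x" for h
  proof (rule Bochner_Integration.integrable_bound)
    show "integrable M (\<lambda>x. C * (1 + 2 powr p * (\<bar>u x\<bar> powr p + \<bar>v x\<bar> powr p)))"
      using u v by auto
    show "AE x in M. norm (F (h x)) \<le> norm (C * (1 + 2 powr p * (\<bar>u x\<bar> powr p + \<bar>v x\<bar> powr p)))"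
    proof (rule AE_I2)
      fix x
      have "\<bar>h x\<bar> powr p \<le> m x powr p" using that p by (intro powr_mono2) auto
      then have "C * (1 + \<bar>h x\<bar> powr p) \<le> C * (1 + 2 powr p * (\<bar>u x\<bar> powr p + \<bar>v x\<bar> powr p))"
        using C mp[of x] by (intro mult_left_mono) auto
      with F(2)[of "h x"] show "norm (F (h x)) \<le> norm (C * (1 + 2 powr p * (\<bar>u x\<bar> powr p + \<bar>v x\<bar> powr p)))"
        unfolding real_norm_def by linarith
    qed
  qed measurable
  have seg: "\<bar>u x + t k * v x\<bar> \<le> m x" for x k
  proof -
    have "\<bar>t k * v x\<bar> \<le> \<bar>v x\<bar>" using t(3)[of k] by (simp add: abs_mult mult_left_le_one_le)
    then show ?thesis unfolding m_def by linarith
  qed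
  have eq: "((LINT x|M. F (u x + t k * v x)) - (LINT x|M. F (u x))) / t k
      = (LINT x|M. (F (u x + t k * v x) - F (u x)) / t k)" for k
  proof -
    have "integrable M (\<lambda>x. F (u x + t k * v x))" by (rule Fint) (use seg in auto)
    moreover have "integrable M (\<lambda>x. F (u x))" by (rule Fint) (auto simp: m_def)
    ultimately show ?thesis by simp
  qed
  show "(\<lambda>k. ((LINT x|M. F (u x + t k * v x)) - (LINT x|M. F (u x))) / t k) \<longlonglongrightarrow> (LINT x|M. f (u x) * v x)"
    unfolding eq
  proof (rule integral_dominated_convergence[where w = ?D])
    show "AE x in M. (\<lambda>k. (F (u x + t k * v x) - F (u x)) / t k) \<longlonglongrightarrow> f (u x) * v x"
    proof (rule AE_I2)
      fix x
      have "((\<lambda>h. F (u x + h * v x)) has_real_derivative f (u x) * v x) (at 0)"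
        by (rule DERIV_chain2[where g = "\<lambda>h. u x + h * v x"]) (auto intro!: derivative_eq_intros F(1))
      then have "((\<lambda>h. (F (u x + h * v x) - F (u x)) / h) \<longlongrightarrow> f (u x) * v x) (at 0)"
        by (simp add: DERIV_def)
      then show "(\<lambda>k. (F (u x + t k * v x) - F (u x)) / t k) \<longlonglongrightarrow> f (u x) * v x"
        using t by (auto simp: tendsto_at_iff_sequentially comp_def)
    qed
    show "AE x in M. norm ((F (u x + t k * v x) - F (u x)) / t k) \<le> ?D x" for k
    proof (rule AE_I2)
      fix x
      have "norm (F (u x + t k * v x) - F (u x)) \<le> C * (1 + m x powr (p - 1)) * norm ((u x + t k * v x) - u x)"
      proof (rule field_differentiable_bound[of "{- m x..m x}"])
        show "norm (f z) \<le> C * (1 + m x powr (p - 1))" if "z \<in> {- m x..m x}" for z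
          using that fle[of z x] by auto
        show "u x + t k * v x \<in> {- m x..m x}" using seg[of x k] by auto
        show "u x \<in> {- m x..m x}" by (auto simp: m_def)
        show "(F has_field_derivative f z) (at z within {- m x..m x})" for z
          by (rule has_field_derivative_at_within[OF F(1)])
      qed (rule convex_real_interval)
      also have "\<dots> = ?D x * \<bar>t k\<bar>" by (simp add: abs_mult mult_ac)
      finally show "norm ((F (u x + t k * v x) - F (u x)) / t k) \<le> ?D x"
        using t(2)[of k] by (simp add: divide_le_eq)
    qed
  qed (use dom in auto)
qed

section \<open>The energy functional\<close>

lemma primitive_has_derivative:
  assumes "continuous_on UNIV g"
  shows "(primitive g has_real_derivative g t) (at t)"
proof -
  have "((\<lambda>u. LBINT y=ereal 0..ereal u. g y) has_vector_derivative g t) (at t within {- \<bar>t\<bar> - 1..\<bar>t\<bar> + 1})"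
    by (rule interval_integral_FTC2) (auto intro: continuous_on_subset[OF assms])
  moreover have "at t within {- \<bar>t\<bar> - 1..\<bar>t\<bar> + 1} = at t"
    by (rule at_within_interior) (auto simp: interior_atLeastAtMost_real)
  ultimately show ?thesis
    by (simp add: primitive_def[abs_def] has_real_derivative_iff_has_vector_derivative)
qed

lemma primitive_0: "primitive g 0 = 0"
  by (simp add: primitive_def interval_integral_endpoints_same)

locale critical_problem = fractional_kernel +
  fixes g :: "real \<Rightarrow> real" and a\<^sub>1 a\<^sub>2 q :: real
  assumes g_cont: "continuous_on UNIV g"
    and a_pos: "0 < a\<^sub>1" "0 < a\<^sub>2"
    and q: "1 \<le> q" "q < p"
    and g_growth: "\<And>t. \<bar>g t\<bar> \<le> a\<^sub>1 + a\<^sub>2 * rpow \<bar>t\<bar> (q - 1)"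
begin

lemma primitive_cont: "continuous_on UNIV (primitive g)"
  using primitive_has_derivative[OF g_cont] by (meson DERIV_isCont continuous_at_imp_continuous_on)

lemma rpow_mono: "0 \<le> x \<Longrightarrow> x \<le> y \<Longrightarrow> rpow x (q - 1) \<le> rpow y (q - 1)"
  using q by (auto simp: rpow_def intro: powr_mono2)

lemma g_bound: "\<bar>g t\<bar> \<le> (a\<^sub>1 + a\<^sub>2) * (1 + \<bar>t\<bar> powr (p - 1))"
proof -
  have "rpow \<bar>t\<bar> (q - 1) \<le> 1 + \<bar>t\<bar> powr (p - 1)"
    using powr_le_one_plus_powr[of "\<bar>t\<bar>" "q - 1" "p - 1"] q by (auto simp: rpow_def)
  then have "a\<^sub>2 * rpow \<bar>t\<bar> (q - 1) \<le> a\<^sub>2 * (1 + \<bar>t\<bar> powr (p - 1))"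
    using a_pos by (intro mult_left_mono) auto
  moreover have "a\<^sub>1 \<le> a\<^sub>1 * (1 + \<bar>t\<bar> powr (p - 1))" using a_pos by (simp add: distrib_left)
  ultimately show ?thesis using g_growth[of t] by (simp add: distrib_right)
qed

lemma primitive_bound_q: "\<bar>primitive g t\<bar> \<le> a\<^sub>1 * \<bar>t\<bar> + a\<^sub>2 * \<bar>t\<bar> powr q"
proof -
  have "norm (primitive g t - primitive g 0) \<le> (a\<^sub>1 + a\<^sub>2 * rpow \<bar>t\<bar> (q - 1)) * norm (t - 0)"
  proof (rule field_differentiable_bound[of "{- \<bar>t\<bar>..\<bar>t\<bar>}"])
    show "(primitive g has_field_derivative g z) (at z within {- \<bar>t\<bar>..\<bar>t\<bar>})" for z
      by (rule has_field_derivative_at_within[OF primitive_has_derivative[OF g_cont]])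
    show "norm (g z) \<le> a\<^sub>1 + a\<^sub>2 * rpow \<bar>t\<bar> (q - 1)" if "z \<in> {- \<bar>t\<bar>..\<bar>t\<bar>}" for z
    proof -
      have "\<bar>z\<bar> \<le> \<bar>t\<bar>" using that by auto
      then have "a\<^sub>2 * rpow \<bar>z\<bar> (q - 1) \<le> a\<^sub>2 * rpow \<bar>t\<bar> (q - 1)"
        using a_pos by (intro mult_left_mono rpow_mono) auto
      then show ?thesis using g_growth[of z] unfolding real_norm_def by linarith
    qed
  qed auto
  also have "\<dots> = a\<^sub>1 * \<bar>t\<bar> + a\<^sub>2 * (rpow \<bar>t\<bar> (q - 1) * \<bar>t\<bar>)" by (simp add: algebra_simps)
  also have "rpow \<bar>t\<bar> (q - 1) * \<bar>t\<bar> = \<bar>t\<bar> powr q"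
    by (cases "t = 0") (auto simp: rpow_def powr_diff)
  finally show ?thesis by (simp add: primitive_0)
qed

lemma primitive_bound: "\<bar>primitive g t\<bar> \<le> (a\<^sub>1 + a\<^sub>2) * (1 + \<bar>t\<bar> powr p)"
proof -
  have "a\<^sub>1 * \<bar>t\<bar> \<le> a\<^sub>1 * (1 + \<bar>t\<bar> powr p)" using a_pos abs_le_powr[of t] by (intro mult_left_mono) auto
  moreover have "a\<^sub>2 * \<bar>t\<bar> powr q \<le> a\<^sub>2 * (1 + \<bar>t\<bar> powr p)"
    using a_pos q powr_le_one_plus_powr[of "\<bar>t\<bar>" q p] by (intro mult_left_mono) auto
  ultimately show ?thesis using primitive_bound_q[of t] by (simp add: distrib_right)
qed

lemma primitive_subcritical:
  assumes "0 < \<epsilon>"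
  shows "\<exists>R>0. \<forall>t. R \<le> \<bar>t\<bar> \<longrightarrow> \<bar>primitive g t\<bar> \<le> \<epsilon> * \<bar>t\<bar> powr p"
proof (intro exI conjI allI impI)
  let ?C = "a\<^sub>1 + a\<^sub>2"
  let ?R = "max 1 ((?C / \<epsilon>) powr (1 / (p - q)))"
  show "0 < ?R" by simp
  fix t assume t: "?R \<le> \<bar>t\<bar>"
  have C: "0 < ?C" using a_pos by simp
  have "\<bar>t\<bar> powr 1 \<le> \<bar>t\<bar> powr q" using t q by (intro powr_mono) auto
  then have "a\<^sub>1 * \<bar>t\<bar> \<le> a\<^sub>1 * \<bar>t\<bar> powr q" using a_pos by simp
  then have "\<bar>primitive g t\<bar> \<le> ?C * \<bar>t\<bar> powr q" using primitive_bound_q[of t] by (simp add: distrib_right)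
  also have "?C \<le> \<epsilon> * \<bar>t\<bar> powr (p - q)"
  proof -
    have "((?C / \<epsilon>) powr (1 / (p - q))) powr (p - q) \<le> \<bar>t\<bar> powr (p - q)"
      using t q by (intro powr_mono2) auto
    then have "?C / \<epsilon> \<le> \<bar>t\<bar> powr (p - q)" using C assms q by (simp add: powr_powr)
    then show ?thesis using assms by (simp add: divide_le_eq mult.commute)
  qed
  then have "?C * \<bar>t\<bar> powr q \<le> \<epsilon> * \<bar>t\<bar> powr (p - q) * \<bar>t\<bar> powr q" by (intro mult_right_mono) auto
  also have "\<dots> = \<epsilon> * \<bar>t\<bar> powr p" by (simp add: mult.assoc powr_add[symmetric])
  finally show "\<bar>primitive g t\<bar> \<le> \<epsilon> * \<bar>t\<bar> powr p" .
qed

lemma finite_measure_Omega: "finite_measure (lebesgue_on \<Omega>)"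
  using emeasure_Omega(2) by (intro finite_measureI) (simp add: emeasure_restrict_space space_restrict_space)

lemma X0_on_Omega:
  assumes "u \<in> X0"
  shows "u \<in> borel_measurable (lebesgue_on \<Omega>)" "integrable (lebesgue_on \<Omega>) (\<lambda>x. \<bar>u x\<bar> powr p)"
    "(LINT x|lebesgue_on \<Omega>. \<bar>u x\<bar> powr p) \<le> (sobolev_C * energy u) powr (p / 2)"
proof -
  show "u \<in> borel_measurable (lebesgue_on \<Omega>)" by (rule measurable_restrict_space1[OF X0_D(1)[OF assms]])
  have i: "integrable lebesgue (\<lambda>x. indicator \<Omega> x *\<^sub>R \<bar>u x\<bar> powr p)"
    by (rule integrable_mult_indicator[OF _ X0_sobolev(1)[OF assms]]) simp
  then show "integrable (lebesgue_on \<Omega>) (\<lambda>x. \<bar>u x\<bar> powr p)"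
    by (subst integrable_restrict_space) auto
  have "(LINT x|lebesgue_on \<Omega>. \<bar>u x\<bar> powr p) = (LINT x|lebesgue. indicator \<Omega> x *\<^sub>R \<bar>u x\<bar> powr p)"
    by (rule integral_restrict_space) simp
  also have "\<dots> \<le> (LINT x|lebesgue. \<bar>u x\<bar> powr p)"
    using i X0_sobolev(1)[OF assms] by (intro integral_mono) (auto simp: indicator_def)
  also have "\<dots> \<le> (sobolev_C * energy u) powr (p / 2)" by (rule X0_sobolev(2)[OF assms])
  finally show "(LINT x|lebesgue_on \<Omega>. \<bar>u x\<bar> powr p) \<le> (sobolev_C * energy u) powr (p / 2)" .
qed

lemma X0_on_Omega_le:
  assumes "u \<in> X0" "energy u \<le> E"
  shows "(LINT x|lebesgue_on \<Omega>. \<bar>u x\<bar> powr p) \<le> (sobolev_C * E) powr (p / 2)"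
proof -
  have "(sobolev_C * energy u) powr (p / 2) \<le> (sobolev_C * E) powr (p / 2)"
    using assms sobolev_C_pos energy_nonneg[of u] p_gt_2 by (intro powr_mono2 mult_left_mono) auto
  then show ?thesis using X0_on_Omega(3)[OF assms(1)] by linarith
qed

lemma set_integral_Omega: "(LINT x:\<Omega>|lebesgue. f x) = (LINT x|lebesgue_on \<Omega>. f x :: real)"
  unfolding set_lebesgue_integral_def by (rule integral_restrict_space[symmetric]) simp

definition critical_term :: "('a \<Rightarrow> real) \<Rightarrow> real" where
  "critical_term u = (LINT x|lebesgue_on \<Omega>. \<bar>u x\<bar> powr p)"

definition potential :: "('a \<Rightarrow> real) \<Rightarrow> real" where
  "potential u = (LINT x|lebesgue_on \<Omega>. primitive g (u x))"

definition functional :: "real \<Rightarrow> real \<Rightarrow> ('a \<Rightarrow> real) \<Rightarrow> real" where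
  "functional \<mu> lam u = energy u / 2 - \<mu> / p * critical_term u - lam * potential u"

lemma critical_term_bounds:
  assumes "u \<in> X0" "energy u \<le> E"
  shows "0 \<le> critical_term u" "critical_term u \<le> (sobolev_C * E) powr (p / 2)"
  unfolding critical_term_def by (auto intro: X0_on_Omega_le[OF assms])

lemma potential_integrable:
  assumes "u \<in> X0"
  shows "integrable (lebesgue_on \<Omega>) (\<lambda>x. primitive g (u x))"
proof (rule Bochner_Integration.integrable_bound)
  interpret finite_measure "lebesgue_on \<Omega>" by (rule finite_measure_Omega)
  have [measurable]: "primitive g \<in> borel_measurable borel"
    using primitive_cont by (rule borel_measurable_continuous_onI)
  note [measurable] = X0_on_Omega(1)[OF assms]
  show "integrable (lebesgue_on \<Omega>) (\<lambda>x. (a\<^sub>1 + a\<^sub>2) * (1 + \<bar>u x\<bar> powr p))"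
    using X0_on_Omega(2)[OF assms] by auto
  show "(\<lambda>x. primitive g (u x)) \<in> borel_measurable (lebesgue_on \<Omega>)" by measurable
  show "AE x in lebesgue_on \<Omega>. norm (primitive g (u x)) \<le> norm ((a\<^sub>1 + a\<^sub>2) * (1 + \<bar>u x\<bar> powr p))"
    using primitive_bound a_pos by (intro AE_I2) auto
qed

definition potential_bound :: "real \<Rightarrow> real" where
  "potential_bound E = (a\<^sub>1 + a\<^sub>2) * (measure lebesgue \<Omega> + (sobolev_C * E) powr (p / 2))"

lemma potential_bound_nonneg: "0 \<le> potential_bound E"
  unfolding potential_bound_def using a_pos by (intro mult_nonneg_nonneg add_nonneg_nonneg) auto

lemma potential_le:
  assumes "u \<in> X0" "energy u \<le> E"
  shows "\<bar>potential u\<bar> \<le> potential_bound E"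
proof -
  interpret finite_measure "lebesgue_on \<Omega>" by (rule finite_measure_Omega)
  note up = X0_on_Omega(2)[OF assms(1)]
  have "\<bar>potential u\<bar> \<le> (LINT x|lebesgue_on \<Omega>. \<bar>primitive g (u x)\<bar>)"
    unfolding potential_def by (rule integral_abs_bound)
  also have "\<dots> \<le> (LINT x|lebesgue_on \<Omega>. (a\<^sub>1 + a\<^sub>2) * (1 + \<bar>u x\<bar> powr p))"
    using potential_integrable[OF assms(1)] up primitive_bound by (intro integral_mono) auto
  also have "\<dots> = (a\<^sub>1 + a\<^sub>2) * (measure lebesgue \<Omega> + critical_term u)"
    using up by (simp add: critical_term_def measure_restrict_space space_restrict_space)
  also have "\<dots> \<le> potential_bound E"
    unfolding potential_bound_def using a_pos critical_term_bounds(2)[OF assms] by (intro mult_left_mono) auto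
  finally show ?thesis .
qed

lemma potential_tendsto:
  assumes w: "\<And>k. w k \<in> X0" "\<And>k. energy (w k) \<le> E" and v: "v \<in> X0" "energy v \<le> E"
    and lim: "AE x in lebesgue. (\<lambda>k. w k x) \<longlonglongrightarrow> v x"
  shows "(\<lambda>k. potential (w k)) \<longlonglongrightarrow> potential v"
  unfolding potential_def
proof (rule integral_subcritical_tendsto[where B = "(sobolev_C * E) powr (p / 2)",
      OF finite_measure_Omega _ primitive_cont primitive_bound primitive_subcritical])
  show "AE x in lebesgue_on \<Omega>. (\<lambda>k. w k x) \<longlonglongrightarrow> v x"
    using lim by (subst AE_restrict_space_iff) auto
qed (use X0_on_Omega w v X0_on_Omega_le p_gt_2 in auto)

lemma energy_midpoint:
  assumes "u \<in> X0" "v \<in> X0"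
  shows "(\<lambda>x. (u x + v x) / 2) \<in> X0"
    and "energy (\<lambda>x. (u x + v x) / 2) = (energy u + energy v) / 2 - energy (\<lambda>x. u x - v x) / 4"
proof -
  have eq: "(\<lambda>x. (u x + v x) / 2) = (\<lambda>x. 1/2 * u x + 1/2 * v x)" by (auto simp: field_simps)
  show "(\<lambda>x. (u x + v x) / 2) \<in> X0" unfolding eq by (rule X0_lincomb(1)[OF assms])
  show "energy (\<lambda>x. (u x + v x) / 2) = (energy u + energy v) / 2 - energy (\<lambda>x. u x - v x) / 4"
    unfolding eq X0_lincomb(2)[OF assms] using X0_lincomb(2)[OF assms, of 1 "-1"]
    by (simp add: power2_eq_square field_simps)
qed

text \<open>The factor by which the critical term can reduce the convexity of \<open>\<parallel>u\<parallel>\<^sup>2 / 2\<close> on the ball \<open>\<parallel>u\<parallel>\<^sup>2 \<le> E\<close>. It tends to \<open>0\<close>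
  with \<open>E\<close>.\<close>

definition convexity_defect :: "real \<Rightarrow> real \<Rightarrow> real" where
  "convexity_defect \<mu> E = \<mu> * (p - 1) / 4 * sobolev_C * (2 powr (p + 1) * (sobolev_C * E) powr (p / 2)) powr ((p - 2) / p)"

text \<open>By the parallelogram identity the quadratic part contributes \<open>\<parallel>u - v\<parallel>\<^sup>2 / 8\<close>. The midpoint gap of the critical
  term is bounded by \<open>\<integral> (|u| + |v|)\<^bsup>p - 2\<^esup> (u - v)\<^sup>2\<close>, which the inequalities of Hoelder and Sobolev estimate by
  \<open>\<parallel>u - v\<parallel>\<^sup>2\<close> times a factor that is small on small balls.\<close>

lemma strongly_midpoint_convex:
  assumes \<mu>: "0 < \<mu>" and E: "0 < E" and u: "u \<in> X0" "energy u \<le> E" and v: "v \<in> X0" "energy v \<le> E"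
    and small: "convexity_defect \<mu> E \<le> 1 / 16"
  defines "\<Phi> \<equiv> \<lambda>u. energy u / 2 - \<mu> / p * critical_term u"
  shows "energy (\<lambda>x. u x - v x) / 16 \<le> (\<Phi> u + \<Phi> v) / 2 - \<Phi> (\<lambda>x. (u x + v x) / 2)"
proof -
  let ?M = "lebesgue_on \<Omega>" and ?N = "energy (\<lambda>x. u x - v x)"
  let ?X = "2 powr (p + 1) * (sobolev_C * E) powr (p / 2)"
  let ?Y = "(sobolev_C * ?N) powr (p / 2)"
  have p0: "0 < p" using p_gt_2 by simp
  note d = X0_diff[OF u(1) v(1)] and mid = energy_midpoint[OF u(1) v(1)]
  note uM = X0_on_Omega[OF u(1)] and vM = X0_on_Omega[OF v(1)] and dM = X0_on_Omega[OF d]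
    and mM = X0_on_Omega[OF mid(1)]
  note [measurable] = uM(1) vM(1)
  have X: "0 < ?X" using sobolev_C_pos E by simp
  have sum_le: "\<bar>\<bar>u x\<bar> + \<bar>v x\<bar>\<bar> powr p \<le> 2 powr p * (\<bar>u x\<bar> powr p + \<bar>v x\<bar> powr p)" for x
    using powr_add_le[of "\<bar>u x\<bar>" "\<bar>v x\<bar>" p] p0 by simp
  have sum_int: "integrable ?M (\<lambda>x. \<bar>\<bar>u x\<bar> + \<bar>v x\<bar>\<bar> powr p)"
  proof (rule Bochner_Integration.integrable_bound)
    show "integrable ?M (\<lambda>x. 2 powr p * (\<bar>u x\<bar> powr p + \<bar>v x\<bar> powr p))" using uM vM by auto
    show "AE x in ?M. norm (\<bar>\<bar>u x\<bar> + \<bar>v x\<bar>\<bar> powr p) \<le> norm (2 powr p * (\<bar>u x\<bar> powr p + \<bar>v x\<bar> powr p))"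
      using sum_le by (intro AE_I2) auto
  qed measurable
  have sum_X: "(LINT x|?M. \<bar>\<bar>u x\<bar> + \<bar>v x\<bar>\<bar> powr p) \<le> ?X"
  proof -
    have "(LINT x|?M. \<bar>\<bar>u x\<bar> + \<bar>v x\<bar>\<bar> powr p) \<le> (LINT x|?M. 2 powr p * (\<bar>u x\<bar> powr p + \<bar>v x\<bar> powr p))"
      using sum_le sum_int uM vM by (intro integral_mono) auto
    also have "\<dots> = 2 powr p * (critical_term u + critical_term v)"
      using uM vM by (simp add: critical_term_def)
    also have "\<dots> \<le> 2 powr p * ((sobolev_C * E) powr (p / 2) + (sobolev_C * E) powr (p / 2))"
      using critical_term_bounds(2)[OF u] critical_term_bounds(2)[OF v] by (intro mult_left_mono add_mono) auto
    also have "\<dots> = ?X" by (simp add: powr_add)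
    finally show ?thesis .
  qed
  have hol: "integrable ?M (\<lambda>x. \<bar>\<bar>u x\<bar> + \<bar>v x\<bar>\<bar> powr (p - 2) * (u x - v x)\<^sup>2)"
    "(LINT x|?M. \<bar>\<bar>u x\<bar> + \<bar>v x\<bar>\<bar> powr (p - 2) * (u x - v x)\<^sup>2) \<le> ?X powr ((p - 2) / p) * ?Y powr (2 / p)"
    by (rule holder_powr_square[OF p_gt_2 _ sum_int sum_X dM X]; measurable)+
  have Y: "?Y powr (2 / p) = sobolev_C * ?N"
    using p0 sobolev_C_pos energy_nonneg[of "\<lambda>x. u x - v x"] by (simp add: powr_powr)
  have "(critical_term u + critical_term v) / 2 - critical_term (\<lambda>x. (u x + v x) / 2)
      = (LINT x|?M. (\<bar>u x\<bar> powr p + \<bar>v x\<bar> powr p) / 2 - \<bar>(u x + v x) / 2\<bar> powr p)"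
    unfolding critical_term_def using uM vM mM by simp
  also have "\<dots> \<le> (LINT x|?M. p * (p - 1) / 4 * (\<bar>\<bar>u x\<bar> + \<bar>v x\<bar>\<bar> powr (p - 2) * (u x - v x)\<^sup>2))"
  proof (rule integral_mono)
    show "(\<bar>u x\<bar> powr p + \<bar>v x\<bar> powr p) / 2 - \<bar>(u x + v x) / 2\<bar> powr p
        \<le> p * (p - 1) / 4 * (\<bar>\<bar>u x\<bar> + \<bar>v x\<bar>\<bar> powr (p - 2) * (u x - v x)\<^sup>2)" for x
      using powr_midpoint_gap[OF p_gt_2, of "u x" "v x"] by (simp only: abs_of_nonneg add_nonneg_nonneg abs_ge_zero)
  qed (use uM vM mM hol in auto)
  also have "\<dots> = p * (p - 1) / 4 * (LINT x|?M. \<bar>\<bar>u x\<bar> + \<bar>v x\<bar>\<bar> powr (p - 2) * (u x - v x)\<^sup>2)"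
    by (rule integral_mult_right_zero)
  also have "\<dots> \<le> p * (p - 1) / 4 * (?X powr ((p - 2) / p) * (sobolev_C * ?N))"
    using hol(2) p_gt_2 unfolding Y by (intro mult_left_mono) auto
  finally have gap: "(critical_term u + critical_term v) / 2 - critical_term (\<lambda>x. (u x + v x) / 2)
      \<le> p * (p - 1) / 4 * (?X powr ((p - 2) / p) * (sobolev_C * ?N))" .
  have "\<mu> / p * ((critical_term u + critical_term v) / 2 - critical_term (\<lambda>x. (u x + v x) / 2))
      \<le> \<mu> / p * (p * (p - 1) / 4 * (?X powr ((p - 2) / p) * (sobolev_C * ?N)))"
    using \<mu> p0 by (intro mult_left_mono gap) auto
  also have "\<dots> = convexity_defect \<mu> E * ?N"
    using p0 by (simp add: convexity_defect_def)
  also have "\<dots> \<le> 1 / 16 * ?N" by (intro mult_right_mono small energy_nonneg)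
  finally have "\<mu> / p * ((critical_term u + critical_term v) / 2 - critical_term (\<lambda>x. (u x + v x) / 2)) \<le> ?N / 16"
    by simp
  moreover have "\<mu> / p * ((critical_term u + critical_term v) / 2 - critical_term (\<lambda>x. (u x + v x) / 2))
      = (\<mu> / p * critical_term u + \<mu> / p * critical_term v) / 2 - \<mu> / p * critical_term (\<lambda>x. (u x + v x) / 2)"
    by (simp add: algebra_simps add_divide_distrib)
  moreover have "N / 16 \<le> (a / 2 - A + (b / 2 - B)) / 2 - (((a + b) / 2 - N / 4) / 2 - C)"
    if "D \<le> N / 16" "D = (A + B) / 2 - C" for N a b A B C D :: real
    using that by (simp add: field_simps)
  ultimately show ?thesis unfolding \<Phi>_def mid(2) by blast
qed

end

section \<open>The minimiser and the equation\<close>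

context critical_problem
begin

text \<open>A triangle inequality for the energy in the form with a parameter, from \<open>0 \<le> \<parallel>\<delta> v + (w - v)\<parallel>\<^sup>2\<close>.\<close>

lemma energy_diff_triangle:
  assumes v: "v \<in> X0" and w: "w \<in> X0" and \<delta>: "0 < \<delta>"
  shows "(1 - \<delta>) * energy v - energy (\<lambda>x. w x - v x) / \<delta> \<le> energy w"
proof -
  define h where "h x = w x - v x" for x
  have h: "h \<in> X0" unfolding h_def by (rule X0_diff[OF w v])
  have "w = (\<lambda>x. 1 * v x + 1 * h x)" by (auto simp: h_def)
  then have w_eq: "energy w = energy v + 2 * X0_inner \<Omega> K v h + energy h"
    using X0_lincomb(2)[OF v h, of 1 1] by simp
  have "0 \<le> \<delta>\<^sup>2 * energy v + 2 * \<delta> * X0_inner \<Omega> K v h + energy h"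
    using energy_nonneg[of "\<lambda>x. \<delta> * v x + 1 * h x"] X0_lincomb(2)[OF v h, of \<delta> 1] by simp
  also have "\<dots> = \<delta> * (\<delta> * energy v + 2 * X0_inner \<Omega> K v h + energy h / \<delta>)"
    using \<delta> by (simp add: field_simps power2_eq_square)
  finally have "0 \<le> \<delta> * energy v + 2 * X0_inner \<Omega> K v h + energy h / \<delta>"
    using \<delta> by (simp add: zero_le_mult_iff)
  then show ?thesis
    using w_eq energy_nonneg[of h] unfolding h_def[symmetric] by (simp add: algebra_simps)
qed

text \<open>Where \<open>|w - v| \<le> \<delta> |v|\<close> the first summand alone bounds \<open>|w|\<^sup>p\<close>, and elsewhere the second one does.\<close>

lemma critical_term_triangle:
  assumes v: "v \<in> X0" and w: "w \<in> X0" and \<delta>: "0 < \<delta>"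
  shows "critical_term w \<le> (1 + \<delta>) powr p * critical_term v + (1 + 1 / \<delta>) powr p * critical_term (\<lambda>x. w x - v x)"
proof -
  have pw: "\<bar>b\<bar> powr p \<le> (1 + \<delta>) powr p * \<bar>a\<bar> powr p + (1 + 1 / \<delta>) powr p * \<bar>b - a\<bar> powr p" for a b :: real
  proof (cases "\<bar>b - a\<bar> \<le> \<delta> * \<bar>a\<bar>")
    case True
    have "\<bar>b\<bar> \<le> \<bar>a\<bar> + \<bar>b - a\<bar>" by linarith
    also have "\<dots> \<le> (1 + \<delta>) * \<bar>a\<bar>" using True by (simp add: distrib_right)
    finally have "\<bar>b\<bar> powr p \<le> ((1 + \<delta>) * \<bar>a\<bar>) powr p" using p_gt_2 by (intro powr_mono2) auto
    also have "\<dots> = (1 + \<delta>) powr p * \<bar>a\<bar> powr p" by (simp add: powr_mult)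
    finally show ?thesis by (simp add: add_increasing2)
  next
    case False
    then have "\<bar>a\<bar> \<le> \<bar>b - a\<bar> / \<delta>" using \<delta> by (simp add: field_simps)
    then have "\<bar>b\<bar> \<le> (1 + 1 / \<delta>) * \<bar>b - a\<bar>" by (simp add: distrib_right)
    then have "\<bar>b\<bar> powr p \<le> ((1 + 1 / \<delta>) * \<bar>b - a\<bar>) powr p" using p_gt_2 by (intro powr_mono2) auto
    also have "\<dots> = (1 + 1 / \<delta>) powr p * \<bar>b - a\<bar> powr p" by (simp add: powr_mult)
    finally show ?thesis by (simp add: add_increasing)
  qed
  note d = X0_on_Omega[OF X0_diff[OF w v]]
  have "critical_term w \<le> (LINT x|lebesgue_on \<Omega>. (1 + \<delta>) powr p * \<bar>v x\<bar> powr p + (1 + 1 / \<delta>) powr p * \<bar>w x - v x\<bar> powr p)"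
    unfolding critical_term_def using X0_on_Omega[OF v] X0_on_Omega[OF w] d pw by (intro integral_mono) auto
  also have "\<dots> = (1 + \<delta>) powr p * critical_term v + (1 + 1 / \<delta>) powr p * critical_term (\<lambda>x. w x - v x)"
    unfolding critical_term_def using X0_on_Omega[OF v] d by simp
  finally show ?thesis .
qed

text \<open>Both triangle inequalities bound \<open>J(w\<^sub>k)\<close> from below by \<open>J(v)\<close> up to terms that vanish as first \<open>k \<rightarrow> \<infinity>\<close> and then
  \<open>\<delta> \<rightarrow> 0\<close>.\<close>

lemma functional_lower_limit:
  assumes \<mu>: "0 < \<mu>" and w: "\<And>k. w k \<in> X0" and v: "v \<in> X0"
    and conv: "(\<lambda>k. energy (\<lambda>x. w k x - v x)) \<longlonglongrightarrow> 0"
    and pot: "(\<lambda>k. potential (w k)) \<longlonglongrightarrow> potential v"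
    and lim: "(\<lambda>k. functional \<mu> lam (w k)) \<longlonglongrightarrow> m"
  shows "functional \<mu> lam v \<le> m"
proof -
  let ?e = "\<lambda>k. energy (\<lambda>x. w k x - v x)"
  have p0: "0 < p" using p_gt_2 by simp
  have crit: "(\<lambda>k. critical_term (\<lambda>x. w k x - v x)) \<longlonglongrightarrow> 0"
  proof (rule tendsto_sandwich[OF _ _ tendsto_const])
    have "(\<lambda>k. (sobolev_C * ?e k) powr (p / 2)) \<longlonglongrightarrow> (sobolev_C * 0) powr (p / 2)"
      using p0 sobolev_C_pos by (intro tendsto_powr2 tendsto_mult conv tendsto_const) (auto simp: energy_nonneg)
    then show "(\<lambda>k. (sobolev_C * ?e k) powr (p / 2)) \<longlonglongrightarrow> 0" by simp
  qed (auto intro!: always_eventually critical_term_bounds[OF X0_diff[OF w v] order_refl])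
  have step: "((1 - \<delta>) * energy v) / 2 - \<mu> / p * ((1 + \<delta>) powr p * critical_term v) - lam * potential v \<le> m"
    if \<delta>: "0 < \<delta>" for \<delta>
  proof (rule LIMSEQ_le[OF _ lim])
    let ?L = "\<lambda>k. ((1 - \<delta>) * energy v - ?e k / \<delta>) / 2
      - \<mu> / p * ((1 + \<delta>) powr p * critical_term v + (1 + 1 / \<delta>) powr p * critical_term (\<lambda>x. w k x - v x))
      - lam * potential (w k)"
    have "?L \<longlonglongrightarrow> ((1 - \<delta>) * energy v - 0 / \<delta>) / 2
      - \<mu> / p * ((1 + \<delta>) powr p * critical_term v + (1 + 1 / \<delta>) powr p * 0) - lam * potential v"
      using \<delta> by (intro tendsto_intros conv crit pot) auto
    then show "?L \<longlonglongrightarrow> ((1 - \<delta>) * energy v) / 2 - \<mu> / p * ((1 + \<delta>) powr p * critical_term v) - lam * potential v"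
      by simp
    have "?L k \<le> functional \<mu> lam (w k)" for k
      unfolding functional_def
      using \<mu> p0 energy_diff_triangle[OF v w[of k] \<delta>] critical_term_triangle[OF v w[of k] \<delta>]
      by (intro diff_mono divide_right_mono mult_left_mono order_refl) auto
    then show "\<exists>N. \<forall>n\<ge>N. ?L n \<le> functional \<mu> lam (w n)" by blast
  qed
  let ?F = "\<lambda>\<delta>. ((1 - \<delta>) * energy v) / 2 - \<mu> / p * ((1 + \<delta>) powr p * critical_term v) - lam * potential v"
  have "(?F \<longlongrightarrow> ((1 - 0) * energy v) / 2 - \<mu> / p * ((1 + 0) powr p * critical_term v) - lam * potential v) (at_right 0)"
    by (intro tendsto_intros) auto
  then have "(?F \<longlongrightarrow> functional \<mu> lam v) (at_right 0)" by (simp add: functional_def)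
  then show ?thesis
  proof (rule tendsto_upperbound)
    show "\<forall>\<^sub>F \<delta> in at_right 0. ?F \<delta> \<le> m"
      using eventually_at_right_less[of "0::real"] by eventually_elim (rule step)
  qed simp
qed

text \<open>Along a minimising sequence \<open>w\<^sub>k\<close> with limit \<open>v\<close> almost everywhere, Fatou's lemma yields indices \<open>\<sigma>(k) \<ge> k\<close> with
  \<open>\<parallel>w\<^sub>k - v\<parallel>\<^sup>2 \<le> \<parallel>w\<^sub>k - w\<^sub>\<sigma>\<^sub>(\<^sub>k\<^sub>)\<parallel>\<^sup>2 + 1 / (k + 1)\<close>. The midpoint of \<open>w\<^sub>k\<close> and \<open>w\<^sub>\<sigma>\<^sub>(\<^sub>k\<^sub>)\<close> cannot have a value below the infimum, so strong
  convexity and the continuity of the potential force the right-hand side to \<open>0\<close>.\<close>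

lemma minimizer_exists:
  assumes \<mu>: "0 < \<mu>" and E: "0 < E" and small: "convexity_defect \<mu> E \<le> 1 / 16"
  obtains v where "v \<in> X0" "energy v \<le> E"
    "\<And>u. u \<in> X0 \<Longrightarrow> energy u \<le> E \<Longrightarrow> functional \<mu> lam v \<le> functional \<mu> lam u"
proof -
  have p0: "0 < p" using p_gt_2 by simp
  let ?J = "functional \<mu> lam"
  define A where "A = {?J u | u. u \<in> X0 \<and> energy u \<le> E}"
  define m where "m = Inf A"
  have "?J (\<lambda>x. 0) \<in> A" using zero_X0 E by (auto simp: A_def X0_inner_eq kernel_diff_def)
  then have A_ne: "A \<noteq> {}" by blast
  have "bdd_below A"
  proof (rule bdd_belowI)
    fix y assume "y \<in> A"
    then obtain u where u: "u \<in> X0" "energy u \<le> E" "y = ?J u" by (auto simp: A_def)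
    have "\<mu> / p * critical_term u \<le> \<mu> / p * (sobolev_C * E) powr (p / 2)"
      using \<mu> p0 critical_term_bounds(2)[OF u(1,2)] by (intro mult_left_mono) auto
    moreover have "lam * potential u \<le> \<bar>lam\<bar> * potential_bound E"
    proof -
      have "lam * potential u \<le> \<bar>lam\<bar> * \<bar>potential u\<bar>" by (simp add: abs_mult[symmetric])
      also have "\<dots> \<le> \<bar>lam\<bar> * potential_bound E" by (intro mult_left_mono potential_le u) auto
      finally show ?thesis .
    qed
    ultimately show "- (\<mu> / p * (sobolev_C * E) powr (p / 2)) - \<bar>lam\<bar> * potential_bound E \<le> y"
      unfolding u(3) functional_def using energy_nonneg[of u] by linarith
  qed
  then have m_le: "m \<le> ?J u" if "u \<in> X0" "energy u \<le> E" for u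
    unfolding m_def using that by (intro cInf_lower) (auto simp: A_def)
  have "\<exists>u. u \<in> X0 \<and> energy u \<le> E \<and> ?J u < m + 1 / (real k + 1)" for k :: nat
  proof -
    obtain y where "y \<in> A" "y < m + 1 / (real k + 1)"
      using cInf_lessD[OF A_ne, of "m + 1 / (real k + 1)"] by (auto simp: m_def)
    then show ?thesis by (auto simp: A_def)
  qed
  then obtain u where u: "\<And>k. u k \<in> X0" "\<And>k. energy (u k) \<le> E" "\<And>k. ?J (u k) < m + 1 / (real k + 1)"
    by metis
  obtain r v where r: "strict_mono r" and v: "v \<in> borel_measurable lebesgue"
    and lim: "AE x in lebesgue. (\<lambda>i. u (r i) x) \<longlonglongrightarrow> v x"
    by (rule X0_compact[OF u(1,2)])
  define w where "w k = u (r k)" for k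
  have w: "w k \<in> X0" "energy (w k) \<le> E" for k using u by (auto simp: w_def)
  have wlim: "AE x in lebesgue. (\<lambda>i. w i x) \<longlonglongrightarrow> v x" using lim by (simp add: w_def)
  have wJ: "?J (w l) < m + 1 / (real k + 1)" if "k \<le> l" for k l
  proof -
    have "k \<le> r l" using that strict_mono_imp_increasing[OF r, of l] by linarith
    then have "1 / (real (r l) + 1) \<le> 1 / (real k + 1)" by (intro divide_left_mono) auto
    then show ?thesis using u(3)[of "r l"] unfolding w_def by linarith
  qed
  have vX: "v \<in> X0" "energy v \<le> E"
    using X0_AE_closed[OF w(1) v wlim, of E] w(2) by auto
  \<comment> \<open>by lower semicontinuity, the distance to the limit is almost attained along the sequence\<close>
  have "\<exists>l\<ge>k. energy (\<lambda>x. w k x - v x) \<le> energy (\<lambda>x. w k x - w l x) + 1 / (real k + 1)" for k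
  proof (rule ccontr)
    assume "\<not> ?thesis"
    then have *: "energy (\<lambda>x. w k x - w l x) \<le> energy (\<lambda>x. w k x - v x) - 1 / (real k + 1)" if "k \<le> l" for l
      using that by (meson not_le less_imp_le le_diff_eq)
    have "energy (\<lambda>x. w k x - v x) \<le> energy (\<lambda>x. w k x - v x) - 1 / (real k + 1)"
    proof (rule X0_AE_closed(2)[where u = "\<lambda>l x. w k x - w l x"])
      show "(\<lambda>x. w k x - w l x) \<in> X0" for l by (rule X0_diff[OF w(1) w(1)])
      show "(\<lambda>x. w k x - v x) \<in> borel_measurable lebesgue" using X0_D(1)[OF w(1)] v by measurable
      show "AE x in lebesgue. (\<lambda>l. w k x - w l x) \<longlonglongrightarrow> w k x - v x"
        using wlim by eventually_elim (intro tendsto_intros)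
      show "\<forall>\<^sub>F l in sequentially. energy (\<lambda>x. w k x - w l x) \<le> energy (\<lambda>x. w k x - v x) - 1 / (real k + 1)"
        unfolding eventually_sequentially using * by blast
    qed
    moreover have "0 < 1 / (real k + 1)" by simp
    ultimately show False by linarith
  qed
  then have "\<forall>k. \<exists>l. k \<le> l \<and> energy (\<lambda>x. w k x - v x) \<le> energy (\<lambda>x. w k x - w l x) + 1 / (real k + 1)"
    by blast
  from choice[OF this] obtain \<sigma> where
    "\<forall>k. k \<le> \<sigma> k \<and> energy (\<lambda>x. w k x - v x) \<le> energy (\<lambda>x. w k x - w (\<sigma> k) x) + 1 / (real k + 1)" ..
  then have \<sigma>: "k \<le> \<sigma> k"
    "energy (\<lambda>x. w k x - v x) \<le> energy (\<lambda>x. w k x - w (\<sigma> k) x) + 1 / (real k + 1)" for k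
    by simp_all
  define z where "z k x = (w k x + w (\<sigma> k) x) / 2" for k x
  have z: "z k \<in> X0" "energy (z k) \<le> E" for k
  proof -
    show "z k \<in> X0" unfolding z_def by (rule energy_midpoint(1)[OF w(1) w(1)])
    have "(a + b) / 2 - d / 4 \<le> E" if "a \<le> E" "b \<le> E" "0 \<le> d" for a b d :: real
      using that by (simp add: field_simps)
    from this[OF w(2) w(2) energy_nonneg] show "energy (z k) \<le> E"
      unfolding z_def energy_midpoint(2)[OF w(1) w(1)] .
  qed
  have \<sigma>_top: "filterlim \<sigma> at_top sequentially"
    by (rule filterlim_at_top_mono[OF filterlim_ident]) (use \<sigma>(1) in auto)
  have \<sigma>lim: "AE x in lebesgue. (\<lambda>k. w (\<sigma> k) x) \<longlonglongrightarrow> v x"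
    using wlim by eventually_elim (rule filterlim_compose[OF _ \<sigma>_top])
  have zlim: "AE x in lebesgue. (\<lambda>k. z k x) \<longlonglongrightarrow> v x"
    using wlim \<sigma>lim
  proof eventually_elim
    case (elim x)
    then have "(\<lambda>k. z k x) \<longlonglongrightarrow> (v x + v x) / 2" unfolding z_def by (intro tendsto_intros) auto
    then show ?case by simp
  qed
  have pw: "(\<lambda>k. potential (w k)) \<longlonglongrightarrow> potential v" by (rule potential_tendsto[OF w vX wlim])
  have p\<sigma>: "(\<lambda>k. potential (w (\<sigma> k))) \<longlonglongrightarrow> potential v" by (rule potential_tendsto[OF w vX \<sigma>lim])
  have pz: "(\<lambda>k. potential (z k)) \<longlonglongrightarrow> potential v" by (rule potential_tendsto[OF z vX zlim])
  \<comment> \<open>sixteen times the excess over the infimum, plus the slack \<open>1 / (k + 1)\<close> from the choice of \<open>\<sigma>\<close>\<close>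
  define err where "err k = 17 / (real k + 1)
      + 16 * (lam * ((potential (w k) + potential (w (\<sigma> k))) / 2 - potential (z k)))" for k
  have inv0: "(\<lambda>k. 1 / (real k + 1)) \<longlonglongrightarrow> 0"
    using LIMSEQ_Suc[OF lim_1_over_n[where 'a = real]] by (simp add: add.commute)
  have err0: "err \<longlonglongrightarrow> 0"
  proof -
    have "(\<lambda>k. 17 * (1 / (real k + 1)) + 16 * (lam * ((potential (w k) + potential (w (\<sigma> k))) / 2 - potential (z k))))
      \<longlonglongrightarrow> 17 * 0 + 16 * (lam * ((potential v + potential v) / 2 - potential v))"
      by (intro tendsto_intros inv0 pw p\<sigma> pz) auto
    then show ?thesis by (simp add: err_def[abs_def])
  qed
  have e_le: "energy (\<lambda>x. w k x - v x) \<le> err k" for k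
  proof -
    let ?\<Phi> = "\<lambda>u. energy u / 2 - \<mu> / p * critical_term u"
    have \<Phi>J: "?\<Phi> u = ?J u + lam * potential u" for u by (simp add: functional_def)
    have "energy (\<lambda>x. w k x - w (\<sigma> k) x) / 16 \<le> (?\<Phi> (w k) + ?\<Phi> (w (\<sigma> k))) / 2 - ?\<Phi> (z k)"
      unfolding z_def by (rule strongly_midpoint_convex[OF \<mu> E w w small])
    then have convex: "energy (\<lambda>x. w k x - w (\<sigma> k) x) / 16
        \<le> (?J (w k) + lam * potential (w k) + (?J (w (\<sigma> k)) + lam * potential (w (\<sigma> k)))) / 2 - (?J (z k) + lam * potential (z k))"
      unfolding \<Phi>J .
    have err_eq: "err k = 17 * (1 / (real k + 1)) + 8 * (lam * potential (w k)) + 8 * (lam * potential (w (\<sigma> k))) - 16 * (lam * potential (z k))"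
      unfolding err_def by (simp add: algebra_simps add_divide_distrib)
    have combine: "e \<le> 17 * i + 8 * P1 + 8 * P2 - 16 * P3"
      if "d / 16 \<le> (J1 + P1 + (J2 + P2)) / 2 - (J3 + P3)" "J1 < m + i" "J2 < m + i" "m \<le> J3" "e \<le> d + i"
      for d e i J1 J2 J3 P1 P2 P3 :: real
      using that by (simp add: field_simps)
    show ?thesis
      unfolding err_eq by (rule combine[OF convex wJ[OF order_refl] wJ[OF \<sigma>(1)] m_le[OF z] \<sigma>(2)])
  qed
  have conv: "(\<lambda>k. energy (\<lambda>x. w k x - v x)) \<longlonglongrightarrow> 0"
    by (rule tendsto_sandwich[OF _ _ tendsto_const err0]) (use e_le energy_nonneg in auto)
  have "(\<lambda>k. ?J (w k)) \<longlonglongrightarrow> m"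
  proof (rule tendsto_sandwich[OF _ _ tendsto_const])
    have "(\<lambda>k. m + 1 / (real k + 1)) \<longlonglongrightarrow> m + 0" by (intro tendsto_intros inv0)
    then show "(\<lambda>k. m + 1 / (real k + 1)) \<longlonglongrightarrow> m" by simp
  qed (use m_le[OF w] wJ in \<open>auto intro!: always_eventually less_imp_le\<close>)
  from functional_lower_limit[OF \<mu> w(1) vX(1) conv pw this]
  have v_le: "?J v \<le> m" .
  show thesis
    by (rule that[OF vX]) (rule order_trans[OF v_le m_le])
qed

text \<open>Difference quotients of \<open>J\<close> at \<open>u\<close> along \<open>v\<close> are nonnegative for small positive increments, as these do not leave the
  ball. So the linear form of their limits is nonnegative, and applied to \<open>- v\<close> it must vanish.\<close>

lemma minimizer_weak_solution:
  assumes u: "u \<in> X0" "energy u < E"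
    and min: "\<And>v. v \<in> X0 \<Longrightarrow> energy v \<le> E \<Longrightarrow> functional \<mu> lam u \<le> functional \<mu> lam v"
  shows "weak_solution \<Omega> K p \<mu> lam g u"
proof -
  let ?M = "lebesgue_on \<Omega>"
  define L where "L v = X0_inner \<Omega> K u v - \<mu> * (LINT x|?M. \<bar>u x\<bar> powr (p - 2) * u x * v x) - lam * (LINT x|?M. g (u x) * v x)" for v
  define t where "t k = 1 / (real k + 1)" for k
  have t: "t \<longlonglongrightarrow> 0" "t k \<noteq> 0" "\<bar>t k\<bar> \<le> 1" "0 < t k" for k
    using LIMSEQ_Suc[OF lim_1_over_n[where 'a = real]] by (simp_all add: t_def[abs_def] add.commute)
  have p0: "1 < p" using p_gt_2 by simp
  have L_nonneg: "0 \<le> L v" if v: "v \<in> X0" for v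
  proof -
    let ?w = "\<lambda>k x. u x + t k * v x"
    have eq: "?w k = (\<lambda>x. 1 * u x + t k * v x)" for k by simp
    have w: "?w k \<in> X0" for k unfolding eq by (rule X0_lincomb(1)[OF u(1) v])
    have E_w: "energy (?w k) = energy u + t k * (2 * X0_inner \<Omega> K u v + t k * energy v)" for k
      unfolding eq X0_lincomb(2)[OF u(1) v] by (simp add: power2_eq_square algebra_simps)
    have "(\<lambda>k. energy (?w k)) \<longlonglongrightarrow> energy u + 0 * (2 * X0_inner \<Omega> K u v + 0 * energy v)"
      unfolding E_w by (intro tendsto_intros t)
    then have "\<forall>\<^sub>F k in sequentially. energy (?w k) < E"
      using u(2) by (intro order_tendstoD(2)) auto
    then have quot: "\<forall>\<^sub>F k in sequentially. 0 \<le> (functional \<mu> lam (?w k) - functional \<mu> lam u) / t k"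
      by eventually_elim (use min[OF w] t(4) in \<open>simp add: less_imp_le\<close>)
    note uM = X0_on_Omega[OF u(1)] and vM = X0_on_Omega[OF v]
    have crit: "(\<lambda>k. (critical_term (?w k) - critical_term u) / t k) \<longlonglongrightarrow> (LINT x|?M. p * (\<bar>u x\<bar> powr (p - 2) * u x) * v x)"
      unfolding critical_term_def
    proof (rule integral_directional_derivative(2)[where C = p, OF finite_measure_Omega p0 DERIV_abs_powr[OF p_gt_2] _ _ _ uM(1,2) vM(1,2) t(1-3)])
      show "\<bar>\<bar>y\<bar> powr p\<bar> \<le> p * (1 + \<bar>y\<bar> powr p)" for y
      proof -
        have "1 * \<bar>y\<bar> powr p \<le> p * (1 + \<bar>y\<bar> powr p)" using p0 by (intro mult_mono) auto
        then show ?thesis by simp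
      qed
      show "\<bar>p * (\<bar>y\<bar> powr (p - 2) * y)\<bar> \<le> p * (1 + \<bar>y\<bar> powr (p - 1))" for y
      proof -
        have "\<bar>y\<bar> powr (p - 2) * \<bar>y\<bar> = \<bar>y\<bar> powr (p - 1)"
        proof (cases "y = 0")
          case False
          then have "\<bar>y\<bar> powr (p - 2) * \<bar>y\<bar> powr 1 = \<bar>y\<bar> powr (p - 1)" unfolding powr_add[symmetric] by simp
          then show ?thesis by simp
        qed simp
        then show ?thesis using p0 by (simp add: abs_mult)
      qed
    qed measurable
    have pot: "(\<lambda>k. (potential (?w k) - potential u) / t k) \<longlonglongrightarrow> (LINT x|?M. g (u x) * v x)"
      unfolding potential_def
      by (rule integral_directional_derivative(2)[OF finite_measure_Omega p0 primitive_has_derivative[OF g_cont]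
            primitive_bound borel_measurable_continuous_onI[OF g_cont] g_bound uM(1,2) vM(1,2) t(1-3)])
    have "(functional \<mu> lam (?w k) - functional \<mu> lam u) / t k
        = (2 * X0_inner \<Omega> K u v + t k * energy v) / 2 - \<mu> / p * ((critical_term (?w k) - critical_term u) / t k)
          - lam * ((potential (?w k) - potential u) / t k)" for k
    proof -
      have "((e + \<tau> * (2 * i + \<tau> * d)) / 2 - m * C1 - l * P1 - (e / 2 - m * C0 - l * P0)) / \<tau>
          = (2 * i + \<tau> * d) / 2 - m * ((C1 - C0) / \<tau>) - l * ((P1 - P0) / \<tau>)"
        if "\<tau> \<noteq> 0" for \<tau> e i d m l C1 C0 P1 P0 :: real
        using that by (simp add: field_simps)
      from this[OF t(2)] show ?thesis unfolding functional_def E_w .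
    qed
    moreover have "(\<lambda>k. (2 * X0_inner \<Omega> K u v + t k * energy v) / 2 - \<mu> / p * ((critical_term (?w k) - critical_term u) / t k)
          - lam * ((potential (?w k) - potential u) / t k))
      \<longlonglongrightarrow> (2 * X0_inner \<Omega> K u v + 0 * energy v) / 2 - \<mu> / p * (LINT x|?M. p * (\<bar>u x\<bar> powr (p - 2) * u x) * v x)
          - lam * (LINT x|?M. g (u x) * v x)"
      by (intro tendsto_intros t crit pot) auto
    moreover have "(LINT x|?M. p * (\<bar>u x\<bar> powr (p - 2) * u x) * v x) = p * (LINT x|?M. \<bar>u x\<bar> powr (p - 2) * u x * v x)"
      unfolding mult.assoc by (rule integral_mult_right_zero)
    ultimately have "(\<lambda>k. (functional \<mu> lam (?w k) - functional \<mu> lam u) / t k) \<longlonglongrightarrow> L v"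
      using p0 by (simp add: L_def)
    then show "0 \<le> L v" using quot by (rule tendsto_lowerbound) simp
  qed
  have L_zero: "L v = 0" if v: "v \<in> X0" for v
  proof -
    have "X0_inner \<Omega> K u (\<lambda>x. - v x) = - X0_inner \<Omega> K u v"
      by (simp add: X0_inner_eq kernel_diff_def algebra_simps flip: integral_minus)
    then have "L (\<lambda>x. - v x) = - L v" by (simp add: L_def)
    then show ?thesis using L_nonneg[OF v] L_nonneg[OF X0_uminus[OF v]] by linarith
  qed
  then show ?thesis unfolding weak_solution_def set_integral_Omega using u(1) by (auto simp: L_def)
qed

text \<open>Along \<open>t \<phi>\<close> with a bump \<open>\<phi>\<close> the energy is quadratic in \<open>t\<close>, while \<open>G(t \<phi>) \<ge> A t\<^sup>2 \<phi>\<^sup>2\<close> for any prescribed \<open>A\<close> once \<open>t\<close>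
  is small; the critical term only helps.\<close>

lemma functional_negative:
  assumes lam: "0 < lam" and \<mu>: "0 < \<mu>" and E: "0 < E"
    and G: "Liminf (at_right 0) (\<lambda>t. ereal (primitive g t / t\<^sup>2)) = \<infinity>"
  obtains v where "v \<in> X0" "energy v \<le> E" "functional \<mu> lam v < 0"
proof -
  obtain \<phi> where \<phi>: "\<phi> \<in> X0" "\<And>x. 0 \<le> \<phi> x" "\<And>x. \<phi> x \<le> 1" "\<not> (AE x in lebesgue. \<phi> x = 0)"
    "\<And>x. x \<notin> \<Omega> \<Longrightarrow> \<phi> x = 0"
    using exists_bump by metis
  let ?M = "lebesgue_on \<Omega>"
  interpret finite_measure ?M by (rule finite_measure_Omega)
  note [measurable] = X0_on_Omega(1)[OF \<phi>(1)]
  have sq_int: "integrable ?M (\<lambda>x. (\<phi> x)\<^sup>2)"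
    by (rule integrable_const_bound[of _ 1]) (use \<phi>(2,3) in \<open>auto intro!: power_le_one\<close>)
  define S where "S = (LINT x|?M. (\<phi> x)\<^sup>2)"
  have "S \<noteq> 0"
  proof
    assume "S = 0"
    then have "AE x in ?M. (\<phi> x)\<^sup>2 = 0"
      unfolding S_def using sq_int by (subst (asm) integral_nonneg_eq_0_iff_AE) auto
    then have "AE x in lebesgue. x \<in> \<Omega> \<longrightarrow> \<phi> x = 0"
      by (subst (asm) AE_restrict_space_iff) auto
    then have "AE x in lebesgue. \<phi> x = 0" by eventually_elim (use \<phi>(5) in blast)
    then show False using \<phi>(4) by blast
  qed
  moreover have "0 \<le> S" unfolding S_def by (intro integral_nonneg_AE) auto
  ultimately have S: "0 < S" by linarith
  \<comment> \<open>large enough for the potential to exceed half the energy after multiplication by \<open>lam\<close>\<close>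
  define A where "A = (energy \<phi> + 1) / (2 * lam * S)"
  have A: "lam * (A * S) = (energy \<phi> + 1) / 2" using lam S by (simp add: A_def)
  have "\<forall>\<^sub>F t in at_right 0. ereal A < ereal (primitive g t / t\<^sup>2)"
    using less_LiminfD[of "ereal A" "at_right 0" "\<lambda>t. ereal (primitive g t / t\<^sup>2)"] G by simp
  then obtain b where b: "0 < b" "\<And>t. 0 < t \<Longrightarrow> t < b \<Longrightarrow> A < primitive g t / t\<^sup>2"
    by (auto simp: eventually_at_right_field)
  define t where "t = min (b / 2) (min 1 (E / (energy \<phi> + 1)))"
  have E\<phi>: "0 < energy \<phi> + 1" using energy_nonneg[of \<phi>] by linarith
  have t: "0 < t" "t < b" "t \<le> 1" "t \<le> E / (energy \<phi> + 1)" using b(1) E E\<phi> by (auto simp: t_def)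
  define v where "v x = t * \<phi> x" for x
  have v_eq: "v = (\<lambda>x. t * \<phi> x + 0 * \<phi> x)" by (auto simp: v_def)
  have v: "v \<in> X0" "energy v = t\<^sup>2 * energy \<phi>"
    unfolding v_eq using X0_lincomb[OF \<phi>(1) \<phi>(1), of t 0] by auto
  have "t\<^sup>2 * energy \<phi> \<le> E"
  proof -
    have "t\<^sup>2 * energy \<phi> \<le> t * (energy \<phi> + 1)"
    proof -
      have "t * t \<le> t * 1" using t by (intro mult_left_mono) auto
      then show ?thesis unfolding power2_eq_square using energy_nonneg[of \<phi>] t by (intro mult_mono) auto
    qed
    also have "\<dots> \<le> E" using t(4) E\<phi> by (simp add: pos_le_divide_eq)
    finally show ?thesis .
  qed
  moreover have "functional \<mu> lam v < 0"
  proof -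
    have "t\<^sup>2 * (A * S) = (LINT x|?M. t\<^sup>2 * (A * (\<phi> x)\<^sup>2))"
      unfolding S_def by simp
    also have "\<dots> \<le> potential v"
      unfolding potential_def
    proof (rule integral_mono)
      show "integrable ?M (\<lambda>x. t\<^sup>2 * (A * (\<phi> x)\<^sup>2))" using sq_int by simp
      show "integrable ?M (\<lambda>x. primitive g (v x))" by (rule potential_integrable[OF v(1)])
      fix x
      show "t\<^sup>2 * (A * (\<phi> x)\<^sup>2) \<le> primitive g (v x)"
      proof (cases "\<phi> x = 0")
        case True
        then show ?thesis by (simp add: v_def primitive_0)
      next
        case False
        then have v0: "0 < v x" using t \<phi>(2)[of x] by (auto simp: v_def intro: le_neq_trans)
        have "v x \<le> t * 1" unfolding v_def using t \<phi>(3)[of x] by (intro mult_left_mono) auto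
        then have "v x < b" using t by linarith
        then have "A < primitive g (v x) / (v x)\<^sup>2" using b(2) v0 by blast
        then have "A * (v x)\<^sup>2 < primitive g (v x)" using v0 by (simp add: pos_less_divide_eq)
        then show ?thesis by (simp add: v_def power_mult_distrib mult_ac)
      qed
    qed
    finally have "lam * (t\<^sup>2 * (A * S)) \<le> lam * potential v" using lam by (intro mult_left_mono) auto
    moreover have "lam * (t\<^sup>2 * (A * S)) = t\<^sup>2 * ((energy \<phi> + 1) / 2)" unfolding A[symmetric] by (simp add: mult_ac)
    moreover have "0 \<le> \<mu> / p * critical_term v"
      using \<mu> p_gt_2 critical_term_bounds(1)[OF v(1) order_refl] by (intro mult_nonneg_nonneg) auto
    moreover have "0 < t\<^sup>2" using t by simp
    moreover have "t\<^sup>2 * ((energy \<phi> + 1) / 2) = t\<^sup>2 * energy \<phi> / 2 + t\<^sup>2 / 2" by (simp add: algebra_simps add_divide_distrib)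
    ultimately show ?thesis unfolding functional_def v(2) by linarith
  qed
  ultimately show thesis using that[of v] v by simp
qed

text \<open>Both conditions bound \<open>E\<^bsup>(p - 2) / 2\<^esup>\<close> by a positive number. The second one makes the critical term at most
  a quarter of the quadratic term on the sphere.\<close>

lemma exists_small_radius:
  assumes "0 < \<mu>"
  obtains E where "0 < E" "convexity_defect \<mu> E \<le> 1 / 16" "\<mu> / p * (sobolev_C * E) powr (p / 2) \<le> E / 8"
proof -
  define r where "r = (p - 2) / 2"
  have r: "0 < r" using p_gt_2 by (simp add: r_def)
  have S: "0 < sobolev_C" by (rule sobolev_C_pos)
  define c1 where "c1 = \<mu> * (p - 1) / 4 * sobolev_C * (2 powr (p + 1) * sobolev_C powr (p / 2)) powr ((p - 2) / p)"
  define c2 where "c2 = \<mu> / p * sobolev_C powr (p / 2)"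
  have c: "0 < c1" "0 < c2" using assms p_gt_2 S by (auto simp: c1_def c2_def)
  define \<eta> where "\<eta> = min (1 / (16 * c1)) (1 / (8 * c2))"
  have \<eta>: "0 < \<eta>" "c1 * \<eta> \<le> 1 / 16" "c2 * \<eta> \<le> 1 / 8"
  proof -
    show "0 < \<eta>" using c by (simp add: \<eta>_def)
    have "c1 * \<eta> \<le> c1 * (1 / (16 * c1))" using c by (intro mult_left_mono) (auto simp: \<eta>_def)
    then show "c1 * \<eta> \<le> 1 / 16" using c by simp
    have "c2 * \<eta> \<le> c2 * (1 / (8 * c2))" using c by (intro mult_left_mono) (auto simp: \<eta>_def)
    then show "c2 * \<eta> \<le> 1 / 8" using c by simp
  qed
  define E where "E = \<eta> powr (1 / r)"
  have E: "0 < E" "E powr r = \<eta>" using \<eta>(1) r by (simp_all add: E_def powr_powr)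
  have "convexity_defect \<mu> E = c1 * E powr r"
  proof -
    have "p / 2 * ((p - 2) / p) = r" using p_gt_2 by (simp add: r_def)
    then have "(2 powr (p + 1) * (sobolev_C * E) powr (p / 2)) powr ((p - 2) / p)
        = (2 powr (p + 1) * sobolev_C powr (p / 2)) powr ((p - 2) / p) * E powr r"
      using S E(1) by (simp add: powr_mult powr_powr mult.assoc[symmetric])
    then show ?thesis by (simp add: convexity_defect_def c1_def)
  qed
  then have "convexity_defect \<mu> E \<le> 1 / 16" using \<eta>(2) E(2) by simp
  moreover have "\<mu> / p * (sobolev_C * E) powr (p / 2) \<le> E / 8"
  proof -
    have "p / 2 = r + 1" by (simp add: r_def field_simps)
    then have "E powr (p / 2) = E powr (r + 1)" by (simp only:)
    also have "\<dots> = \<eta> * E" using E by (simp add: powr_add)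
    finally have "E powr (p / 2) = \<eta> * E" .
    then have "\<mu> / p * (sobolev_C * E) powr (p / 2) = c2 * \<eta> * E"
      using S E(1) by (simp add: c2_def powr_mult)
    also have "\<dots> \<le> 1 / 8 * E" using \<eta>(3) E(1) by (intro mult_right_mono) auto
    finally show ?thesis by simp
  qed
  ultimately show thesis using that E(1) by blast
qed

text \<open>On the sphere \<open>\<parallel>u\<parallel>\<^sup>2 = E\<close> the quadratic term is \<open>E / 2\<close>, the critical term at most \<open>E / 8\<close> and, by the choice of
  \<open>b\<close>, the potential term at most \<open>E / 4\<close>. A minimiser with negative value is therefore inside the ball.\<close>

lemma nontrivial_solution_for_small_lambda:
  assumes \<mu>: "0 < \<mu>" and G: "Liminf (at_right 0) (\<lambda>t. ereal (primitive g t / t\<^sup>2)) = \<infinity>"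
  obtains b where "0 < b"
    "\<And>lam. 0 < lam \<Longrightarrow> lam < b \<Longrightarrow> \<exists>u. weak_solution \<Omega> K p \<mu> lam g u \<and> \<not> (AE x in lebesgue. u x = 0)"
proof -
  obtain E where E: "0 < E" "convexity_defect \<mu> E \<le> 1 / 16" "\<mu> / p * (sobolev_C * E) powr (p / 2) \<le> E / 8"
    using exists_small_radius[OF \<mu>] by blast
  define b where "b = E / (4 * (potential_bound E + 1))"
  have B: "0 < potential_bound E + 1" using potential_bound_nonneg[of E] by linarith
  have "0 < b" using E(1) B by (simp add: b_def)
  moreover have "\<exists>u. weak_solution \<Omega> K p \<mu> lam g u \<and> \<not> (AE x in lebesgue. u x = 0)" if lam: "0 < lam" "lam < b" for lam
  proof -
    obtain u where u: "u \<in> X0" "energy u \<le> E"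
      and min: "\<And>v. v \<in> X0 \<Longrightarrow> energy v \<le> E \<Longrightarrow> functional \<mu> lam u \<le> functional \<mu> lam v"
      using minimizer_exists[OF \<mu> E(1,2), of lam] by blast
    obtain v where "v \<in> X0" "energy v \<le> E" "functional \<mu> lam v < 0"
      using functional_negative[OF lam(1) \<mu> E(1) G] by blast
    with min have neg: "functional \<mu> lam u < 0" by (meson le_less_trans)
    have "energy u \<noteq> E"
    proof
      assume eq: "energy u = E"
      have "\<mu> / p * critical_term u \<le> \<mu> / p * (sobolev_C * E) powr (p / 2)"
        using \<mu> p_gt_2 critical_term_bounds(2)[OF u] by (intro mult_left_mono) auto
      moreover have "lam * potential u \<le> E / 4"
      proof -
        have "lam * potential u \<le> lam * (potential_bound E + 1)"
          using lam potential_le[OF u] by (intro mult_left_mono) auto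
        also have "\<dots> \<le> b * (potential_bound E + 1)" using lam B by (intro mult_right_mono) auto
        also have "\<dots> = E / 4"
        proof -
          have "E / (4 * x) * x = E / 4" if "0 < x" for x using that by simp
          from this[OF B] show ?thesis unfolding b_def .
        qed
        finally show ?thesis .
      qed
      ultimately have "0 < functional \<mu> lam u" unfolding functional_def eq using E(1,3) by linarith
      then show False using neg by linarith
    qed
    then have "energy u < E" using u by simp
    from minimizer_weak_solution[OF u(1) this min] have "weak_solution \<Omega> K p \<mu> lam g u" .
    moreover have "\<not> (AE x in lebesgue. u x = 0)"
    proof
      assume z: "AE x in lebesgue. u x = 0"
      have "AE x in lebesgue_on \<Omega>. u x = 0" by (subst AE_restrict_space_iff) (use z in auto)
      then have "potential u = 0" "critical_term u = 0"
        unfolding potential_def critical_term_def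
        by (auto intro!: integral_eq_zero_AE simp: primitive_0 elim!: eventually_mono)
      then show False using neg energy_nonneg[of u] by (simp add: functional_def)
    qed
    ultimately show ?thesis by blast
  qed
  ultimately show thesis using that by blast
qed

end

section \<open>The profile \<open>h\<^sub>\<mu>\<close> and the main theorem\<close>

text \<open>With \<open>T\<close> such that \<open>\<mu> c\<^sup>p T\<^bsup>p - 2\<^esup> = 1\<close>, the numerator is \<open>t (1 - (t / T)\<^bsup>p - 2\<^esup>)\<close>, positive on \<open>(0, T)\<close> and negative beyond \<open>T\<close>, so the maximum over \<open>[0, T]\<close> is
  global.\<close>

lemma profile_attains_positive_max:
  fixes p q \<mu> c A B :: real
  assumes p: "2 < p" and q: "1 \<le> q" and pos: "0 < \<mu>" "0 < c" "0 < A" "0 < B"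
  defines "h \<equiv> \<lambda>t. (t - \<mu> * c powr p * t powr (p - 1)) / (A + B * rpow t (q - 1))"
  shows "\<exists>t0\<ge>0. (\<forall>t\<ge>0. h t \<le> h t0) \<and> 0 < h t0"
proof -
  define \<kappa> where "\<kappa> = \<mu> * c powr p"
  have \<kappa>: "0 < \<kappa>" using pos by (simp add: \<kappa>_def)
  define T where "T = (1 / \<kappa>) powr (1 / (p - 2))"
  have T: "0 < T" "\<kappa> * T powr (p - 2) = 1" using \<kappa> p by (simp_all add: T_def powr_powr)
  have den: "0 < A + B * rpow t (q - 1)" if "0 \<le> t" for t
    using that pos by (auto simp: rpow_def intro!: add_pos_nonneg)
  have num: "t - \<kappa> * t powr (p - 1) = t * (1 - \<kappa> * t powr (p - 2))" if "0 \<le> t" for t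
  proof (cases "t = 0")
    case False
    then have "t powr (p - 1) = t powr (p - 2) * t" using that powr_add[of t "p - 2" 1] by simp
    then show ?thesis by (simp add: algebra_simps)
  qed simp
  have h_eq: "h t = t * (1 - \<kappa> * t powr (p - 2)) / (A + B * rpow t (q - 1))" if "0 \<le> t" for t
    unfolding h_def \<kappa>_def[symmetric] num[OF that] ..
  have big: "h t \<le> 0" if "T < t" for t
  proof -
    have "\<kappa> * T powr (p - 2) \<le> \<kappa> * t powr (p - 2)"
      using that T(1) p \<kappa> by (intro mult_left_mono powr_mono2) auto
    then have "1 \<le> \<kappa> * t powr (p - 2)" unfolding T(2) .
    then show ?thesis using h_eq[of t] den[of t] that T by (simp add: divide_nonpos_pos mult_nonneg_nonpos)
  qed
  have half: "0 < h (T / 2)"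
  proof -
    have "\<kappa> * (T / 2) powr (p - 2) < \<kappa> * T powr (p - 2)"
      using T(1) p \<kappa> by (intro mult_strict_left_mono powr_less_mono2) auto
    then have "\<kappa> * (T / 2) powr (p - 2) < 1" unfolding T(2) .
    then show ?thesis using h_eq[of "T / 2"] den[of "T / 2"] T by simp
  qed
  have rc: "continuous_on {0..T} (\<lambda>t. rpow t (q - 1))"
  proof (cases "q = 1")
    case True
    then show ?thesis by (simp add: rpow_def)
  next
    case False
    then have "continuous_on {0..T} (\<lambda>t. t powr (q - 1))" using q by (intro continuous_on_powr') (auto intro: continuous_intros)
    then show ?thesis using False by (simp add: rpow_def)
  qed
  have pc: "continuous_on {0..T} (\<lambda>t. t powr (p - 1))" using p by (intro continuous_on_powr') (auto intro: continuous_intros)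
  have "A + B * rpow t (q - 1) \<noteq> 0" if "t \<in> {0..T}" for t using den[of t] that by auto
  then have "continuous_on {0..T} h" unfolding h_def
    by (intro continuous_on_divide continuous_on_diff continuous_on_mult continuous_on_add continuous_on_const continuous_on_id rc pc) auto
  then obtain t0 where t0: "t0 \<in> {0..T}" "\<And>t. t \<in> {0..T} \<Longrightarrow> h t \<le> h t0"
    using continuous_attains_sup[of "{0..T}" h] T by auto
  have "0 < h t0" using t0(2)[of "T / 2"] half T by auto
  moreover have "h t \<le> h t0" if "0 \<le> t" for t
    using t0(2)[of t] big[of t] that \<open>0 < h t0\<close> by (cases "t \<le> T") auto
  ultimately show ?thesis using t0(1) by auto
qed

theorem theorem3:
  fixes \<Omega> :: "(real ^ 'n) set"
    and K :: "real ^ 'n \<Rightarrow> real"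
    and s p c a\<^sub>1 a\<^sub>2 q :: real
    and g :: "real \<Rightarrow> real"
    and h :: "real \<Rightarrow> real \<Rightarrow> real"
  assumes s: "0 < s" "s < 1" "2 * s < real CARD('n)"
    and \<Omega>: "\<Omega> \<noteq> {}" "open \<Omega>" "bounded \<Omega>" "lipschitz_boundary \<Omega>"
    and K_pos: "\<And>x. x \<noteq> 0 \<Longrightarrow> 0 < K x"
    and K_int: "integrable lebesgue (\<lambda>x. min ((norm x)\<^sup>2) 1 * K x)"
    and K_lower: "\<exists>k\<^sub>0 > 0. \<forall>x. x \<noteq> 0 \<longrightarrow> K x \<ge> k\<^sub>0 * norm x powr (- (real CARD('n) + 2 * s))"
    and p: "p = 2 * real CARD('n) / (real CARD('n) - 2 * s)"
    and c: "c = embedding_const \<Omega> K p"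
    and g_cont: "continuous_on UNIV g"
    and a_pos: "0 < a\<^sub>1" "0 < a\<^sub>2"
    and q: "1 \<le> q" "q < p"
    and g_growth: "\<And>t. \<bar>g t\<bar> \<le> a\<^sub>1 + a\<^sub>2 * rpow \<bar>t\<bar> (q - 1)"
    and G_liminf: "Liminf (at_right 0) (\<lambda>t. ereal (primitive g t / t\<^sup>2)) = \<infinity>"
    and h: "\<And>\<mu> t. h \<mu> t =
        (t - \<mu> * c powr p * t powr (p - 1)) /
        (a\<^sub>1 * c * measure lebesgue \<Omega> powr ((p - 1) / p)
         + a\<^sub>2 * c powr q * measure lebesgue \<Omega> powr ((p - q) / p) * rpow t (q - 1))"
  shows "\<forall>\<mu> > 0. \<exists>t\<^sub>0 \<ge> 0. (\<forall>t \<ge> 0. h \<mu> t \<le> h \<mu> t\<^sub>0) \<and>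
    (\<exists>a b. a < b \<and> {a<..<b} \<subseteq> {0<..<h \<mu> t\<^sub>0} \<and>
      (\<forall>lam \<in> {a<..<b}. \<exists>u. weak_solution \<Omega> K p \<mu> lam g u \<and> \<not> (AE x in lebesgue. u x = 0)))"
proof (intro allI impI)
  fix \<mu> :: real assume \<mu>: "0 < \<mu>"
  obtain k\<^sub>0 where k\<^sub>0: "0 < k\<^sub>0" "\<forall>x. x \<noteq> 0 \<longrightarrow> K x \<ge> k\<^sub>0 * norm x powr (- (real CARD('n) + 2 * s))"
    using K_lower by blast
  have dim: "DIM(real ^ 'n) = CARD('n)" by simp
  interpret critical_problem \<Omega> K s p k\<^sub>0 g a\<^sub>1 a\<^sub>2 q
  proof (unfold_locales, unfold dim)
    show "k\<^sub>0 * norm x powr (- (real CARD('n) + 2 * s)) \<le> K x" if "x \<noteq> 0" for x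
      using k\<^sub>0(2) that by blast
  qed (fact s \<Omega> p K_pos K_int k\<^sub>0 g_cont a_pos q g_growth)+
  have c_pos: "0 < c" unfolding c by (rule embedding_const_pos)
  have "\<not> negligible \<Omega>" using \<Omega>(1,2) open_not_negligible by blast
  then have "emeasure lebesgue \<Omega> \<noteq> 0" using negligible_iff_emeasure0[OF Omega_sets(2)] by blast
  then have vol: "0 < measure lebesgue \<Omega>"
    using emeasure_Omega(2) unfolding measure_def enn2real_positive_iff zero_less_iff_neq_zero infinity_ennreal_def by blast
  let ?A = "a\<^sub>1 * c * measure lebesgue \<Omega> powr ((p - 1) / p)"
  let ?B = "a\<^sub>2 * c powr q * measure lebesgue \<Omega> powr ((p - q) / p)"
  have "0 < ?A" "0 < ?B" using a_pos c_pos vol by simp_all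
  from profile_attains_positive_max[OF p_gt_2 q(1) \<mu> c_pos this, folded h]
  obtain t\<^sub>0 where t\<^sub>0: "0 \<le> t\<^sub>0" "\<And>t. 0 \<le> t \<Longrightarrow> h \<mu> t \<le> h \<mu> t\<^sub>0" "0 < h \<mu> t\<^sub>0"
    by blast
  obtain b where b: "0 < b"
    "\<And>lam. 0 < lam \<Longrightarrow> lam < b \<Longrightarrow> \<exists>u. weak_solution \<Omega> K p \<mu> lam g u \<and> \<not> (AE x in lebesgue. u x = 0)"
    using nontrivial_solution_for_small_lambda[OF \<mu> G_liminf] by blast
  have "{0<..<min b (h \<mu> t\<^sub>0)} \<subseteq> {0<..<h \<mu> t\<^sub>0}" by auto
  moreover have "0 < min b (h \<mu> t\<^sub>0)" using b(1) t\<^sub>0(3) by simp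
  moreover have "\<forall>lam \<in> {0<..<min b (h \<mu> t\<^sub>0)}. \<exists>u. weak_solution \<Omega> K p \<mu> lam g u \<and> \<not> (AE x in lebesgue. u x = 0)"
    using b(2) by auto
  ultimately show "\<exists>t\<^sub>0 \<ge> 0. (\<forall>t \<ge> 0. h \<mu> t \<le> h \<mu> t\<^sub>0) \<and>
    (\<exists>a b. a < b \<and> {a<..<b} \<subseteq> {0<..<h \<mu> t\<^sub>0} \<and>
      (\<forall>lam \<in> {a<..<b}. \<exists>u. weak_solution \<Omega> K p \<mu> lam g u \<and> \<not> (AE x in lebesgue. u x = 0)))"
    using t\<^sub>0(1,2) by blast
qed

end
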